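(* Let $G$ be a locally compact group with identity $e$, and let $P\colon C_b(G)\to C_b(G)$ be a conditional expectation. Let $B=P(C_0(G))$, a $C^*$-subalgebra of $C_0(G)$, let $Q$ be the spectrum of $B$, identify $B$ with $C_0(Q)$ via the Gelfand transform, and let $\varphi\colon G\to Q$ be the canonical map ($\varphi(p)$ is the restriction to $B$ of evaluation at $p$). Assume that: (1) $P(\mathcal K_+(G))\subset \mathcal K_+(G)$, and for all $p\in G$ and $f\in\mathcal K_+(G)$ one has $P(f)(\varphi(p))>0$ whenever $f(p)>0$ (here $P(f)\in B$ is viewed as a function on $Q$; viewed as a function on $G$, $P(f)(\varphi(p))$ is just $P(f)(p)$); (2) for all $f\in C_b(G)$, $$\bigl((P\times \mathrm{id})\circ \Delta \circ P\bigr)(f)=\bigl((\mathrm{id} \times P)\circ \Delta \circ P\bigr)(f)= \bigl((P\times P)\circ \Delta \bigr)(f),$$ $$P(\check f) = \bigl(P(f)\bigr)\check{\ },$$ where $\Delta\colon C_b(G)\to C_b(G\times G)$ is $(\Delta f)(p_1,p_2)=f(p_1p_2)$ and $\check f(p)=f(p^{-1})$. Define $\tilde\Delta\colon C_b(Q)\to C_b(Q\times Q)$ by $\tilde \Delta(\tilde f)=\bigl((P\times P)\circ\Delta\bigr)(\tilde f)$ for $\tilde f\in C_b(Q)$; for $s\in Q$ define $\check s\in Q$ by $\check s(\tilde f)=\check{\tilde f}(s)$, $\tilde f\in B$; and define $\tilde e\in Q$ by $\tilde e(\tilde f)=\tilde f(e)$, $\tilde f\in B$. Then $(Q,\tilde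 e,\check{\ })$ is a locally compact hypergroup with comultiplication $\tilde\Delta$; that is, with the convolution on $M_b(Q)$ given by $\langle f,\mu_1*\mu_2\rangle=\int_{Q\times Q}(\tilde\Delta f)(s_1,s_2)\,d\mu_1(s_1)\,d\mu_2(s_2)$, $Q$ is a locally compact hypergroup with identity $\tilde e$ and involution $s\mapsto\check s$. Moreover, if $m$ is a left Haar measure on $G$ and $m\circ P=m$ (that is, $\langle Pf,m\rangle=\langle f,m\rangle$ for all $f\in\mathcal K(G)$), then the measure $\tilde m=\varphi_*(m)=m|_B$ on $Q$, i.e. $\langle \tilde f,\tilde m\rangle=\langle \tilde f\circ\varphi,m\rangle$ for $\tilde f\in\mathcal K(Q)$, is a left Haar measure on the hypergroup $Q$.
   Context: Notation. For a locally compact Hausdorff space $X$: $C(X)$, $C_b(X)$, $C_0(X)$ are the continuous, bounded continuous (sup norm), and vanishing-at-infinity continuous complex functions; $\mathcal K(X)$ is the space of compactly supported continuous functions and $\mathcal K_+(X)$ its subset of nonnegative functions. $M_b(X)$ is the space of bounded complex Radon measures, $M_p(X)$ the probability measures, $\varepsilon_s$ the Dirac measure at $s$, and $\langle f,\mu\rangle=\int f\,d\mu$. Conditional expectation. For a $C^*$-algebra $A$ and a $C^*$-subalgebra $D\subset A$, a bounded linear map $P\colon A\to D$ is a conditional expectation if: (i) $P$ is a projection onto $D$ of norm one ($P^2=P$, $\|P\|=1$); (ii) $P(a^*a)\ge 0$ for $a\in A$; (iii) $P(b_1ab_2)=b_1P(a)b_2$ for $a\in A$, $b_1,b_2\in D$;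 (iv) $P(a^* )P(a)\le P(a^*a)$. A conditional expectation $P\colon C_b(G)\to C_b(G)$ is one onto its range, a $C^*$-subalgebra of $C_b(G)$. Identifications. A function $\tilde f$ on $Q$ is identified with the function $\tilde f\circ\varphi$ on $G$ (so $B\cong C_0(Q)$), and similarly for functions on $Q\times Q$ and $G\times G$. For $F\in C_b(G\times G)$, $(P\times\mathrm{id})F$ is obtained by applying $P$ in the first variable with the second fixed, $(\mathrm{id}\times P)F$ by applying $P$ in the second variable, and $P\times P$ is the composition of these. Hypergroup. The set $\mathcal C$ of nonempty compact subsets of $Q$ carries the Michael topology, generated by the subbasis of all sets $\{F\in\mathcal C: F\subset W,\ F\cap V\ne\emptyset\}$, $V,W\subset Q$ open. A locally compact hypergroup is a locally compact Hausdorff space $Q$ with a convolution $*$ on $M_b(Q)$, determined by $\langle f,\mu*\nu\rangle=\int\int\langle f,\varepsilon_s*\varepsilon_t\rangle\,d\mu(s)\,d\nu(t)$, such that: (H1) $(M_b(Q),* )$ is an associative algebra over $\mathbb C$; (H2) for all $s,t\in Q$, $\varepsilon_s*\varepsilon_t\in M_p(Q)$ and its support is compact; (H3) $(s,t)\mapsto\varepsilon_s*\varepsilon_t$ is continuous from $Q\times Q$ to $M_p(Q)$ with the weak topology $\sigma(M_p(Q),C_0(Q))$; (H4) $(s,t)\mapsto\operatorname{supp}(\varepsilon_s*\varepsilon_t)$ is continuous from $Q\times Q$ to $\mathcal C$ with the Michael topology; (H5) there is a (necessarily unique) $e\in Q$ with $\varepsilon_e*\varepsilon_s=\varepsilon_s*\varepsilon_e=\varepsilon_s$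 for all $s$; (H6) there is a (necessarily unique) homeomorphism $s\mapsto\check s$ of $Q$ with $\check{\check s}=s$ and $(\varepsilon_s*\varepsilon_t)\check{\ }=\varepsilon_{\check t}*\varepsilon_{\check s}$, where $\langle f,\check\mu\rangle=\langle\check f,\mu\rangle$, $\check f(s)=f(\check s)$; (H7) $e\in\operatorname{supp}(\varepsilon_s*\varepsilon_t)$ if and only if $s=\check t$. A left Haar measure on a hypergroup $Q$ is a nonzero nonnegative Radon measure $\tilde m$ with $\varepsilon_s*\tilde m=\tilde m$ for all $s\in Q$, i.e. $\int_Q\langle f,\varepsilon_s*\varepsilon_t\rangle\,d\tilde m(t)=\int_Q f\,d\tilde m$ for all $f\in\mathcal K(Q)$ and $s\in Q$. *)

theory Defs
  imports "HOL-Analysis.Analysis"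
begin

section \<open>Function spaces on a topological space\<close>

definition Cb :: "'a topology \<Rightarrow> ('a \<Rightarrow> complex) set" where
  "Cb X = {f. continuous_map X euclidean f \<and> bounded (f ` topspace X)}"

definition C0 :: "'a topology \<Rightarrow> ('a \<Rightarrow> complex) set" where
  "C0 X = {f. continuous_map X euclidean f \<and>
              (\<forall>r>0. compactin X {x \<in> topspace X. r \<le> cmod (f x)})}"

definition Kc :: "'a topology \<Rightarrow> ('a \<Rightarrow> complex) set" where
  "Kc X = {f. continuous_map X euclidean f \<and>
              compactin X (X closure_of {x \<in> topspace X. f x \<noteq> 0})}"

definition Kc_plus :: "'a topology \<Rightarrow> ('a \<Rightarrow> complex) set" where
  "Kc_plus X = {f \<in> Kc X. \<forall>x\<in>topspace X. f x \<in> \<real>\<^sub>\<ge>\<^sub>0}"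


section \<open>Radon measures\<close>

definition borel_of :: "'a topology \<Rightarrow> 'a measure" where
  "borel_of X = sigma (topspace X) {U. openin X U}"

definition radon_measure :: "'a topology \<Rightarrow> 'a measure \<Rightarrow> bool" where
  "radon_measure X M \<longleftrightarrow>
     sets M = sets (borel_of X) \<and>
     (\<forall>K. compactin X K \<longrightarrow> emeasure M K < \<infinity>) \<and>
     (\<forall>A\<in>sets M. emeasure M A = (INF U\<in>{U. openin X U \<and> A \<subseteq> U}. emeasure M U)) \<and>
     (\<forall>U. openin X U \<longrightarrow> emeasure M U = (SUP K\<in>{K. compactin X K \<and> K \<subseteq> U}. emeasure M K))"

text \<open>A complex measure is a set function, taken to be \<open>0\<close> off the Borel sets so that equality of
  complex measures is equality of functions.\<close>

type_synonym 'a cmeas = "'a set \<Rightarrow> complex"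

definition complex_measure :: "'a topology \<Rightarrow> 'a cmeas \<Rightarrow> bool" where
  "complex_measure X \<mu> \<longleftrightarrow>
     (\<forall>A. A \<notin> sets (borel_of X) \<longrightarrow> \<mu> A = 0) \<and>
     (\<forall>F :: nat \<Rightarrow> 'a set. range F \<subseteq> sets (borel_of X) \<and> disjoint_family F \<longrightarrow>
        (\<lambda>n. \<mu> (F n)) sums \<mu> (\<Union>n. F n))"

text \<open>The positive variation in the Jordan decomposition of a signed measure \<open>\<rho>\<close>; the negative
  variation is the positive variation of \<open>- \<rho>\<close>. The conversion \<^const>\<open>ennreal\<close> sends negative
  values to \<open>0\<close>, which does not affect the supremum because \<open>\<rho> {} = 0\<close>.\<close>

definition pos_variation :: "'a topology \<Rightarrow> ('a set \<Rightarrow> real) \<Rightarrow> 'a measure" where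
  "pos_variation X \<rho> = measure_of (topspace X) (sets (borel_of X))
     (\<lambda>A. SUP B\<in>{B \<in> sets (borel_of X). B \<subseteq> A}. ennreal (\<rho> B))"

definition Mb :: "'a topology \<Rightarrow> 'a cmeas set" where
  "Mb X = {\<mu>. complex_measure X \<mu> \<and>
     radon_measure X (pos_variation X (\<lambda>A. Re (\<mu> A))) \<and>
     radon_measure X (pos_variation X (\<lambda>A. - Re (\<mu> A))) \<and>
     radon_measure X (pos_variation X (\<lambda>A. Im (\<mu> A))) \<and>
     radon_measure X (pos_variation X (\<lambda>A. - Im (\<mu> A)))}"

definition pairing :: "'a topology \<Rightarrow> ('a \<Rightarrow> complex) \<Rightarrow> 'a cmeas \<Rightarrow> complex" where
  "pairing X f \<mu> =
     (\<integral>x. f x \<partial>pos_variation X (\<lambda>A. Re (\<mu> A))) - (\<integral>x. f x \<partial>pos_variation X (\<lambda>A. - Re (\<mu> A)))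
     + \<i> * ((\<integral>x. f x \<partial>pos_variation X (\<lambda>A. Im (\<mu> A))) - (\<integral>x. f x \<partial>pos_variation X (\<lambda>A. - Im (\<mu> A))))"

definition Mp :: "'a topology \<Rightarrow> 'a cmeas set" where
  "Mp X = {\<mu> \<in> Mb X. (\<forall>A. \<mu> A \<in> \<real>\<^sub>\<ge>\<^sub>0) \<and> \<mu> (topspace X) = 1}"

definition dirac :: "'a topology \<Rightarrow> 'a \<Rightarrow> 'a cmeas" where
  "dirac X s = (\<lambda>A. if A \<in> sets (borel_of X) \<and> s \<in> A then 1 else 0)"

definition msupport :: "'a topology \<Rightarrow> 'a cmeas \<Rightarrow> 'a set" where
  "msupport X \<mu> = topspace X -
     \<Union>{U. openin X U \<and> (\<forall>A\<in>sets (borel_of X). A \<subseteq> U \<longrightarrow> \<mu> A = 0)}"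

text \<open>The topology \<open>\<sigma>(Mp X, C0 X)\<close>.\<close>

definition weak_topology :: "'a topology \<Rightarrow> 'a cmeas topology" where
  "weak_topology X = pullback_topology (Mp X) (\<lambda>\<mu>. \<lambda>f\<in>C0 X. pairing X f \<mu>)
     (product_topology (\<lambda>_. euclidean) (C0 X))"

definition michael_topology :: "'a topology \<Rightarrow> 'a set topology" where
  "michael_topology X = topology_generated_by
     {{F. compactin X F \<and> F \<noteq> {} \<and> F \<subseteq> W \<and> F \<inter> V \<noteq> {}} | V W. openin X V \<and> openin X W}"


section \<open>Locally compact hypergroups\<close>

text \<open>In \<open>H6\<close> the equality of \<open>(\<epsilon>\<^sub>s * \<epsilon>\<^sub>t)\<close> reflected and \<open>\<epsilon>\<^bsub>invol t\<^esub> * \<epsilon>\<^bsub>invol s\<^esub>\<close> is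
  spelled out through the pairing that defines the reflected measure.\<close>

locale hypergroup =
  fixes X :: "'a topology"
    and conv :: "'a cmeas \<Rightarrow> 'a cmeas \<Rightarrow> 'a cmeas"
    and e :: 'a
    and invol :: "'a \<Rightarrow> 'a"
  assumes locally_compact: "locally_compact_space X"
    and Hausdorff: "Hausdorff_space X"
    and conv_closed: "\<lbrakk>\<mu> \<in> Mb X; \<nu> \<in> Mb X\<rbrakk> \<Longrightarrow> conv \<mu> \<nu> \<in> Mb X"
    and conv_pairing: "\<lbrakk>\<mu> \<in> Mb X; \<nu> \<in> Mb X; f \<in> Cb X\<rbrakk> \<Longrightarrow>
      pairing X f (conv \<mu> \<nu>) =
      pairing X (\<lambda>t. pairing X (\<lambda>s. pairing X f (conv (dirac X s) (dirac X t))) \<mu>) \<nu>"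
    and H1_subspace: "(\<lambda>A. 0) \<in> Mb X"
      "\<lbrakk>\<mu> \<in> Mb X; \<nu> \<in> Mb X\<rbrakk> \<Longrightarrow> (\<lambda>A. \<mu> A + \<nu> A) \<in> Mb X"
      "\<mu> \<in> Mb X \<Longrightarrow> (\<lambda>A. c * \<mu> A) \<in> Mb X"
    and H1_bilinear:
      "\<lbrakk>\<mu> \<in> Mb X; \<mu>' \<in> Mb X; \<nu> \<in> Mb X\<rbrakk> \<Longrightarrow>
        conv (\<lambda>A. \<mu> A + \<mu>' A) \<nu> = (\<lambda>A. conv \<mu> \<nu> A + conv \<mu>' \<nu> A)"
      "\<lbrakk>\<mu> \<in> Mb X; \<nu> \<in> Mb X; \<nu>' \<in> Mb X\<rbrakk> \<Longrightarrow>
        conv \<mu> (\<lambda>A. \<nu> A + \<nu>' A) = (\<lambda>A. conv \<mu> \<nu> A + conv \<mu> \<nu>' A)"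
      "\<lbrakk>\<mu> \<in> Mb X; \<nu> \<in> Mb X\<rbrakk> \<Longrightarrow> conv (\<lambda>A. c * \<mu> A) \<nu> = (\<lambda>A. c * conv \<mu> \<nu> A)"
      "\<lbrakk>\<mu> \<in> Mb X; \<nu> \<in> Mb X\<rbrakk> \<Longrightarrow> conv \<mu> (\<lambda>A. c * \<nu> A) = (\<lambda>A. c * conv \<mu> \<nu> A)"
    and H1_assoc: "\<lbrakk>\<mu> \<in> Mb X; \<nu> \<in> Mb X; \<kappa> \<in> Mb X\<rbrakk> \<Longrightarrow>
      conv (conv \<mu> \<nu>) \<kappa> = conv \<mu> (conv \<nu> \<kappa>)"
    and H2: "\<lbrakk>s \<in> topspace X; t \<in> topspace X\<rbrakk> \<Longrightarrow>
      conv (dirac X s) (dirac X t) \<in> Mp X \<and>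
      compactin X (msupport X (conv (dirac X s) (dirac X t)))"
    and H3: "continuous_map (prod_topology X X) (weak_topology X)
      (\<lambda>(s, t). conv (dirac X s) (dirac X t))"
    and H4: "continuous_map (prod_topology X X) (michael_topology X)
      (\<lambda>(s, t). msupport X (conv (dirac X s) (dirac X t)))"
    and H5: "e \<in> topspace X"
      "s \<in> topspace X \<Longrightarrow> conv (dirac X e) (dirac X s) = dirac X s"
      "s \<in> topspace X \<Longrightarrow> conv (dirac X s) (dirac X e) = dirac X s"
    and H6: "homeomorphic_map X X invol"
      "s \<in> topspace X \<Longrightarrow> invol (invol s) = s"
      "\<lbrakk>s \<in> topspace X; t \<in> topspace X; f \<in> Cb X\<rbrakk> \<Longrightarrow>
        pairing X (f \<circ> invol) (conv (dirac X s) (dirac X t)) =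
        pairing X f (conv (dirac X (invol t)) (dirac X (invol s)))"
    and H7: "\<lbrakk>s \<in> topspace X; t \<in> topspace X\<rbrakk> \<Longrightarrow>
      e \<in> msupport X (conv (dirac X s) (dirac X t)) \<longleftrightarrow> s = invol t"

definition hypergroup_left_haar ::
  "'a topology \<Rightarrow> ('a cmeas \<Rightarrow> 'a cmeas \<Rightarrow> 'a cmeas) \<Rightarrow> 'a measure \<Rightarrow> bool" where
  "hypergroup_left_haar X conv M \<longleftrightarrow>
     radon_measure X M \<and> emeasure M (topspace X) \<noteq> 0 \<and>
     (\<forall>s\<in>topspace X. \<forall>f\<in>Kc X.
        (\<integral>t. pairing X f (conv (dirac X s) (dirac X t)) \<partial>M) = (\<integral>t. f t \<partial>M))"


section \<open>The algebra of bounded continuous functions and conditional expectations\<close>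

text \<open>The additive class \<^class>\<open>topological_group_add\<close> is the library's class of topological
  groups; it does not assume commutativity. Accordingly \<open>p\<^sub>1 p\<^sub>2\<close>, \<open>p\<close> inverse and the identity are
  written \<open>p\<^sub>1 + p\<^sub>2\<close>, \<open>- p\<close> and \<open>0\<close>.\<close>

unbundle bcontfun.lifting

lemma bcontfun_continuous: "f \<in> bcontfun \<Longrightarrow> continuous_on UNIV f"
  by (simp add: bcontfun_def)

lemma bcontfun_bound:
  assumes "f \<in> bcontfun"
  obtains a where "0 \<le> a" "\<And>x. norm (f x) \<le> a"
proof -
  have "bounded (range f)"
    using assms by (simp add: bcontfun_def)
  then obtain a where "\<And>x. norm (f x) \<le> a"
    by (meson bounded_iff rangeI)
  then show thesis
    by (meson norm_ge_zero order_trans that)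
qed

lift_definition bc_mult ::
  "('g::topological_space \<Rightarrow>\<^sub>C complex) \<Rightarrow> ('g \<Rightarrow>\<^sub>C complex) \<Rightarrow> ('g \<Rightarrow>\<^sub>C complex)"
  is "\<lambda>f g x. f x * g x"
proof -
  fix f g :: "'g \<Rightarrow> complex"
  assume f: "f \<in> bcontfun" and g: "g \<in> bcontfun"
  obtain a where a: "0 \<le> a" "\<And>x. norm (f x) \<le> a"
    using bcontfun_bound[OF f] by blast
  obtain b where b: "\<And>x. norm (g x) \<le> b"
    using bcontfun_bound[OF g] by blast
  have "norm (f x * g x) \<le> a * b" for x
    unfolding norm_mult by (intro mult_mono a b norm_ge_zero)
  then show "(\<lambda>x. f x * g x) \<in> bcontfun"
    by (rule bcontfun_normI[OF continuous_on_mult[OF f[THEN bcontfun_continuous] g[THEN bcontfun_continuous]]])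
qed

lift_definition bc_scale ::
  "complex \<Rightarrow> ('g::topological_space \<Rightarrow>\<^sub>C complex) \<Rightarrow> ('g \<Rightarrow>\<^sub>C complex)"
  is "\<lambda>c f x. c * f x"
proof -
  fix c :: complex and f :: "'g \<Rightarrow> complex"
  assume f: "f \<in> bcontfun"
  obtain a where a: "\<And>x. norm (f x) \<le> a"
    using bcontfun_bound[OF f] by blast
  have "norm (c * f x) \<le> norm c * a" for x
    unfolding norm_mult by (intro mult_left_mono a norm_ge_zero)
  then show "(\<lambda>x. c * f x) \<in> bcontfun"
    by (rule bcontfun_normI[OF continuous_on_mult_left[OF f[THEN bcontfun_continuous]]])
qed

lift_definition bc_cnj :: "('g::topological_space \<Rightarrow>\<^sub>C complex) \<Rightarrow> ('g \<Rightarrow>\<^sub>C complex)"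
  is "\<lambda>f x. cnj (f x)"
proof -
  fix f :: "'g \<Rightarrow> complex"
  assume f: "f \<in> bcontfun"
  obtain a where a: "\<And>x. norm (f x) \<le> a"
    using bcontfun_bound[OF f] by blast
  have "norm (cnj (f x)) \<le> a" for x
    by (simp add: a)
  then show "(\<lambda>x. cnj (f x)) \<in> bcontfun"
    by (rule bcontfun_normI[OF continuous_on_cnj[OF f[THEN bcontfun_continuous]]])
qed

lift_definition bc_check :: "('g::topological_group_add \<Rightarrow>\<^sub>C complex) \<Rightarrow> ('g \<Rightarrow>\<^sub>C complex)"
  is "\<lambda>f p. f (- p)"
proof -
  fix f :: "'g \<Rightarrow> complex"
  assume f: "f \<in> bcontfun"
  obtain a where a: "\<And>x. norm (f x) \<le> a"
    using bcontfun_bound[OF f] by blast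
  have "continuous_on UNIV (\<lambda>p. f (- p))"
    by (rule continuous_on_compose2[OF f[THEN bcontfun_continuous] continuous_on_minus[OF continuous_on_id]])
      simp
  then show "(\<lambda>p. f (- p)) \<in> bcontfun"
    by (rule bcontfun_normI) (rule a)
qed

lift_definition comult ::
  "('g::topological_group_add \<Rightarrow>\<^sub>C complex) \<Rightarrow> (('g \<times> 'g) \<Rightarrow>\<^sub>C complex)"
  is "\<lambda>f (p\<^sub>1, p\<^sub>2). f (p\<^sub>1 + p\<^sub>2)"
proof -
  fix f :: "'g \<Rightarrow> complex"
  assume f: "f \<in> bcontfun"
  obtain a where a: "\<And>x. norm (f x) \<le> a"
    using bcontfun_bound[OF f] by blast
  have "continuous_on UNIV (\<lambda>p::'g \<times> 'g. f (fst p + snd p))"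
    by (rule continuous_on_compose2[OF f[THEN bcontfun_continuous]
          continuous_on_add[OF continuous_on_fst[OF continuous_on_id] continuous_on_snd[OF continuous_on_id]]])
      simp
  then show "(\<lambda>(p\<^sub>1, p\<^sub>2). f (p\<^sub>1 + p\<^sub>2)) \<in> bcontfun"
    unfolding case_prod_unfold by (rule bcontfun_normI) (rule a)
qed

text \<open>\<^const>\<open>closed\<close> refers to the topology of the sup norm.\<close>

definition cstar_subalgebra :: "('g::topological_space \<Rightarrow>\<^sub>C complex) set \<Rightarrow> bool" where
  "cstar_subalgebra D \<longleftrightarrow> 0 \<in> D \<and> closed D \<and>
     (\<forall>f\<in>D. \<forall>g\<in>D. f + g \<in> D \<and> bc_mult f g \<in> D) \<and>
     (\<forall>f\<in>D. bc_cnj f \<in> D \<and> (\<forall>c. bc_scale c f \<in> D))"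

text \<open>The order of the \<open>C\<^sup>*\<close>-algebra of bounded continuous functions is the pointwise one.\<close>

definition bc_le :: "('g::topological_space \<Rightarrow>\<^sub>C complex) \<Rightarrow> ('g \<Rightarrow>\<^sub>C complex) \<Rightarrow> bool" where
  "bc_le f g \<longleftrightarrow> (\<forall>x. apply_bcontfun (g - f) x \<in> \<real>\<^sub>\<ge>\<^sub>0)"

definition cond_expectation ::
  "('g::topological_space \<Rightarrow>\<^sub>C complex) set \<Rightarrow>
   (('g \<Rightarrow>\<^sub>C complex) \<Rightarrow> ('g \<Rightarrow>\<^sub>C complex)) \<Rightarrow> bool" where
  "cond_expectation D P \<longleftrightarrow>
     cstar_subalgebra D \<and>
     bounded_linear P \<and> (\<forall>c f. P (bc_scale c f) = bc_scale c (P f)) \<and>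
     range P = D \<and> (\<forall>f. P (P f) = P f) \<and> onorm P = 1 \<and>
     (\<forall>a. bc_le 0 (P (bc_mult (bc_cnj a) a))) \<and>
     (\<forall>a. \<forall>b\<^sub>1\<in>D. \<forall>b\<^sub>2\<in>D.
        P (bc_mult (bc_mult b\<^sub>1 a) b\<^sub>2) = bc_mult (bc_mult b\<^sub>1 (P a)) b\<^sub>2) \<and>
     (\<forall>a. bc_le (bc_mult (P (bc_cnj a)) (P a)) (P (bc_mult (bc_cnj a) a)))"

text \<open>The slice maps \<open>P \<times> id\<close> and \<open>id \<times> P\<close>. Slices of a function in \<open>C\<^sub>b(G \<times> G)\<close> are in
  \<open>C\<^sub>b(G)\<close>. In the composition \<open>P \<times> P\<close> the intermediate slices are again in \<open>C\<^sub>b(G)\<close>, and the order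
  of the factors is immaterial, as soon as \<open>P\<close> preserves \<open>K\<^sub>+(G)\<close> and \<open>P f\<close> is positive
  wherever \<open>f \<in> K\<^sub>+(G)\<close> is: every \<open>p\<close> then has some \<open>b \<in> K\<^sub>+(G)\<close> with \<open>P b = b\<close> and
  \<open>b p \<noteq> 0\<close>, and \<open>b \<sqdot> P f = P (b f)\<close> shows that \<open>f \<mapsto> P f p\<close> depends
  only on the restriction of \<open>f\<close> to a compact set.\<close>

definition P_id ::
  "(('g::topological_space \<Rightarrow>\<^sub>C complex) \<Rightarrow> ('g \<Rightarrow>\<^sub>C complex)) \<Rightarrow>
   ('g \<times> 'g \<Rightarrow> complex) \<Rightarrow> ('g \<times> 'g \<Rightarrow> complex)" where
  "P_id P F = (\<lambda>(p\<^sub>1, p\<^sub>2). apply_bcontfun (P (Bcontfun (\<lambda>q. F (q, p\<^sub>2)))) p\<^sub>1)"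

definition id_P ::
  "(('g::topological_space \<Rightarrow>\<^sub>C complex) \<Rightarrow> ('g \<Rightarrow>\<^sub>C complex)) \<Rightarrow>
   ('g \<times> 'g \<Rightarrow> complex) \<Rightarrow> ('g \<times> 'g \<Rightarrow> complex)" where
  "id_P P F = (\<lambda>(p\<^sub>1, p\<^sub>2). apply_bcontfun (P (Bcontfun (\<lambda>q. F (p\<^sub>1, q)))) p\<^sub>2)"

definition P_P ::
  "(('g::topological_space \<Rightarrow>\<^sub>C complex) \<Rightarrow> ('g \<Rightarrow>\<^sub>C complex)) \<Rightarrow>
   ('g \<times> 'g \<Rightarrow> complex) \<Rightarrow> ('g \<times> 'g \<Rightarrow> complex)" where
  "P_P P F = P_id P (id_P P F)"


section \<open>The spectrum\<close>

text \<open>Characters are extensional on \<open>B\<close>, so that they are determined by their values on \<open>B\<close> and the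
  Gelfand topology is the trace of the product topology.\<close>

definition characters :: "('g::topological_space \<Rightarrow>\<^sub>C complex) set \<Rightarrow> (('g \<Rightarrow>\<^sub>C complex) \<Rightarrow> complex) set"
  where
  "characters B = {h \<in> extensional B.
     (\<forall>f\<in>B. \<forall>g\<in>B. h (f + g) = h f + h g \<and> h (bc_mult f g) = h f * h g) \<and>
     (\<forall>c. \<forall>f\<in>B. h (bc_scale c f) = c * h f) \<and>
     (\<exists>f\<in>B. h f \<noteq> 0)}"

definition spectrum :: "('g::topological_space \<Rightarrow>\<^sub>C complex) set \<Rightarrow> (('g \<Rightarrow>\<^sub>C complex) \<Rightarrow> complex) topology"
  where
  "spectrum B = subtopology (product_topology (\<lambda>_. euclidean) B) (characters B)"

definition algB ::
  "(('g::topological_space \<Rightarrow>\<^sub>C complex) \<Rightarrow> ('g \<Rightarrow>\<^sub>C complex)) \<Rightarrow> ('g \<Rightarrow>\<^sub>C complex) set" where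
  "algB P = P ` {f. apply_bcontfun f \<in> C0 euclidean}"

abbreviation specQ ::
  "(('g::topological_space \<Rightarrow>\<^sub>C complex) \<Rightarrow> ('g \<Rightarrow>\<^sub>C complex)) \<Rightarrow> (('g \<Rightarrow>\<^sub>C complex) \<Rightarrow> complex) topology"
  where
  "specQ P \<equiv> spectrum (algB P)"

definition can ::
  "(('g::topological_space \<Rightarrow>\<^sub>C complex) \<Rightarrow> ('g \<Rightarrow>\<^sub>C complex)) \<Rightarrow> 'g \<Rightarrow> (('g \<Rightarrow>\<^sub>C complex) \<Rightarrow> complex)"
  where
  "can P p = (\<lambda>b\<in>algB P. apply_bcontfun b p)"

definition Q_unit ::
  "(('g::topological_group_add \<Rightarrow>\<^sub>C complex) \<Rightarrow> ('g \<Rightarrow>\<^sub>C complex)) \<Rightarrow> (('g \<Rightarrow>\<^sub>C complex) \<Rightarrow> complex)"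
  where
  "Q_unit P = (\<lambda>b\<in>algB P. apply_bcontfun b 0)"

definition Q_check ::
  "(('g::topological_group_add \<Rightarrow>\<^sub>C complex) \<Rightarrow> ('g \<Rightarrow>\<^sub>C complex)) \<Rightarrow>
   (('g \<Rightarrow>\<^sub>C complex) \<Rightarrow> complex) \<Rightarrow> (('g \<Rightarrow>\<^sub>C complex) \<Rightarrow> complex)" where
  "Q_check P s = (\<lambda>b\<in>algB P. s (bc_check b))"

text \<open>A function \<open>f\<close> on the spectrum is read as the function \<open>f \<circ> can P\<close> on the group. The result is
  brought back to the spectrum by evaluating at arbitrary preimages under \<open>can P\<close>; that the choice
  does not matter is part of the theorem.\<close>

definition Q_comult ::
  "(('g::topological_group_add \<Rightarrow>\<^sub>C complex) \<Rightarrow> ('g \<Rightarrow>\<^sub>C complex)) \<Rightarrow>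
   ((('g \<Rightarrow>\<^sub>C complex) \<Rightarrow> complex) \<Rightarrow> complex) \<Rightarrow>
   (('g \<Rightarrow>\<^sub>C complex) \<Rightarrow> complex) \<times> (('g \<Rightarrow>\<^sub>C complex) \<Rightarrow> complex) \<Rightarrow> complex" where
  "Q_comult P f = (\<lambda>(s, t).
     P_P P (apply_bcontfun (comult (Bcontfun (f \<circ> can P))))
       (inv_into UNIV (can P) s, inv_into UNIV (can P) t))"

definition is_Q_conv ::
  "(('g::topological_group_add \<Rightarrow>\<^sub>C complex) \<Rightarrow> ('g \<Rightarrow>\<^sub>C complex)) \<Rightarrow>
   (('g \<Rightarrow>\<^sub>C complex) \<Rightarrow> complex) cmeas \<Rightarrow> (('g \<Rightarrow>\<^sub>C complex) \<Rightarrow> complex) cmeas \<Rightarrow>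
   (('g \<Rightarrow>\<^sub>C complex) \<Rightarrow> complex) cmeas \<Rightarrow> bool" where
  "is_Q_conv P \<mu>\<^sub>1 \<mu>\<^sub>2 \<nu> \<longleftrightarrow> \<nu> \<in> Mb (specQ P) \<and>
     (\<forall>f\<in>Cb (specQ P). pairing (specQ P) f \<nu> =
        pairing (specQ P) (\<lambda>s\<^sub>2. pairing (specQ P) (\<lambda>s\<^sub>1. Q_comult P f (s\<^sub>1, s\<^sub>2)) \<mu>\<^sub>1) \<mu>\<^sub>2)"

definition Q_conv ::
  "(('g::topological_group_add \<Rightarrow>\<^sub>C complex) \<Rightarrow> ('g \<Rightarrow>\<^sub>C complex)) \<Rightarrow>
   (('g \<Rightarrow>\<^sub>C complex) \<Rightarrow> complex) cmeas \<Rightarrow> (('g \<Rightarrow>\<^sub>C complex) \<Rightarrow> complex) cmeas \<Rightarrow>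
   (('g \<Rightarrow>\<^sub>C complex) \<Rightarrow> complex) cmeas" where
  "Q_conv P \<mu>\<^sub>1 \<mu>\<^sub>2 = (THE \<nu>. is_Q_conv P \<mu>\<^sub>1 \<mu>\<^sub>2 \<nu>)"


section \<open>Haar measures on groups\<close>

definition group_left_haar :: "'g::topological_group_add measure \<Rightarrow> bool" where
  "group_left_haar m \<longleftrightarrow>
     radon_measure euclidean m \<and> emeasure m UNIV \<noteq> 0 \<and>
     (\<forall>a. \<forall>A\<in>sets m. emeasure m ((+) a ` A) = emeasure m A)"

end

theory Submission
  imports Defs
begin

text \<open>Write \<open>\<phi>\<close> for the canonical map \<open>can P\<close> and \<open>Q\<close> for the spectrum. The structure of \<open>P\<close> is
  that of an average over the fibres of \<open>\<phi>\<close>. For each \<open>p\<close> the functional \<open>f \<mapsto> P f p\<close> is positive and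
  unital, and it multiplies through functions \<open>b\<close> in the range of \<open>P\<close>. Hence \<open>\<bar>b - b p\<bar>\<^sup>2\<close>, which is in
  the range and vanishes at \<open>p\<close>, has value \<open>0\<close> under it; as such functions dominate on compact sets
  everything that vanishes on the fibre of \<open>p\<close>, the functional only sees this fibre
  (\<open>E_zero_on_fib\<close>). Hypothesis (1) makes \<open>P\<close> unital, the fibres compact, and the support of the
  functional the whole fibre (\<open>E_nonzero\<close>). So the range of \<open>P\<close> consists exactly of the bounded
  continuous functions that are constant on fibres. Every character of \<open>B\<close> is an evaluation
  (\<open>character_is_evaluation\<close>) and \<open>\<phi>\<close> is a proper surjection (\<open>proper_can\<close>), so these are
  exactly the functions \<open>f \<circ> \<phi>\<close> with \<open>f\<close> bounded and continuous on \<open>Q\<close>.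

  For such \<open>u = f \<circ> \<phi>\<close> hypothesis (2) says that the averages of \<open>u (a + y)\<close> over \<open>y\<close> in the fibre of
  \<open>b\<close>, of \<open>u (x + b)\<close> over \<open>x\<close> in the fibre of \<open>a\<close>, and of \<open>u (x + y)\<close> over both, coincide. This common
  value is the comultiplication of \<open>f\<close> at \<open>(\<phi> a, \<phi> b)\<close>, and all hypergroup axioms are read off from
  its three forms: it depends on fibres only; coassociativity is associativity of the group;
  averaging \<open>u (0 + y)\<close> or \<open>u (x + 0)\<close> gives back \<open>u\<close>, whence the unit; and the support of
  \<open>\<epsilon>\<^sub>s * \<epsilon>\<^sub>t\<close> is \<open>\<phi>\<close> of the sum of the two fibres, and also \<open>\<phi> (a + fibre)\<close> for any single \<open>a\<close> over
  \<open>s\<close>. Since convolving with the unit does nothing, the fibre of \<open>0\<close> is absorbed by all fibres, and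
  \<open>\<phi> (x + y) = \<phi> 0\<close> forces \<open>y\<close> into the fibre of \<open>- x\<close>; this is the axiom that ties the unit to the
  involution. Invariance of the image of a Haar measure is \<open>m \<circ> P = m\<close> followed by left translation.

  What remains is measure theory on a locally compact Hausdorff space. Complex Radon measures are
  linear combinations of finite positive ones (\<open>Mb_induct\<close>) and are determined by their integrals
  (\<open>Mb_eqI\<close>). Iterating the comultiplication over two finite positive measures gives a positive
  functional, and a representation theorem for tight functionals (\<open>riesz_representation\<close>) turns
  it into a measure; this gives the convolution. Its associativity is coassociativity together with an
  exchange of the comultiplication with an integral (\<open>F_pairing_exchange\<close>), which holds since at
  each point the comultiplication only involves a compact set. These arguments are carried
  out for an abstract comultiplication in the locale \<open>comultiplication\<close>, of which the
  spectrum is then an instance.\<close>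

section \<open>Borel sets and signed measures\<close>

lemma space_borel_of [simp]: "space (borel_of X) = topspace X"
  unfolding borel_of_def by (simp add: space_measure_of_conv)

lemma sets_borel_of: "sets (borel_of X) = sigma_sets (topspace X) {U. openin X U}"
  unfolding borel_of_def by (rule sets_measure_of) (auto dest: openin_subset)

lemma openin_borel_of: "openin X U \<Longrightarrow> U \<in> sets (borel_of X)"
  by (simp add: sets_borel_of)

lemma closedin_borel_of:
  assumes "closedin X C"
  shows "C \<in> sets (borel_of X)"
proof -
  have "C = space (borel_of X) - (topspace X - C)"
    using closedin_subset[OF assms] by auto
  also have "\<dots> \<in> sets (borel_of X)"
    using assms by (intro sets.compl_sets openin_borel_of) (simp add: closedin_def)
  finally show ?thesis .
qed

lemma borel_of_subset: "A \<in> sets (borel_of X) \<Longrightarrow> A \<subseteq> topspace X"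
  using sets.sets_into_space[of A "borel_of X"] by simp

lemma topspace_borel_of [simp]: "topspace X \<in> sets (borel_of X)"
  by (simp add: openin_borel_of)

lemma continuous_map_borel_measurable:
  assumes "continuous_map X euclidean f"
  shows "f \<in> borel_measurable (borel_of X)"
  unfolding borel_def
proof (rule measurable_measure_of)
  fix S :: "'b set" assume "S \<in> {S. open S}"
  then have "openin X {x \<in> topspace X. f x \<in> S}"
    using assms by (simp add: continuous_map)
  moreover have "f -` S \<inter> space (borel_of X) = {x \<in> topspace X. f x \<in> S}"
    by auto
  ultimately show "f -` S \<inter> space (borel_of X) \<in> sets (borel_of X)"
    by (simp add: openin_borel_of)
qed auto

text \<open>The real-valued counterpart of a complex measure: real and imaginary parts of complex measures are
  of this kind.\<close>

definition signed_measure :: "'a topology \<Rightarrow> ('a set \<Rightarrow> real) \<Rightarrow> bool" where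
  "signed_measure X \<rho> \<longleftrightarrow>
     (\<forall>A. A \<notin> sets (borel_of X) \<longrightarrow> \<rho> A = 0) \<and>
     (\<forall>F :: nat \<Rightarrow> 'a set. range F \<subseteq> sets (borel_of X) \<and> disjoint_family F \<longrightarrow>
        (\<lambda>n. \<rho> (F n)) sums \<rho> (\<Union>n. F n))"

lemma signed_measure_uminus: "signed_measure X \<rho> \<Longrightarrow> signed_measure X (\<lambda>A. - \<rho> A)"
  unfolding signed_measure_def by (auto intro!: sums_minus)

lemma complex_measure_iff_signed:
  "complex_measure X \<mu> \<longleftrightarrow>
     signed_measure X (\<lambda>A. Re (\<mu> A)) \<and> signed_measure X (\<lambda>A. Im (\<mu> A))"
  unfolding signed_measure_def complex_measure_def
  by (auto simp: sums_complex_iff complex_eq_iff)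

lemma signed_measure_empty:
  assumes "signed_measure X \<rho>"
  shows "\<rho> {} = 0"
proof -
  have "range (\<lambda>n::nat. {}) \<subseteq> sets (borel_of X) \<and> disjoint_family (\<lambda>n::nat. {} :: 'a set)"
    by (auto simp: disjoint_family_on_def)
  then have "(\<lambda>n::nat. \<rho> {}) sums \<rho> (\<Union>n::nat. {})"
    using assms unfolding signed_measure_def by blast
  then show ?thesis
    using sums_summable summable_const_iff by blast
qed

lemma signed_measure_Un:
  assumes "signed_measure X \<rho>" "A \<in> sets (borel_of X)" "B \<in> sets (borel_of X)" "A \<inter> B = {}"
  shows "\<rho> (A \<union> B) = \<rho> A + \<rho> B"
proof -
  have "range (binaryset A B) \<subseteq> sets (borel_of X)" "disjoint_family (binaryset A B)"
    using assms by (auto simp: range_binaryset_eq disjoint_family_on_def binaryset_def)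
  then have "(\<lambda>n. \<rho> (binaryset A B n)) sums \<rho> (\<Union>n. binaryset A B n)"
    using assms(1) unfolding signed_measure_def by blast
  moreover have "(\<lambda>n. \<rho> (binaryset A B n)) sums (\<rho> A + \<rho> B)"
    by (rule binaryset_sums) (rule signed_measure_empty[OF assms(1)])
  ultimately show ?thesis
    by (simp add: UN_binaryset_eq sums_unique2)
qed

lemma signed_measure_Diff:
  assumes "signed_measure X \<rho>" "A \<in> sets (borel_of X)" "B \<in> sets (borel_of X)" "B \<subseteq> A"
  shows "\<rho> (A - B) = \<rho> A - \<rho> B"
proof -
  have "(A - B) \<union> B = A" "(A - B) \<inter> B = {}" using assms(4) by auto
  then show ?thesis
    using signed_measure_Un[OF assms(1), of "A - B" B] assms(2,3) by auto
qed

section \<open>The Jordan decomposition\<close>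

text \<open>The set function behind the positive variation. It is studied before it is known to be a measure,
  which is what makes \<open>pos_variation\<close> meaningful.\<close>

definition upper_var :: "'a topology \<Rightarrow> ('a set \<Rightarrow> real) \<Rightarrow> 'a set \<Rightarrow> ennreal" where
  "upper_var X \<rho> A = (SUP B\<in>{B \<in> sets (borel_of X). B \<subseteq> A}. ennreal (\<rho> B))"

lemma upper_var_ge: "B \<in> sets (borel_of X) \<Longrightarrow> B \<subseteq> A \<Longrightarrow> ennreal (\<rho> B) \<le> upper_var X \<rho> A"
  unfolding upper_var_def by (intro SUP_upper) auto

lemma upper_var_empty:
  assumes "signed_measure X \<rho>"
  shows "upper_var X \<rho> {} = 0"
proof -
  have "{B \<in> sets (borel_of X). B \<subseteq> {}} = {{}}" by auto
  then show ?thesis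
    unfolding upper_var_def by (simp add: signed_measure_empty[OF assms])
qed

text \<open>Competitors for the two suprema combine to one for the union; a competitor with negative value can
  be replaced by the empty set.\<close>

lemma upper_var_Un_ge:
  assumes s: "signed_measure X \<rho>" and disj: "A \<inter> B = {}"
  shows "upper_var X \<rho> A + upper_var X \<rho> B \<le> upper_var X \<rho> (A \<union> B)"
proof -
  have *: "ennreal (\<rho> C) + ennreal (\<rho> D) \<le> upper_var X \<rho> (A \<union> B)"
    if C: "C \<in> sets (borel_of X)" "C \<subseteq> A" and D: "D \<in> sets (borel_of X)" "D \<subseteq> B" for C D
  proof (cases "\<rho> C \<le> 0 \<or> \<rho> D \<le> 0")
    case True
    then show ?thesis
      using upper_var_ge[OF C(1), of "A \<union> B" \<rho>] upper_var_ge[OF D(1), of "A \<union> B" \<rho>] C D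
      by (auto simp: ennreal_neg le_supI1 le_supI2)
  next
    case False
    have "C \<inter> D = {}" using C D disj by auto
    then have "\<rho> (C \<union> D) = \<rho> C + \<rho> D"
      using signed_measure_Un[OF s C(1) D(1)] by simp
    then have "ennreal (\<rho> C) + ennreal (\<rho> D) = ennreal (\<rho> (C \<union> D))"
      using False by (simp add: ennreal_plus)
    also have "\<dots> \<le> upper_var X \<rho> (A \<union> B)"
      using C D by (intro upper_var_ge) auto
    finally show ?thesis .
  qed
  have ne: "{C \<in> sets (borel_of X). C \<subseteq> A} \<noteq> {}" "{C \<in> sets (borel_of X). C \<subseteq> B} \<noteq> {}"
    by blast+
  have "upper_var X \<rho> A + upper_var X \<rho> B =
    (SUP C\<in>{C \<in> sets (borel_of X). C \<subseteq> A}. ennreal (\<rho> C) + upper_var X \<rho> B)"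
    unfolding upper_var_def[of X \<rho> A] by (rule ennreal_SUP_add_left[symmetric, OF ne(1)]) 
  also have "\<dots> \<le> upper_var X \<rho> (A \<union> B)"
  proof (rule SUP_least)
    fix C assume C: "C \<in> {C \<in> sets (borel_of X). C \<subseteq> A}"
    have "ennreal (\<rho> C) + upper_var X \<rho> B =
      (SUP D\<in>{C \<in> sets (borel_of X). C \<subseteq> B}. ennreal (\<rho> C) + ennreal (\<rho> D))"
      unfolding upper_var_def by (rule ennreal_SUP_add_right[OF ne(2)])
    also have "\<dots> \<le> upper_var X \<rho> (A \<union> B)"
      using C * by (intro SUP_least) auto
    finally show "ennreal (\<rho> C) + upper_var X \<rho> B \<le> upper_var X \<rho> (A \<union> B)" .
  qed
  finally show ?thesis .
qed

lemma upper_var_mono: "A \<subseteq> B \<Longrightarrow> upper_var X \<rho> A \<le> upper_var X \<rho> B"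
  unfolding upper_var_def by (rule SUP_subset_mono) auto

text \<open>Superadditivity passes to the limit from finite unions; for the converse, a single competitor for the
  union is cut along the pieces.\<close>

lemma countably_additive_upper_var:
  assumes s: "signed_measure X \<rho>"
  shows "countably_additive (sets (borel_of X)) (upper_var X \<rho>)"
proof (rule countably_additiveI)
  fix F :: "nat \<Rightarrow> 'a set"
  assume F: "range F \<subseteq> sets (borel_of X)" "disjoint_family F" "\<Union> (range F) \<in> sets (borel_of X)"
  show "(\<Sum>n. upper_var X \<rho> (F n)) = upper_var X \<rho> (\<Union> (range F))"
  proof (rule antisym)
    have part: "(\<Sum>n<N. upper_var X \<rho> (F n)) \<le> upper_var X \<rho> (\<Union>n<N. F n)" for N
    proof (induction N)
      case 0
      then show ?case by simp
    next
      case (Suc N)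
      have "(\<Union>n<N. F n) \<inter> F N = {}"
        using F(2) unfolding disjoint_family_on_def by (auto simp: disjoint_iff) (metis less_irrefl)
      then have "upper_var X \<rho> (\<Union>n<N. F n) + upper_var X \<rho> (F N) \<le> upper_var X \<rho> ((\<Union>n<N. F n) \<union> F N)"
        by (rule upper_var_Un_ge[OF s])
      moreover have "(\<Union>n<Suc N. F n) = (\<Union>n<N. F n) \<union> F N"
        by (auto simp: less_Suc_eq)
      ultimately show ?case
        using Suc by (simp add: order_trans[OF add_right_mono])
    qed
    have "(\<Sum>n<N. upper_var X \<rho> (F n)) \<le> upper_var X \<rho> (\<Union> (range F))" for N
      using part[of N] by (rule order_trans) (rule upper_var_mono, auto)
    then show "(\<Sum>n. upper_var X \<rho> (F n)) \<le> upper_var X \<rho> (\<Union> (range F))"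
      by (rule suminf_le_const[OF summableI])
  next
    show "upper_var X \<rho> (\<Union> (range F)) \<le> (\<Sum>n. upper_var X \<rho> (F n))"
      unfolding upper_var_def[of X \<rho> "\<Union> (range F)"]
    proof (rule SUP_least)
      fix B assume "B \<in> {B \<in> sets (borel_of X). B \<subseteq> \<Union> (range F)}"
      then have B: "B \<in> sets (borel_of X)" "B \<subseteq> \<Union> (range F)" by auto
      have "range (\<lambda>n. B \<inter> F n) \<subseteq> sets (borel_of X)" "disjoint_family (\<lambda>n. B \<inter> F n)"
        using F B(1) by (auto simp: disjoint_family_on_def)
      then have "(\<lambda>n. \<rho> (B \<inter> F n)) sums \<rho> (\<Union>n. B \<inter> F n)"
        using s unfolding signed_measure_def by blast
      moreover have "(\<Union>n. B \<inter> F n) = B" using B by auto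
      ultimately have lim: "(\<lambda>N. \<Sum>n<N. \<rho> (B \<inter> F n)) \<longlonglongrightarrow> \<rho> B"
        by (simp add: sums_def)
      have "(\<lambda>N. ennreal (\<Sum>n<N. \<rho> (B \<inter> F n))) \<longlonglongrightarrow> ennreal (\<rho> B)"
        by (rule tendsto_ennrealI[OF lim])
      moreover have "ennreal (\<Sum>n<N. \<rho> (B \<inter> F n)) \<le> (\<Sum>n. upper_var X \<rho> (F n))" for N
      proof -
        have "ennreal (\<Sum>n<N. \<rho> (B \<inter> F n)) \<le> ennreal (\<Sum>n<N. max 0 (\<rho> (B \<inter> F n)))"
          by (intro ennreal_leI sum_mono) auto
        also have "\<dots> = (\<Sum>n<N. ennreal (\<rho> (B \<inter> F n)))"
          by (simp add: sum_ennreal[symmetric] ennreal_max_0)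
        also have "\<dots> \<le> (\<Sum>n<N. upper_var X \<rho> (F n))"
          using F B by (intro sum_mono upper_var_ge) auto
        also have "\<dots> \<le> (\<Sum>n. upper_var X \<rho> (F n))"
          by (rule sum_le_suminf) auto
        finally show ?thesis .
      qed
      ultimately show "ennreal (\<rho> B) \<le> (\<Sum>n. upper_var X \<rho> (F n))"
        by (intro LIMSEQ_le_const2) auto
    qed
  qed
qed

lemma sets_pos_variation [simp]: "sets (pos_variation X \<rho>) = sets (borel_of X)"
  and space_pos_variation [simp]: "space (pos_variation X \<rho>) = topspace X"
  unfolding pos_variation_def using sets.space_closed[of "borel_of X"] sets.sigma_sets_eq[of "borel_of X"]
  by (auto simp: space_measure_of_conv sets_measure_of_conv)

lemma emeasure_pos_variation:
  assumes "signed_measure X \<rho>" "A \<in> sets (borel_of X)"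
  shows "emeasure (pos_variation X \<rho>) A = upper_var X \<rho> A"
proof -
  have "pos_variation X \<rho> = measure_of (topspace X) (sets (borel_of X)) (upper_var X \<rho>)"
    unfolding pos_variation_def upper_var_def ..
  then show ?thesis
  proof (rule emeasure_measure_of)
    show "sets (borel_of X) \<subseteq> Pow (topspace X)"
      using sets.space_closed[of "borel_of X"] by simp
    show "positive (sets (pos_variation X \<rho>)) (upper_var X \<rho>)"
      by (simp add: positive_def upper_var_empty[OF assms(1)])
    show "countably_additive (sets (pos_variation X \<rho>)) (upper_var X \<rho>)"
      by (simp add: countably_additive_upper_var[OF assms(1)])
  qed (simp add: assms(2))
qed

lemma upper_var_Un:
  assumes "signed_measure X \<rho>" "A \<in> sets (borel_of X)" "B \<in> sets (borel_of X)" "A \<inter> B = {}"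
  shows "upper_var X \<rho> (A \<union> B) = upper_var X \<rho> A + upper_var X \<rho> B"
  using plus_emeasure[of A "pos_variation X \<rho>" B] assms
  by (simp add: emeasure_pos_variation sets.Un)

text \<open>A part \<open>B\<close> whose value exceeds \<open>1 + \<bar>\<rho> E\<bar>\<close> and its complement in \<open>E\<close> both have values of size at
  least \<open>1\<close>, and one of them inherits the infinite variation.\<close>

lemma upper_var_infinite_split:
  assumes s: "signed_measure X \<rho>" and E: "E \<in> sets (borel_of X)" "upper_var X \<rho> E = \<infinity>"
  shows "\<exists>E'. E' \<in> sets (borel_of X) \<and> E' \<subseteq> E \<and> upper_var X \<rho> E' = \<infinity> \<and> 1 \<le> \<bar>\<rho> (E - E')\<bar>"
proof -
  have "ennreal (1 + \<bar>\<rho> E\<bar>) < upper_var X \<rho> E"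
    using E(2) by simp
  then obtain B where B: "B \<in> sets (borel_of X)" "B \<subseteq> E" "ennreal (1 + \<bar>\<rho> E\<bar>) < ennreal (\<rho> B)"
    unfolding upper_var_def less_SUP_iff by auto
  have ge: "1 + \<bar>\<rho> E\<bar> \<le> \<rho> B"
    using B(3) by (metis ennreal_less_iff abs_ge_zero add_nonneg_nonneg less_imp_le zero_le_one)
  have diff: "\<rho> (E - B) = \<rho> E - \<rho> B"
    by (rule signed_measure_Diff[OF s E(1) B(1,2)])
  have EB: "E - B \<in> sets (borel_of X)" using E B by auto
  have "upper_var X \<rho> (B \<union> (E - B)) = upper_var X \<rho> B + upper_var X \<rho> (E - B)"
    by (rule upper_var_Un[OF s B(1) EB]) auto
  then have "upper_var X \<rho> B = \<infinity> \<or> upper_var X \<rho> (E - B) = \<infinity>"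
    using B(2) E(2) by (simp add: Un_absorb1) (metis ennreal_add_eq_top)
  then show ?thesis
  proof
    assume "upper_var X \<rho> B = \<infinity>"
    then show ?thesis using B ge diff by (intro exI[of _ B]) auto
  next
    assume "upper_var X \<rho> (E - B) = \<infinity>"
    moreover have "E - (E - B) = B" using B by auto
    ultimately show ?thesis using EB ge by (intro exI[of _ "E - B"]) auto
  qed
qed

text \<open>Repeated splitting would produce disjoint sets with values bounded away from \<open>0\<close>, contrary to
  countable additivity.\<close>

lemma upper_var_finite:
  assumes s: "signed_measure X \<rho>"
  shows "upper_var X \<rho> (topspace X) < \<infinity>"
proof (rule ccontr)
  assume "\<not> ?thesis"
  then have inf: "upper_var X \<rho> (topspace X) = \<infinity>" by (simp add: less_top[symmetric])
  define Q where "Q E \<longleftrightarrow> E \<in> sets (borel_of X) \<and> upper_var X \<rho> E = \<infinity>" for E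
  have "\<exists>E. \<forall>n. Q (E n) \<and> (E (Suc n) \<subseteq> E n \<and> 1 \<le> \<bar>\<rho> (E n - E (Suc n))\<bar>)"
  proof (rule dependent_nat_choice)
    show "\<exists>E. Q E" using inf unfolding Q_def by (intro exI[of _ "topspace X"]) simp
    show "\<exists>E'. Q E' \<and> (E' \<subseteq> E \<and> 1 \<le> \<bar>\<rho> (E - E')\<bar>)" if "Q E" for E n
      using upper_var_infinite_split[OF s, of E] that unfolding Q_def by blast
  qed
  then obtain E where E: "\<And>n. E n \<in> sets (borel_of X)" "\<And>n. E (Suc n) \<subseteq> E n"
      "\<And>n. 1 \<le> \<bar>\<rho> (E n - E (Suc n))\<bar>"
    unfolding Q_def by blast
  have dec: "decseq E" using E(2) by (simp add: decseq_Suc_iff)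
  have disj: "disjoint_family (\<lambda>n. E n - E (Suc n))"
    unfolding disjoint_family_on_def
  proof (intro ballI impI)
    fix m n :: nat assume "m \<noteq> n"
    have *: "(E m - E (Suc m)) \<inter> (E n - E (Suc n)) = {}" if "m < n" for m n
      using decseqD[OF dec, of "Suc m" n] that by auto
    show "(E m - E (Suc m)) \<inter> (E n - E (Suc n)) = {}"
      using *[of m n] *[of n m] \<open>m \<noteq> n\<close> by (cases "m < n") auto
  qed
  have "range (\<lambda>n. E n - E (Suc n)) \<subseteq> sets (borel_of X)"
    using E(1) by auto
  with disj have "summable (\<lambda>n. \<rho> (E n - E (Suc n)))"
    using s sums_summable unfolding signed_measure_def by blast
  then have "(\<lambda>n. \<rho> (E n - E (Suc n))) \<longlonglongrightarrow> 0" by (rule summable_LIMSEQ_zero)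
  then have "\<forall>\<^sub>F n in sequentially. \<bar>\<rho> (E n - E (Suc n))\<bar> < 1"
    by (metis (mono_tags, lifting) LIMSEQ_D eventually_sequentially less_numeral_extra(1) real_norm_def diff_zero)
  then obtain n where "\<bar>\<rho> (E n - E (Suc n))\<bar> < 1"
    by (auto simp: eventually_sequentially)
  with E(3)[of n] show False by simp
qed

lemma finite_measure_pos_variation:
  "signed_measure X \<rho> \<Longrightarrow> finite_measure (pos_variation X \<rho>)"
  by (rule finite_measureI) (use upper_var_finite[of X \<rho>] in \<open>simp add: emeasure_pos_variation\<close>)

text \<open>Replacing a competitor \<open>B\<close> by \<open>A - B\<close> exchanges the two suprema up to the constant \<open>\<rho> A\<close>.\<close>

lemma jordan_decomposition:
  assumes s: "signed_measure X \<rho>" and A: "A \<in> sets (borel_of X)"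
  shows "\<rho> A = measure (pos_variation X \<rho>) A - measure (pos_variation X (\<lambda>A. - \<rho> A)) A"
proof -
  let ?p = "measure (pos_variation X \<rho>) A" and ?n = "measure (pos_variation X (\<lambda>A. - \<rho> A)) A"
  note s' = signed_measure_uminus[OF s]
  interpret p: finite_measure "pos_variation X \<rho>" by (rule finite_measure_pos_variation[OF s])
  interpret n: finite_measure "pos_variation X (\<lambda>A. - \<rho> A)" by (rule finite_measure_pos_variation[OF s'])
  have p: "upper_var X \<rho> A = ennreal ?p"
    using emeasure_pos_variation[OF s A] by (simp add: p.emeasure_eq_measure)
  have n: "upper_var X (\<lambda>A. - \<rho> A) A = ennreal ?n"
    using emeasure_pos_variation[OF s' A] by (simp add: n.emeasure_eq_measure)
  have *: "\<rho> B \<le> ?p" "- \<rho> B \<le> ?n" if "B \<in> sets (borel_of X)" "B \<subseteq> A" for B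
    using upper_var_ge[of B X A \<rho>] upper_var_ge[of B X A "\<lambda>A. - \<rho> A"] that p n
    by (simp_all add: ennreal_le_iff)
  have "upper_var X \<rho> A \<le> ennreal (\<rho> A + ?n)"
    unfolding upper_var_def
  proof (rule SUP_least)
    fix B assume B: "B \<in> {B \<in> sets (borel_of X). B \<subseteq> A}"
    then have "\<rho> (A - B) = \<rho> A - \<rho> B" by (intro signed_measure_Diff[OF s A]) auto
    moreover have "- \<rho> (A - B) \<le> ?n" using A B by (intro *) auto
    ultimately show "ennreal (\<rho> B) \<le> ennreal (\<rho> A + ?n)" by (intro ennreal_leI) auto
  qed
  then have 1: "?p \<le> \<rho> A + ?n"
    using p *(2)[OF A] by (simp add: ennreal_le_iff)
  have "upper_var X (\<lambda>A. - \<rho> A) A \<le> ennreal (?p - \<rho> A)"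
    unfolding upper_var_def
  proof (rule SUP_least)
    fix B assume B: "B \<in> {B \<in> sets (borel_of X). B \<subseteq> A}"
    then have "\<rho> (A - B) = \<rho> A - \<rho> B" by (intro signed_measure_Diff[OF s A]) auto
    moreover have "\<rho> (A - B) \<le> ?p" using A B by (intro *) auto
    ultimately show "ennreal (- \<rho> B) \<le> ennreal (?p - \<rho> A)" by (intro ennreal_leI) auto
  qed
  then have 2: "?n \<le> ?p - \<rho> A"
    using n *(1)[OF A] by (simp add: ennreal_le_iff)
  from 1 2 show ?thesis by simp
qed

section \<open>Finite Radon measures\<close>

definition finite_radon :: "'a topology \<Rightarrow> 'a measure \<Rightarrow> bool" where
  "finite_radon X M \<longleftrightarrow> radon_measure X M \<and> emeasure M (topspace X) < \<infinity>"

lemma finite_radon_sets: "finite_radon X M \<Longrightarrow> sets M = sets (borel_of X)"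
  unfolding finite_radon_def radon_measure_def by blast

lemma finite_radon_space: "finite_radon X M \<Longrightarrow> space M = topspace X"
  using sets_eq_imp_space_eq[OF finite_radon_sets[of X M]] by simp

lemma finite_radon_finite: "finite_radon X M \<Longrightarrow> finite_measure M"
  by (rule finite_measureI) (auto simp: finite_radon_space finite_radon_def)

lemma finite_radon_outer:
  assumes "finite_radon X M" "A \<in> sets (borel_of X)" "0 < \<epsilon>"
  shows "\<exists>U. openin X U \<and> A \<subseteq> U \<and> measure M U < measure M A + \<epsilon>"
proof -
  interpret finite_measure M by (rule finite_radon_finite[OF assms(1)])
  have "emeasure M A = (INF U\<in>{U. openin X U \<and> A \<subseteq> U}. emeasure M U)"
    using assms(1,2) unfolding finite_radon_def radon_measure_def by blast
  moreover have "emeasure M A < ennreal (measure M A + \<epsilon>)"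
    using assms(3) by (simp add: emeasure_eq_measure ennreal_less_iff)
  ultimately have "\<exists>U\<in>{U. openin X U \<and> A \<subseteq> U}. emeasure M U < ennreal (measure M A + \<epsilon>)"
    by (simp only: INF_less_iff)
  then obtain U where "openin X U" "A \<subseteq> U" "emeasure M U < ennreal (measure M A + \<epsilon>)"
    by auto
  then show ?thesis
    by (auto simp: emeasure_eq_measure ennreal_less_iff)
qed

lemma finite_radon_inner:
  assumes "finite_radon X M" "openin X U" "0 < \<epsilon>"
  shows "\<exists>K. compactin X K \<and> K \<subseteq> U \<and> measure M U < measure M K + \<epsilon>"
proof (cases "measure M U < \<epsilon>")
  case True
  then show ?thesis by (intro exI[of _ "{}"]) simp
next
  case False
  interpret finite_measure M by (rule finite_radon_finite[OF assms(1)])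
  have "emeasure M U = (SUP K\<in>{K. compactin X K \<and> K \<subseteq> U}. emeasure M K)"
    using assms(1,2) unfolding finite_radon_def radon_measure_def by blast
  moreover have "ennreal (measure M U - \<epsilon>) < emeasure M U"
    using assms(3) False by (simp add: emeasure_eq_measure ennreal_less_iff)
  ultimately have "\<exists>K\<in>{K. compactin X K \<and> K \<subseteq> U}. ennreal (measure M U - \<epsilon>) < emeasure M K"
    by (simp only: less_SUP_iff)
  then obtain K where "compactin X K" "K \<subseteq> U" "ennreal (measure M U - \<epsilon>) < emeasure M K"
    by auto
  then show ?thesis
    using False by (intro exI[of _ K]) (auto simp: emeasure_eq_measure ennreal_less_iff)
qed

lemma finite_radonI:
  assumes H: "Hausdorff_space X"
    and M: "finite_measure M" "sets M = sets (borel_of X)"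
    and outer: "\<And>A \<epsilon>. \<lbrakk>A \<in> sets (borel_of X); 0 < \<epsilon>\<rbrakk> \<Longrightarrow>
      \<exists>U. openin X U \<and> A \<subseteq> U \<and> measure M U \<le> measure M A + \<epsilon>"
    and inner: "\<And>U \<epsilon>. \<lbrakk>openin X U; 0 < \<epsilon>\<rbrakk> \<Longrightarrow>
      \<exists>K. compactin X K \<and> K \<subseteq> U \<and> measure M U \<le> measure M K + \<epsilon>"
  shows "finite_radon X M"
proof -
  interpret finite_measure M by fact
  have fin: "emeasure M A < \<infinity>" for A by (simp add: emeasure_eq_measure)
  have "emeasure M A = (INF U\<in>{U. openin X U \<and> A \<subseteq> U}. emeasure M U)" if A: "A \<in> sets M" for A
  proof (rule antisym)
    show "emeasure M A \<le> (INF U\<in>{U. openin X U \<and> A \<subseteq> U}. emeasure M U)"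
      by (rule INF_greatest) (auto intro!: emeasure_mono simp: M(2) openin_borel_of)
    show "(INF U\<in>{U. openin X U \<and> A \<subseteq> U}. emeasure M U) \<le> emeasure M A"
    proof (rule ennreal_le_epsilon)
      fix \<epsilon> :: real assume "0 < \<epsilon>"
      then obtain U where U: "openin X U" "A \<subseteq> U" "measure M U \<le> measure M A + \<epsilon>"
        using outer[of A \<epsilon>] A M(2) by auto
      have "(INF U\<in>{U. openin X U \<and> A \<subseteq> U}. emeasure M U) \<le> emeasure M U"
        using U by (intro INF_lower) auto
      also have "\<dots> \<le> emeasure M A + ennreal \<epsilon>"
        using U(3) \<open>0 < \<epsilon>\<close> by (simp add: emeasure_eq_measure ennreal_plus[symmetric] del: ennreal_plus)
      finally show "(INF U\<in>{U. openin X U \<and> A \<subseteq> U}. emeasure M U) \<le> emeasure M A + ennreal \<epsilon>" .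
    qed
  qed
  moreover have "emeasure M U = (SUP K\<in>{K. compactin X K \<and> K \<subseteq> U}. emeasure M K)" if U: "openin X U" for U
  proof (rule antisym)
    show "(SUP K\<in>{K. compactin X K \<and> K \<subseteq> U}. emeasure M K) \<le> emeasure M U"
      using U by (intro SUP_least) (auto intro!: emeasure_mono simp: M(2) openin_borel_of)
    show "emeasure M U \<le> (SUP K\<in>{K. compactin X K \<and> K \<subseteq> U}. emeasure M K)"
    proof (rule ennreal_le_epsilon)
      fix \<epsilon> :: real assume "0 < \<epsilon>"
      then obtain K where K: "compactin X K" "K \<subseteq> U" "measure M U \<le> measure M K + \<epsilon>"
        using inner[OF U, of \<epsilon>] by auto
      have "emeasure M U \<le> emeasure M K + ennreal \<epsilon>"
        using K(3) \<open>0 < \<epsilon>\<close> by (simp add: emeasure_eq_measure ennreal_plus[symmetric] del: ennreal_plus)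
      also have "\<dots> \<le> (SUP K\<in>{K. compactin X K \<and> K \<subseteq> U}. emeasure M K) + ennreal \<epsilon>"
        using K by (intro add_right_mono SUP_upper) auto
      finally show "emeasure M U \<le> (SUP K\<in>{K. compactin X K \<and> K \<subseteq> U}. emeasure M K) + ennreal \<epsilon>" .
    qed
  qed
  ultimately show ?thesis
    unfolding finite_radon_def radon_measure_def
    using M(2) fin by blast
qed

text \<open>The sets that approximate for the larger measure also approximate for the smaller one, since the error
  is dominated as well.\<close>

lemma finite_radon_dominated:
  assumes H: "Hausdorff_space X" and N: "finite_radon X N"
    and M: "finite_measure M" "sets M = sets (borel_of X)"
    and le: "\<And>A. A \<in> sets (borel_of X) \<Longrightarrow> measure M A \<le> measure N A"
  shows "finite_radon X M"
proof (rule finite_radonI[OF H M])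
  interpret M: finite_measure M by fact
  interpret N: finite_measure N by (rule finite_radon_finite[OF N])
  note [simp] = M(2) finite_radon_sets[OF N]
  have diff: "measure M B - measure M A \<le> measure N B - measure N A"
    if "A \<in> sets (borel_of X)" "B \<in> sets (borel_of X)" "A \<subseteq> B" for A B
    using that le[of "B - A"] by (simp add: M.finite_measure_Diff N.finite_measure_Diff)
  show "\<exists>U. openin X U \<and> A \<subseteq> U \<and> measure M U \<le> measure M A + \<epsilon>"
    if A: "A \<in> sets (borel_of X)" and e: "0 < \<epsilon>" for A \<epsilon>
  proof -
    obtain U where U: "openin X U" "A \<subseteq> U" "measure N U < measure N A + \<epsilon>"
      using finite_radon_outer[OF N A e] by auto
    then show ?thesis using diff[OF A openin_borel_of[OF U(1)] U(2)] by (intro exI[of _ U]) auto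
  qed
  show "\<exists>K. compactin X K \<and> K \<subseteq> U \<and> measure M U \<le> measure M K + \<epsilon>"
    if U: "openin X U" and e: "0 < \<epsilon>" for U \<epsilon>
  proof -
    obtain K where K: "compactin X K" "K \<subseteq> U" "measure N U < measure N K + \<epsilon>"
      using finite_radon_inner[OF N U e] by auto
    have "K \<in> sets (borel_of X)"
      by (intro closedin_borel_of compactin_imp_closedin[OF H K(1)])
    then show ?thesis
      using diff[OF _ openin_borel_of[OF U] K(2)] K by (intro exI[of _ K]) auto
  qed
qed

definition add_measure :: "'a measure \<Rightarrow> 'a measure \<Rightarrow> 'a measure" where
  "add_measure M N = measure_of (space M) (sets M) (\<lambda>A. emeasure M A + emeasure N A)"

lemma sets_add_measure [simp]: "sets (add_measure M N) = sets M"
  and space_add_measure [simp]: "space (add_measure M N) = space M"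
  unfolding add_measure_def by simp_all

lemma emeasure_add_measure:
  assumes "sets N = sets M" "A \<in> sets M"
  shows "emeasure (add_measure M N) A = emeasure M A + emeasure N A"
  using add_measure_def[of M N]
proof (rule emeasure_measure_of)
  show "countably_additive (sets (add_measure M N)) (\<lambda>A. emeasure M A + emeasure N A)"
    using assms(1) by (auto intro!: countably_additiveI simp: suminf_add[symmetric] suminf_emeasure)
qed (auto simp: positive_def assms sets.space_closed)

lemma finite_measure_add_measure:
  assumes "finite_measure M" "finite_measure N" "sets N = sets M"
  shows "finite_measure (add_measure M N)"
proof (rule finite_measureI)
  interpret M: finite_measure M by fact
  interpret N: finite_measure N by fact
  show "emeasure (add_measure M N) (space (add_measure M N)) \<noteq> \<infinity>"
    using assms(3) by (simp add: emeasure_add_measure)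
qed

lemma measure_add_measure:
  assumes "finite_measure M" "finite_measure N" "sets N = sets M" "A \<in> sets M"
  shows "measure (add_measure M N) A = measure M A + measure N A"
proof -
  interpret M: finite_measure M by fact
  interpret N: finite_measure N by fact
  show ?thesis
    unfolding measure_def[of "add_measure M N"]
    using assms by (simp add: emeasure_add_measure M.emeasure_eq_measure N.emeasure_eq_measure
        ennreal_plus[symmetric] del: ennreal_plus)
qed

lemma nn_integral_add_measure:
  assumes eq: "sets N = sets M" and f: "f \<in> borel_measurable M"
  shows "nn_integral (add_measure M N) f = nn_integral M f + nn_integral N f"
  using f
proof induction
  case (cong f g)
  have "space N = space M" using eq by (rule sets_eq_imp_space_eq)
  then show ?case using cong by (metis nn_integral_cong space_add_measure)
next
  case (set A)
  then show ?case by (simp add: emeasure_add_measure eq)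
next
  case (mult u c)
  moreover have "u \<in> borel_measurable N" "u \<in> borel_measurable (add_measure M N)"
    using mult by (simp_all add: measurable_cong_sets[OF eq refl] measurable_cong_sets[OF sets_add_measure refl])
  ultimately show ?case by (simp add: nn_integral_cmult distrib_left)
next
  case (add u v)
  moreover have "u \<in> borel_measurable N" "u \<in> borel_measurable (add_measure M N)"
     "v \<in> borel_measurable N" "v \<in> borel_measurable (add_measure M N)"
    using add by (simp_all add: measurable_cong_sets[OF eq refl] measurable_cong_sets[OF sets_add_measure refl])
  ultimately show ?case by (simp add: nn_integral_add ac_simps)
next
  case (seq U)
  moreover have "U i \<in> borel_measurable N" "U i \<in> borel_measurable (add_measure M N)" for i
    using seq by (simp_all add: measurable_cong_sets[OF eq refl] measurable_cong_sets[OF sets_add_measure refl])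
  moreover have "incseq (\<lambda>i. nn_integral M (U i))" "incseq (\<lambda>i. nn_integral N (U i))"
    using \<open>incseq U\<close> by (auto simp: incseq_def le_fun_def intro!: nn_integral_mono)
  moreover have "(SUP i. U i) = (\<lambda>x. SUP i. U i x)" by (simp add: fun_eq_iff image_comp)
  ultimately show ?case
    by (simp add: nn_integral_monotone_convergence_SUP ennreal_SUP_add)
qed

text \<open>Adding a constant reduces a bounded function to a nonnegative one, for which the claim is about
  nonnegative integrals.\<close>

lemma integral_add_measure_real:
  fixes f :: "'a \<Rightarrow> real"
  assumes M: "finite_measure M" and N: "finite_measure N" and eq: "sets N = sets M"
    and f: "f \<in> borel_measurable M" and bound: "\<And>x. x \<in> space M \<Longrightarrow> \<bar>f x\<bar> \<le> c"
  shows "integral\<^sup>L (add_measure M N) f = integral\<^sup>L M f + integral\<^sup>L N f"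
proof -
  let ?S = "add_measure M N"
  note S = finite_measure_add_measure[OF M N eq]
  interpret M: finite_measure M by fact
  interpret N: finite_measure N by fact
  interpret S: finite_measure ?S by fact
  have sp: "space N = space M" using eq by (rule sets_eq_imp_space_eq)
  have fN: "f \<in> borel_measurable N" and fS: "f \<in> borel_measurable ?S"
    using f by (simp_all add: measurable_cong_sets[OF eq refl] measurable_cong_sets[OF sets_add_measure refl])
  have int: "integrable M f" "integrable N f" "integrable ?S f"
    using f fN fS bound by (auto intro!: M.integrable_const_bound[of _ c] N.integrable_const_bound[of _ c]
        S.integrable_const_bound[of _ c] simp: sp)
  have pos: "integral\<^sup>L ?S g = integral\<^sup>L M g + integral\<^sup>L N g"
    if g: "integrable M g" "integrable N g" "integrable ?S g" and ge: "\<And>x. x \<in> space M \<Longrightarrow> 0 \<le> g x"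
    for g :: "'a \<Rightarrow> real"
  proof -
    have "ennreal (integral\<^sup>L ?S g) = nn_integral ?S g"
      using g ge by (intro nn_integral_eq_integral[symmetric]) auto
    also have "\<dots> = nn_integral M g + nn_integral N g"
      using g by (intro nn_integral_add_measure[OF eq]) auto
    also have "\<dots> = ennreal (integral\<^sup>L M g) + ennreal (integral\<^sup>L N g)"
      using nn_integral_eq_integral[OF g(1)] nn_integral_eq_integral[OF g(2)] ge
        AE_I2[of N "\<lambda>x. 0 \<le> g x"] by (simp add: sp)
    also have "\<dots> = ennreal (integral\<^sup>L M g + integral\<^sup>L N g)"
      using ge by (intro ennreal_plus[symmetric] integral_nonneg_AE) (auto simp: sp)
    finally show ?thesis
      using ge by (subst (asm) ennreal_inj) (auto intro!: integral_nonneg_AE add_nonneg_nonneg simp: sp)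
  qed
  have 1: "integral\<^sup>L ?S (\<lambda>x. f x + c) = integral\<^sup>L M (\<lambda>x. f x + c) + integral\<^sup>L N (\<lambda>x. f x + c)"
    using int bound by (intro pos) (auto simp: abs_le_iff, smt (verit))
  have 2: "integral\<^sup>L ?S (\<lambda>x. c) = integral\<^sup>L M (\<lambda>x. c) + integral\<^sup>L N (\<lambda>x. c)"
    using measure_add_measure[OF M N eq sets.top] by (simp add: sp algebra_simps)
  from 1 2 int show ?thesis by simp
qed



lemma integral_add_measure:
  fixes f :: "'a \<Rightarrow> complex"
  assumes M: "finite_measure M" and N: "finite_measure N" and eq: "sets N = sets M"
    and f: "f \<in> borel_measurable M" and bound: "\<And>x. x \<in> space M \<Longrightarrow> cmod (f x) \<le> c"
  shows "integral\<^sup>L (add_measure M N) f = integral\<^sup>L M f + integral\<^sup>L N f"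
proof -
  let ?S = "add_measure M N"
  note S = finite_measure_add_measure[OF M N eq]
  interpret M: finite_measure M by fact
  interpret N: finite_measure N by fact
  interpret S: finite_measure ?S by fact
  have sp: "space N = space M" using eq by (rule sets_eq_imp_space_eq)
  have fN: "f \<in> borel_measurable N" and fS: "f \<in> borel_measurable ?S"
    using f by (simp_all add: measurable_cong_sets[OF eq refl] measurable_cong_sets[OF sets_add_measure refl])
  have int: "integrable M f" "integrable N f" "integrable ?S f"
    using f fN fS bound by (auto intro!: M.integrable_const_bound[of _ c] N.integrable_const_bound[of _ c]
        S.integrable_const_bound[of _ c] simp: sp)
  have "integral\<^sup>L ?S (\<lambda>x. Re (f x)) = integral\<^sup>L M (\<lambda>x. Re (f x)) + integral\<^sup>L N (\<lambda>x. Re (f x))"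
    using f bound by (intro integral_add_measure_real[OF M N eq, where c = c])
      (auto intro: order_trans[OF abs_Re_le_cmod])
  moreover have "integral\<^sup>L ?S (\<lambda>x. Im (f x)) = integral\<^sup>L M (\<lambda>x. Im (f x)) + integral\<^sup>L N (\<lambda>x. Im (f x))"
    using f bound by (intro integral_add_measure_real[OF M N eq, where c = c])
      (auto intro: order_trans[OF abs_Im_le_cmod])
  ultimately show ?thesis
    using int by (simp add: complex_eq_iff)
qed

lemma finite_radon_add:
  assumes H: "Hausdorff_space X" and M: "finite_radon X M" and N: "finite_radon X N"
  shows "finite_radon X (add_measure M N)"
proof -
  note [simp] = finite_radon_sets[OF M] finite_radon_sets[OF N]
  note fin = finite_radon_finite[OF M] finite_radon_finite[OF N]
  have meas: "measure (add_measure M N) A = measure M A + measure N A" if "A \<in> sets (borel_of X)" for A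
    using that by (intro measure_add_measure fin) simp_all
  interpret M: finite_measure M by fact
  interpret N: finite_measure N by fact
  show ?thesis
  proof (rule finite_radonI[OF H])
    show "finite_measure (add_measure M N)" by (intro finite_measure_add_measure fin) simp
    show "\<exists>U. openin X U \<and> A \<subseteq> U \<and> measure (add_measure M N) U \<le> measure (add_measure M N) A + \<epsilon>"
      if A: "A \<in> sets (borel_of X)" and e: "0 < \<epsilon>" for A \<epsilon>
    proof -
      obtain U V where UV: "openin X U" "A \<subseteq> U" "measure M U < measure M A + \<epsilon>/2"
        "openin X V" "A \<subseteq> V" "measure N V < measure N A + \<epsilon>/2"
        using finite_radon_outer[OF M A, of "\<epsilon>/2"] finite_radon_outer[OF N A, of "\<epsilon>/2"] e by auto
      have "measure M (U \<inter> V) \<le> measure M U" "measure N (U \<inter> V) \<le> measure N V"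
        using UV by (auto intro!: M.finite_measure_mono N.finite_measure_mono openin_borel_of)
      then show ?thesis
        using UV A meas[OF openin_borel_of[OF openin_Int[OF UV(1,4)]]]
        by (intro exI[of _ "U \<inter> V"]) (auto simp: meas)
    qed
    show "\<exists>K. compactin X K \<and> K \<subseteq> U \<and> measure (add_measure M N) U \<le> measure (add_measure M N) K + \<epsilon>"
      if U: "openin X U" and e: "0 < \<epsilon>" for U \<epsilon>
    proof -
      obtain K L where KL: "compactin X K" "K \<subseteq> U" "measure M U < measure M K + \<epsilon>/2"
        "compactin X L" "L \<subseteq> U" "measure N U < measure N L + \<epsilon>/2"
        using finite_radon_inner[OF M U, of "\<epsilon>/2"] finite_radon_inner[OF N U, of "\<epsilon>/2"] e by auto
      have s: "K \<union> L \<in> sets (borel_of X)"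
        using KL by (intro closedin_borel_of compactin_imp_closedin[OF H] compactin_Un)
      have "measure M K \<le> measure M (K \<union> L)" "measure N L \<le> measure N (K \<union> L)"
        using s by (auto intro!: M.finite_measure_mono N.finite_measure_mono)
      then show ?thesis
        using KL U meas[OF s] by (intro exI[of _ "K \<union> L"]) (auto simp: meas openin_borel_of compactin_Un)
    qed
  qed simp
qed

lemma finite_radon_null: "Hausdorff_space X \<Longrightarrow> finite_radon X (null_measure (borel_of X))"
proof (rule finite_radonI)
  show "\<exists>U. openin X U \<and> A \<subseteq> U \<and>
      measure (null_measure (borel_of X)) U \<le> measure (null_measure (borel_of X)) A + \<epsilon>"
    if "A \<in> sets (borel_of X)" "0 < \<epsilon>" for A \<epsilon>
    using that borel_of_subset[of A X] by (intro exI[of _ "topspace X"]) simp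
qed (auto intro!: finite_measureI exI[of _ "{}"])

lemma finite_radon_scale:
  assumes H: "Hausdorff_space X" and M: "finite_radon X M" and c: "0 \<le> c"
  shows "finite_radon X (scale_measure (ennreal c) M)"
proof -
  interpret M: finite_measure M by (rule finite_radon_finite[OF M])
  have meas: "measure (scale_measure (ennreal c) M) A = c * measure M A" for A
    using c by (simp add: measure_def enn2real_mult)
  have fin: "finite_measure (scale_measure (ennreal c) M)"
    by (rule finite_measureI) (simp add: ennreal_mult_eq_top_iff space_scale_measure)
  show ?thesis
  proof (cases "c = 0")
    case True
    then show ?thesis
      using finite_radon_dominated[OF H M fin] finite_radon_sets[OF M] meas by simp
  next
    case False
    with c have c: "0 < c" by simp
    show ?thesis
    proof (rule finite_radonI[OF H fin])
      show "\<exists>U. openin X U \<and> A \<subseteq> U \<and>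
          measure (scale_measure (ennreal c) M) U \<le> measure (scale_measure (ennreal c) M) A + \<epsilon>"
        if A: "A \<in> sets (borel_of X)" and e: "0 < \<epsilon>" for A \<epsilon>
      proof -
        obtain U where U: "openin X U" "A \<subseteq> U" "measure M U < measure M A + \<epsilon> / c"
          using finite_radon_outer[OF M A, of "\<epsilon> / c"] e c by auto
        then have "c * measure M U \<le> c * measure M A + \<epsilon>"
          using c by (simp add: field_simps)
        with U show ?thesis by (auto simp: meas)
      qed
      show "\<exists>K. compactin X K \<and> K \<subseteq> U \<and>
          measure (scale_measure (ennreal c) M) U \<le> measure (scale_measure (ennreal c) M) K + \<epsilon>"
        if U: "openin X U" and e: "0 < \<epsilon>" for U \<epsilon>
      proof -
        obtain K where K: "compactin X K" "K \<subseteq> U" "measure M U < measure M K + \<epsilon> / c"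
          using finite_radon_inner[OF M U, of "\<epsilon> / c"] e c by auto
        then have "c * measure M U \<le> c * measure M K + \<epsilon>"
          using c by (simp add: field_simps)
        with K show ?thesis by (auto simp: meas)
      qed
    qed (use finite_radon_sets[OF M] in simp)
  qed
qed

text \<open>As an image of counting measure on one point, so that integrals are a change of variables.\<close>

definition point_mass :: "'a topology \<Rightarrow> 'a \<Rightarrow> 'a measure" where
  "point_mass X s = distr (count_space {()}) (borel_of X) (\<lambda>_. s)"

lemma sets_point_mass [simp]: "sets (point_mass X s) = sets (borel_of X)"
  by (simp add: point_mass_def)

lemma emeasure_point_mass:
  assumes "s \<in> topspace X" "A \<in> sets (borel_of X)"
  shows "emeasure (point_mass X s) A = indicator A s"
  unfolding point_mass_def using assms by (subst emeasure_distr) (auto simp: indicator_def)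

lemma integral_point_mass:
  fixes f :: "'a \<Rightarrow> complex"
  assumes "s \<in> topspace X" "continuous_map X euclidean f"
  shows "integral\<^sup>L (point_mass X s) f = f s"
  unfolding point_mass_def using assms
  by (subst integral_distr) (auto intro: continuous_map_borel_measurable simp: lebesgue_integral_count_space_finite)

lemma finite_radon_point_mass:
  assumes H: "Hausdorff_space X" and s: "s \<in> topspace X"
  shows "finite_radon X (point_mass X s)"
proof (rule finite_radonI[OF H])
  have "space (point_mass X s) = topspace X" by (simp add: point_mass_def)
  then show "finite_measure (point_mass X s)"
    by (intro finite_measureI) (simp add: emeasure_point_mass[OF s] indicator_def)
  have meas: "measure (point_mass X s) A = indicator A s" if "A \<in> sets (borel_of X)" for A
    using emeasure_point_mass[OF s that] by (simp add: measure_def indicator_def)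
  show "\<exists>U. openin X U \<and> A \<subseteq> U \<and>
      measure (point_mass X s) U \<le> measure (point_mass X s) A + \<epsilon>"
    if A: "A \<in> sets (borel_of X)" and e: "0 < \<epsilon>" for A \<epsilon>
  proof (cases "s \<in> A")
    case True
    then show ?thesis using A e borel_of_subset[OF A]
      by (intro exI[of _ "topspace X"]) (simp add: meas s)
  next
    case False
    have "openin X (topspace X - {s})"
      using H s by (simp add: Hausdorff_imp_t1_space closedin_t1_singleton openin_diff)
    then show ?thesis using A e borel_of_subset[OF A] False
      by (intro exI[of _ "topspace X - {s}"]) (auto simp: meas openin_borel_of)
  qed
  show "\<exists>K. compactin X K \<and> K \<subseteq> U \<and>
      measure (point_mass X s) U \<le> measure (point_mass X s) K + \<epsilon>"
    if U: "openin X U" and e: "0 < \<epsilon>" for U \<epsilon>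
  proof (cases "s \<in> U")
    case True
    have "{s} \<in> sets (borel_of X)"
      using H s by (intro closedin_borel_of) (simp add: Hausdorff_imp_t1_space closedin_t1_singleton)
    then show ?thesis using U e True s
      by (intro exI[of _ "{s}"]) (simp add: meas openin_borel_of)
  next
    case False
    then show ?thesis using U e by (intro exI[of _ "{}"]) (simp add: meas openin_borel_of)
  qed
qed simp

lemma bounded_continuous_integrable:
  fixes f :: "'a \<Rightarrow> 'b :: {banach, second_countable_topology}"
  assumes M: "finite_measure M" "sets M = sets (borel_of X)"
    and f: "continuous_map X euclidean f" "bounded (f ` topspace X)"
  shows "integrable M f"
proof -
  interpret finite_measure M by fact
  have sp: "space M = topspace X" using sets_eq_imp_space_eq[OF M(2)] by simp
  obtain c where "\<And>x. x \<in> topspace X \<Longrightarrow> norm (f x) \<le> c"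
    using f(2) unfolding bounded_iff by auto
  then show ?thesis
    using continuous_map_borel_measurable[OF f(1)]
    by (intro integrable_const_bound[of _ c]) (auto simp: sp measurable_cong_sets[OF M(2) refl])
qed

section \<open>Complex Radon measures and the pairing\<close>

definition pos_cmeas :: "'a measure \<Rightarrow> 'a cmeas" where
  "pos_cmeas M A = complex_of_real (measure M A)"

lemma signed_measure_of_finite_radon:
  assumes "finite_radon X M"
  shows "signed_measure X (measure M)"
proof -
  interpret finite_measure M by (rule finite_radon_finite[OF assms])
  show ?thesis
    unfolding signed_measure_def using finite_radon_sets[OF assms]
    by (auto intro!: measure_notin_sets finite_measure_UNION)
qed

lemma signed_measure_lincomb:
  assumes "signed_measure X \<rho>" "signed_measure X \<sigma>"
  shows "signed_measure X (\<lambda>A. a * \<rho> A + b * \<sigma> A)"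
  using assms unfolding signed_measure_def by (auto intro!: sums_add sums_mult)

text \<open>A difference of finite Radon measures has Radon variations, since these are dominated by the
  two measures; and it may replace the Jordan decomposition in integrals, since both decompositions
  have the same sum across.\<close>

lemma difference_of_radon:
  assumes H: "Hausdorff_space X" and M: "finite_radon X M" and N: "finite_radon X N"
    and \<rho>: "\<And>A. \<rho> A = measure M A - measure N A"
  shows "finite_radon X (pos_variation X \<rho>)" (is ?th1)
    and "f \<in> Cb X \<Longrightarrow> integral\<^sup>L (pos_variation X \<rho>) f - integral\<^sup>L (pos_variation X (\<lambda>A. - \<rho> A)) f
      = integral\<^sup>L M f - integral\<^sup>L N f" (is "_ \<Longrightarrow> ?th2")
proof -
  have \<rho>_eq: "\<rho> = (\<lambda>A. 1 * measure M A + (-1) * measure N A)" using \<rho> by auto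
  have s: "signed_measure X \<rho>"
    unfolding \<rho>_eq using M N by (intro signed_measure_lincomb signed_measure_of_finite_radon)
  have s': "signed_measure X (\<lambda>A. - \<rho> A)" by (rule signed_measure_uminus[OF s])
  interpret M: finite_measure M by (rule finite_radon_finite[OF M])
  interpret N: finite_measure N by (rule finite_radon_finite[OF N])
  let ?p = "pos_variation X \<rho>" and ?n = "pos_variation X (\<lambda>A. - \<rho> A)"
  interpret p: finite_measure ?p by (rule finite_measure_pos_variation[OF s])
  interpret n: finite_measure ?n by (rule finite_measure_pos_variation[OF s'])
  note sets = finite_radon_sets[OF M] finite_radon_sets[OF N]
  show ?th1
  proof (rule finite_radon_dominated[OF H M])
    fix A assume A: "A \<in> sets (borel_of X)"
    have "upper_var X \<rho> A \<le> ennreal (measure M A)"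
      unfolding upper_var_def
    proof (rule SUP_least)
      fix B assume "B \<in> {B \<in> sets (borel_of X). B \<subseteq> A}"
      then have "\<rho> B \<le> measure M B" "measure M B \<le> measure M A"
        using A by (auto simp: \<rho> sets intro!: M.finite_measure_mono)
      then show "ennreal (\<rho> B) \<le> ennreal (measure M A)" by (intro ennreal_leI) simp
    qed
    then show "measure ?p A \<le> measure M A"
      using emeasure_pos_variation[OF s A] p.emeasure_eq_measure[of A]
      by (metis ennreal_le_iff measure_nonneg)
  qed (simp_all add: p.finite_measure_axioms)
  assume f: "f \<in> Cb X"
  then obtain c where c: "\<And>x. x \<in> topspace X \<Longrightarrow> cmod (f x) \<le> c"
    unfolding Cb_def bounded_iff by auto
  have meas: "f \<in> borel_measurable ?p" "f \<in> borel_measurable M"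
    using f continuous_map_borel_measurable[of X f]
    by (auto simp: Cb_def measurable_cong_sets[OF sets(1) refl] measurable_cong_sets[OF sets_pos_variation refl])
  have sum: "add_measure ?p N = add_measure M ?n"
  proof (rule measure_eqI)
    fix A assume "A \<in> sets (add_measure ?p N)"
    then have A: "A \<in> sets (borel_of X)" by simp
    have "measure ?p A + measure N A = measure M A + measure ?n A"
      using jordan_decomposition[OF s A] \<rho>[of A] by simp
    then show "emeasure (add_measure ?p N) A = emeasure (add_measure M ?n) A"
      using A by (simp add: emeasure_add_measure sets p.emeasure_eq_measure n.emeasure_eq_measure
        M.emeasure_eq_measure N.emeasure_eq_measure ennreal_plus[symmetric] del: ennreal_plus)
  qed (simp add: sets)
  have "integral\<^sup>L ?p f + integral\<^sup>L N f = integral\<^sup>L (add_measure ?p N) f"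
    using c meas sets
    by (intro integral_add_measure[symmetric, where c = c] p.finite_measure_axioms N.finite_measure_axioms) auto
  also have "\<dots> = integral\<^sup>L M f + integral\<^sup>L ?n f"
    unfolding sum using c meas sets finite_radon_space[OF M]
    by (intro integral_add_measure[where c = c] n.finite_measure_axioms M.finite_measure_axioms) auto
  finally show ?th2 by (simp add: algebra_simps)
qed

definition radon_signed :: "'a topology \<Rightarrow> ('a set \<Rightarrow> real) \<Rightarrow> bool" where
  "radon_signed X \<rho> \<longleftrightarrow> signed_measure X \<rho> \<and>
     finite_radon X (pos_variation X \<rho>) \<and> finite_radon X (pos_variation X (\<lambda>A. - \<rho> A))"

text \<open>The part of the pairing that belongs to the real or to the imaginary part of a complex measure.\<close>

definition real_pairing :: "'a topology \<Rightarrow> ('a \<Rightarrow> complex) \<Rightarrow> ('a set \<Rightarrow> real) \<Rightarrow> complex" where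
  "real_pairing X f \<rho> =
     integral\<^sup>L (pos_variation X \<rho>) f - integral\<^sup>L (pos_variation X (\<lambda>A. - \<rho> A)) f"

lemma pairing_real_pairing:
  "pairing X f \<mu> = real_pairing X f (\<lambda>A. Re (\<mu> A)) + \<i> * real_pairing X f (\<lambda>A. Im (\<mu> A))"
  unfolding pairing_def real_pairing_def by simp

text \<open>The variations of a signed measure are automatically finite, so in \<open>Mb\<close> Radon means finite Radon.\<close>

lemma Mb_iff:
  "\<mu> \<in> Mb X \<longleftrightarrow> radon_signed X (\<lambda>A. Re (\<mu> A)) \<and> radon_signed X (\<lambda>A. Im (\<mu> A))"
proof -
  have "emeasure (pos_variation X \<rho>) (topspace X) < \<infinity>" if "signed_measure X \<rho>" for \<rho>
    using upper_var_finite[OF that] by (simp add: emeasure_pos_variation[OF that])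
  then show ?thesis
    unfolding Mb_def radon_signed_def finite_radon_def complex_measure_iff_signed
    using signed_measure_uminus by blast
qed

lemma radon_signed_diff:
  assumes H: "Hausdorff_space X" and M: "finite_radon X M" and N: "finite_radon X N"
    and \<rho>: "\<And>A. \<rho> A = measure M A - measure N A"
  shows "radon_signed X \<rho>"
proof -
  have "\<rho> = (\<lambda>A. 1 * measure M A + (-1) * measure N A)" using \<rho> by auto
  then have "signed_measure X \<rho>"
    using signed_measure_lincomb[of X "measure M" "measure N" 1 "-1"] M N
    by (simp add: signed_measure_of_finite_radon)
  moreover have "finite_radon X (pos_variation X \<rho>)"
    by (rule difference_of_radon(1)[OF H M N \<rho>])
  moreover have "finite_radon X (pos_variation X (\<lambda>A. - \<rho> A))"
    by (rule difference_of_radon(1)[OF H N M]) (simp add: \<rho>)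
  ultimately show ?thesis unfolding radon_signed_def by simp
qed

lemma radon_signed_decomp:
  assumes "radon_signed X \<rho>"
  obtains M N where "finite_radon X M" "finite_radon X N" "\<And>A. \<rho> A = measure M A - measure N A"
proof
  let ?p = "pos_variation X \<rho>" and ?n = "pos_variation X (\<lambda>A. - \<rho> A)"
  show "finite_radon X ?p" "finite_radon X ?n"
    using assms unfolding radon_signed_def by auto
  show "\<rho> A = measure ?p A - measure ?n A" for A
  proof (cases "A \<in> sets (borel_of X)")
    case True
    then show ?thesis using assms jordan_decomposition unfolding radon_signed_def by blast
  next
    case False
    then show ?thesis
      using assms unfolding radon_signed_def signed_measure_def by (simp add: measure_notin_sets)
  qed
qed

lemma real_pairing_diff:
  assumes "Hausdorff_space X" "finite_radon X M" "finite_radon X N"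
    "\<And>A. \<rho> A = measure M A - measure N A" "f \<in> Cb X"
  shows "real_pairing X f \<rho> = integral\<^sup>L M f - integral\<^sup>L N f"
  unfolding real_pairing_def by (rule difference_of_radon(2)[OF assms])

lemma Cb_integrable:
  assumes "finite_radon X M" "f \<in> Cb X"
  shows "integrable M f"
  using assms by (intro bounded_continuous_integrable[of M X])
    (auto simp: Cb_def finite_radon_finite finite_radon_sets)

lemma Cb_measurable:
  assumes "finite_radon X M" "f \<in> Cb X"
  shows "f \<in> borel_measurable M"
  using Cb_integrable[OF assms] by auto

lemma integral_add_radon:
  assumes M: "finite_radon X M" and N: "finite_radon X N" and f: "f \<in> Cb X"
  shows "integral\<^sup>L (add_measure M N) f = integral\<^sup>L M f + integral\<^sup>L N f"
proof -
  obtain c where "\<And>x. x \<in> topspace X \<Longrightarrow> cmod (f x) \<le> c"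
    using f unfolding Cb_def bounded_iff by auto
  then show ?thesis
    using M N f by (intro integral_add_measure[where c = c])
      (auto simp: finite_radon_finite finite_radon_sets finite_radon_space Cb_measurable)
qed

lemma measure_add_radon:
  assumes M: "finite_radon X M" and N: "finite_radon X N"
  shows "measure (add_measure M N) A = measure M A + measure N A"
proof (cases "A \<in> sets (borel_of X)")
  case True
  then show ?thesis using M N
    by (intro measure_add_measure) (auto simp: finite_radon_finite finite_radon_sets)
next
  case False
  then show ?thesis
    by (simp add: measure_notin_sets finite_radon_sets[OF M] finite_radon_sets[OF N])
qed

lemma real_pairing_add:
  assumes H: "Hausdorff_space X" and \<rho>: "radon_signed X \<rho>" and \<sigma>: "radon_signed X \<sigma>"
  shows "radon_signed X (\<lambda>A. \<rho> A + \<sigma> A)" (is ?th1)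
    and "f \<in> Cb X \<Longrightarrow> real_pairing X f (\<lambda>A. \<rho> A + \<sigma> A) = real_pairing X f \<rho> + real_pairing X f \<sigma>"
      (is "_ \<Longrightarrow> ?th2")
proof -
  obtain M N where MN: "finite_radon X M" "finite_radon X N" "\<And>A. \<rho> A = measure M A - measure N A"
    using radon_signed_decomp[OF \<rho>] by blast
  obtain K L where KL: "finite_radon X K" "finite_radon X L" "\<And>A. \<sigma> A = measure K A - measure L A"
    using radon_signed_decomp[OF \<sigma>] by blast
  have 1: "finite_radon X (add_measure M K)" "finite_radon X (add_measure N L)"
    using MN KL H by (auto intro: finite_radon_add)
  have 2: "\<rho> A + \<sigma> A = measure (add_measure M K) A - measure (add_measure N L) A" for A
    using MN KL by (simp add: measure_add_radon)
  show ?th1 by (rule radon_signed_diff[OF H 1 2])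
  show ?th2 if f: "f \<in> Cb X"
    using MN(1,2) KL(1,2) f
    by (simp add: real_pairing_diff[OF H 1 2 f] real_pairing_diff[OF H MN f]
      real_pairing_diff[OF H KL f] integral_add_radon)
qed

lemma radon_signed_uminus: "radon_signed X \<rho> \<Longrightarrow> radon_signed X (\<lambda>A. - \<rho> A)"
  unfolding radon_signed_def by (auto intro: signed_measure_uminus)

lemma real_pairing_uminus: "real_pairing X f (\<lambda>A. - \<rho> A) = - real_pairing X f \<rho>"
  unfolding real_pairing_def by simp

lemma integral_scale_measure:
  fixes f :: "'a \<Rightarrow> complex"
  assumes M: "finite_radon X M" and f: "f \<in> Cb X" and c: "0 \<le> c"
  shows "integral\<^sup>L (scale_measure (ennreal c) M) f = c * integral\<^sup>L M f"
proof -
  have "scale_measure (ennreal c) M = density M (\<lambda>_. ennreal c)"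
    by (rule measure_eqI) (auto simp: emeasure_density nn_integral_cmult)
  then show ?thesis
    using Cb_measurable[OF M f] c by (simp add: integral_density scaleR_conv_of_real)
qed

lemma real_pairing_scale:
  assumes H: "Hausdorff_space X" and \<rho>: "radon_signed X \<rho>"
  shows "radon_signed X (\<lambda>A. c * \<rho> A)" (is ?th1)
    and "f \<in> Cb X \<Longrightarrow> real_pairing X f (\<lambda>A. c * \<rho> A) = c * real_pairing X f \<rho>" (is "_ \<Longrightarrow> ?th2")
proof -
  have *: "radon_signed X (\<lambda>A. c * \<rho> A) \<and>
      (f \<in> Cb X \<longrightarrow> real_pairing X f (\<lambda>A. c * \<rho> A) = c * real_pairing X f \<rho>)"
    if c: "0 \<le> c" for c
  proof -
    obtain M N where MN: "finite_radon X M" "finite_radon X N" "\<And>A. \<rho> A = measure M A - measure N A"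
      using radon_signed_decomp[OF \<rho>] by blast
    let ?s = "scale_measure (ennreal c)"
    have 1: "finite_radon X (?s M)" "finite_radon X (?s N)"
      using MN H c by (auto intro: finite_radon_scale)
    have "measure (?s K) A = c * measure K A" for K :: "'a measure" and A
      using c by (simp add: measure_def enn2real_mult)
    then have 2: "c * \<rho> A = measure (?s M) A - measure (?s N) A" for A
      using MN(3) by (simp add: right_diff_distrib)
    show ?thesis
      using radon_signed_diff[OF H 1 2] MN(1,2) c
      by (simp add: real_pairing_diff[OF H 1 2] real_pairing_diff[OF H MN] integral_scale_measure
          algebra_simps)
  qed
  have "(\<lambda>A. c * \<rho> A) = (\<lambda>A. - ((- c) * \<rho> A))" by simp
  then have **: "?th1 \<and> (f \<in> Cb X \<longrightarrow> ?th2)" if "c < 0"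
    using *[of "- c"] that radon_signed_uminus[of X "\<lambda>A. (- c) * \<rho> A"]
      real_pairing_uminus[of X f "\<lambda>A. (- c) * \<rho> A"] by simp
  show ?th1 using *[of c] ** by linarith
  show "f \<in> Cb X \<Longrightarrow> ?th2" using *[of c] ** by linarith
qed

context
  fixes X :: "'a topology"
  assumes H: "Hausdorff_space X"
begin

lemma Mb_zero: "(\<lambda>A. 0) \<in> Mb X"
  unfolding Mb_iff using radon_signed_diff[OF H finite_radon_null[OF H] finite_radon_null[OF H]] by simp

lemma Mb_add: "\<mu> \<in> Mb X \<Longrightarrow> \<nu> \<in> Mb X \<Longrightarrow> (\<lambda>A. \<mu> A + \<nu> A) \<in> Mb X"
  unfolding Mb_iff by (simp add: real_pairing_add(1)[OF H])

lemma Mb_scale: "\<mu> \<in> Mb X \<Longrightarrow> (\<lambda>A. c * \<mu> A) \<in> Mb X"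
  unfolding Mb_iff
  using real_pairing_add(1)[OF H real_pairing_scale(1)[OF H] radon_signed_uminus[OF real_pairing_scale(1)[OF H]]]
    real_pairing_add(1)[OF H real_pairing_scale(1)[OF H] real_pairing_scale(1)[OF H]]
  by (auto simp: )

lemma Mb_pos:
  assumes "finite_radon X M"
  shows "pos_cmeas M \<in> Mb X"
  unfolding Mb_iff pos_cmeas_def
  using radon_signed_diff[OF H assms finite_radon_null[OF H], of "measure M"]
    radon_signed_diff[OF H finite_radon_null[OF H] finite_radon_null[OF H]] by simp

lemma pairing_pos:
  assumes "finite_radon X M" "f \<in> Cb X"
  shows "pairing X f (pos_cmeas M) = integral\<^sup>L M f"
  unfolding pairing_real_pairing pos_cmeas_def
  using real_pairing_diff[OF H assms(1) finite_radon_null[OF H], of "measure M" f]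
    real_pairing_diff[OF H finite_radon_null[OF H] finite_radon_null[OF H], of "\<lambda>A. 0" f] assms(2)
  by simp

lemma pairing_add:
  assumes "\<mu> \<in> Mb X" "\<nu> \<in> Mb X" "f \<in> Cb X"
  shows "pairing X f (\<lambda>A. \<mu> A + \<nu> A) = pairing X f \<mu> + pairing X f \<nu>"
  using assms unfolding Mb_iff pairing_real_pairing
  by (simp add: real_pairing_add(2)[OF H] algebra_simps)

lemma pairing_scale:
  assumes "\<mu> \<in> Mb X" "f \<in> Cb X"
  shows "pairing X f (\<lambda>A. c * \<mu> A) = c * pairing X f \<mu>"
proof -
  have r: "radon_signed X (\<lambda>A. Re (\<mu> A))" "radon_signed X (\<lambda>A. Im (\<mu> A))"
    using assms(1) unfolding Mb_iff by auto
  have "real_pairing X f (\<lambda>A. Re c * Re (\<mu> A) + (- Im c) * Im (\<mu> A)) =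
      Re c * real_pairing X f (\<lambda>A. Re (\<mu> A)) + (- Im c) * real_pairing X f (\<lambda>A. Im (\<mu> A))"
    using assms(2) r
    by (simp only: real_pairing_add(2)[OF H real_pairing_scale(1)[OF H] real_pairing_scale(1)[OF H]]
        real_pairing_scale(2)[OF H])
  moreover have "real_pairing X f (\<lambda>A. Re c * Im (\<mu> A) + Im c * Re (\<mu> A)) =
      Re c * real_pairing X f (\<lambda>A. Im (\<mu> A)) + Im c * real_pairing X f (\<lambda>A. Re (\<mu> A))"
    using assms(2) r
    by (simp only: real_pairing_add(2)[OF H real_pairing_scale(1)[OF H] real_pairing_scale(1)[OF H]]
        real_pairing_scale(2)[OF H])
  moreover have "c = complex_of_real (Re c) + \<i> * complex_of_real (Im c)"
    by (simp add: complex_eq)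
  ultimately show ?thesis
    unfolding pairing_real_pairing by (simp add: algebra_simps complex_eq_iff)
qed

text \<open>Every complex Radon measure is a linear combination of positive ones, so linear statements need
  only be checked for these.\<close>

lemma Mb_induct [consumes 1, case_names pos add scale]:
  assumes "\<mu> \<in> Mb X"
    and pos: "\<And>M. finite_radon X M \<Longrightarrow> Q (pos_cmeas M)"
    and add: "\<And>\<mu> \<nu>. \<lbrakk>\<mu> \<in> Mb X; \<nu> \<in> Mb X; Q \<mu>; Q \<nu>\<rbrakk> \<Longrightarrow> Q (\<lambda>A. \<mu> A + \<nu> A)"
    and scale: "\<And>c \<mu>. \<lbrakk>\<mu> \<in> Mb X; Q \<mu>\<rbrakk> \<Longrightarrow> Q (\<lambda>A. c * \<mu> A)"
  shows "Q \<mu>"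
proof -
  have real: "(\<lambda>A. complex_of_real (\<rho> A)) \<in> Mb X \<and> Q (\<lambda>A. complex_of_real (\<rho> A))"
    if \<rho>: "radon_signed X \<rho>" for \<rho>
  proof -
    obtain M N where MN: "finite_radon X M" "finite_radon X N" "\<And>A. \<rho> A = measure M A - measure N A"
      using radon_signed_decomp[OF \<rho>] by blast
    have "Q (\<lambda>A. pos_cmeas M A + (-1) * pos_cmeas N A)"
      using MN by (intro add scale pos Mb_pos Mb_scale)
    moreover have "(\<lambda>A. pos_cmeas M A + (-1) * pos_cmeas N A) \<in> Mb X"
      using MN by (intro Mb_add Mb_pos Mb_scale)
    moreover have "(\<lambda>A. pos_cmeas M A + (-1) * pos_cmeas N A) = (\<lambda>A. complex_of_real (\<rho> A))"
      using MN(3) by (simp add: pos_cmeas_def fun_eq_iff)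
    ultimately show ?thesis by simp
  qed
  have "radon_signed X (\<lambda>A. Re (\<mu> A))" "radon_signed X (\<lambda>A. Im (\<mu> A))"
    using assms(1) unfolding Mb_iff by auto
  note parts = this[THEN real]
  have "Q (\<lambda>A. complex_of_real (Re (\<mu> A)) + \<i> * complex_of_real (Im (\<mu> A)))"
    using parts by (intro add scale Mb_scale) simp_all
  moreover have "(\<lambda>A. complex_of_real (Re (\<mu> A)) + \<i> * complex_of_real (Im (\<mu> A))) = \<mu>"
    by (simp add: fun_eq_iff complex_eq_iff)
  ultimately show ?thesis by simp
qed

end

section \<open>The Riesz representation theorem for tight functionals\<close>

lemma completely_regular_separation:
  assumes "completely_regular_space X" "compactin X K" "openin X U" "K \<subseteq> U"
  obtains f :: "'a \<Rightarrow> real" where "continuous_map X euclideanreal f" "\<And>x. x \<in> topspace X \<Longrightarrow> 0 \<le> f x \<and> f x \<le> 1"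
    "\<And>x. x \<in> K \<Longrightarrow> f x = 1" "\<And>x. x \<in> topspace X - U \<Longrightarrow> f x = 0"
proof -
  have "closedin X (topspace X - U)" using assms(3) by (simp add: closedin_def openin_subset double_diff)
  moreover have "disjnt K (topspace X - U)" using assms(4) by (auto simp: disjnt_def)
  ultimately obtain f :: "'a \<Rightarrow> real" where "continuous_map X (top_of_set {0..1}) f"
    "f ` (topspace X - U) \<subseteq> {0}" "f ` K \<subseteq> {1}"
    using Urysohn_completely_regular_compact_closed[of 0 1 X K "topspace X - U"] assms(1,2)
    by (metis zero_le_one)
  then show thesis
    by (intro that[of f]) (auto simp: continuous_map_in_subtopology)
qed

text \<open>Tightness, that is, smallness of \<open>L\<close> on functions vanishing on a large compact set, is what allows
  all bounded continuous functions as arguments in place of compactly supported ones.\<close>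

locale tight_functional =
  fixes X :: "'a topology" and L :: "('a \<Rightarrow> real) \<Rightarrow> real"
  assumes creg: "completely_regular_space X" and haus: "Hausdorff_space X"
    and L_add: "\<lbrakk>continuous_map X euclideanreal f; bounded (f ` topspace X);
        continuous_map X euclideanreal g; bounded (g ` topspace X)\<rbrakk> \<Longrightarrow> L (\<lambda>x. f x + g x) = L f + L g"
    and L_scale: "\<lbrakk>continuous_map X euclideanreal f; bounded (f ` topspace X)\<rbrakk> \<Longrightarrow> L (\<lambda>x. c * f x) = c * L f"
    and L_pos: "\<lbrakk>continuous_map X euclideanreal f; bounded (f ` topspace X);
        \<And>x. x \<in> topspace X \<Longrightarrow> 0 \<le> f x\<rbrakk> \<Longrightarrow> 0 \<le> L f"
    and L_tight: "0 < \<epsilon> \<Longrightarrow> \<exists>K. compactin X K \<and> (\<forall>f. continuous_map X euclideanreal f \<and>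
        (\<forall>x\<in>topspace X. 0 \<le> f x \<and> f x \<le> 1) \<and> (\<forall>x\<in>K. f x = 0) \<longrightarrow> L f \<le> \<epsilon>)"
begin

definition real_Cb :: "('a \<Rightarrow> real) set" where
  "real_Cb = {f. continuous_map X euclideanreal f \<and> bounded (f ` topspace X)}"

definition unit_Cb :: "('a \<Rightarrow> real) set" where
  "unit_Cb = {f. continuous_map X euclideanreal f \<and> (\<forall>x\<in>topspace X. 0 \<le> f x \<and> f x \<le> 1)}"

lemma unit_Cb_real_Cb: "f \<in> unit_Cb \<Longrightarrow> f \<in> real_Cb"
  unfolding unit_Cb_def real_Cb_def by (auto intro!: boundedI[where B = 1])

lemma real_Cb_const [simp]: "(\<lambda>x. c) \<in> real_Cb"
  unfolding real_Cb_def by (auto intro!: boundedI[where B = "\<bar>c\<bar>"])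

lemma real_Cb_add [intro]: "f \<in> real_Cb \<Longrightarrow> g \<in> real_Cb \<Longrightarrow> (\<lambda>x. f x + g x) \<in> real_Cb"
  unfolding real_Cb_def by (auto intro!: continuous_map_add bounded_plus_comp)

lemma real_Cb_scale [intro]: "f \<in> real_Cb \<Longrightarrow> (\<lambda>x. c * f x) \<in> real_Cb"
proof -
  assume f: "f \<in> real_Cb"
  then obtain B where "\<And>x. x \<in> topspace X \<Longrightarrow> \<bar>f x\<bar> \<le> B"
    unfolding real_Cb_def bounded_iff by auto
  then have "bounded ((\<lambda>x. c * f x) ` topspace X)"
    by (intro boundedI[where B = "\<bar>c\<bar> * B"]) (auto simp: abs_mult intro!: mult_left_mono)
  then show ?thesis
    using f unfolding real_Cb_def by (auto intro: continuous_map_real_mult_left)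
qed

lemma real_Cb_diff [intro]: "f \<in> real_Cb \<Longrightarrow> g \<in> real_Cb \<Longrightarrow> (\<lambda>x. f x - g x) \<in> real_Cb"
  using real_Cb_add[of f "\<lambda>x. (-1) * g x"] real_Cb_scale[of g "-1"] by simp

lemma L_plus: "f \<in> real_Cb \<Longrightarrow> g \<in> real_Cb \<Longrightarrow> L (\<lambda>x. f x + g x) = L f + L g"
  unfolding real_Cb_def by (auto intro: L_add)

lemma L_mult: "f \<in> real_Cb \<Longrightarrow> L (\<lambda>x. c * f x) = c * L f"
  unfolding real_Cb_def by (auto intro: L_scale)

lemma L_minus: "f \<in> real_Cb \<Longrightarrow> g \<in> real_Cb \<Longrightarrow> L (\<lambda>x. f x - g x) = L f - L g"
  using L_plus[of f "\<lambda>x. (-1) * g x"] L_mult[of g "-1"] real_Cb_scale[of g "-1"] by simp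

lemma L_mono: "f \<in> real_Cb \<Longrightarrow> g \<in> real_Cb \<Longrightarrow> (\<And>x. x \<in> topspace X \<Longrightarrow> f x \<le> g x) \<Longrightarrow> L f \<le> L g"
  using L_pos[of "\<lambda>x. g x - f x"] L_minus[of g f] real_Cb_diff[of g f] unfolding real_Cb_def by simp

lemma real_Cb_sum: "finite I \<Longrightarrow> (\<And>i. i \<in> I \<Longrightarrow> h i \<in> real_Cb) \<Longrightarrow>
    (\<lambda>x. \<Sum>i\<in>I. h i x) \<in> real_Cb \<and> L (\<lambda>x. \<Sum>i\<in>I. h i x) = (\<Sum>i\<in>I. L (h i))"
proof (induction I rule: finite_induct)
  case empty
  then show ?case using L_mult[of "\<lambda>x. 1" 0] by simp
next
  case (insert i I)
  then show ?case using L_plus[of "h i" "\<lambda>x. \<Sum>i\<in>I. h i x"] real_Cb_add[of "h i" "\<lambda>x. \<Sum>i\<in>I. h i x"] by simp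
qed

lemma L_const: "L (\<lambda>x. c) = c * L (\<lambda>x. 1)"
  using L_mult[of "\<lambda>x. 1" c] by simp

lemma L_one_nonneg: "0 \<le> L (\<lambda>x. 1)"
  using L_mono[of "\<lambda>x. 0" "\<lambda>x. 1"] L_const[of 0] by simp

lemma L_unit_Cb_nonneg: "f \<in> unit_Cb \<Longrightarrow> 0 \<le> L f"
  using L_mono[of "\<lambda>x. 0" f] L_const[of 0] unit_Cb_real_Cb[of f] unfolding unit_Cb_def by simp

text \<open>For open \<open>U\<close> this is the value of the measure under construction.\<close>

definition vol :: "'a set \<Rightarrow> ennreal" where
  "vol U = (SUP f\<in>{f \<in> unit_Cb. \<forall>x\<in>topspace X - U. f x = 0}. ennreal (L f))"

lemma vol_ge: "f \<in> unit_Cb \<Longrightarrow> (\<And>x. x \<in> topspace X - U \<Longrightarrow> f x = 0) \<Longrightarrow> ennreal (L f) \<le> vol U"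
  unfolding vol_def by (rule SUP_upper) auto

lemma vol_le: "vol U \<le> ennreal (L (\<lambda>x. 1))"
  unfolding vol_def
proof (rule SUP_least)
  fix f assume "f \<in> {f \<in> unit_Cb. \<forall>x\<in>topspace X - U. f x = 0}"
  then have f: "f \<in> unit_Cb" by simp
  show "ennreal (L f) \<le> ennreal (L (\<lambda>x. 1))"
    using f by (intro ennreal_leI L_mono unit_Cb_real_Cb[OF f]) (auto simp: unit_Cb_def)
qed

lemma vol_mono: "U \<subseteq> V \<Longrightarrow> vol U \<le> vol V"
  unfolding vol_def by (rule SUP_subset_mono) auto

lemma vol_empty: "vol {} = 0"
proof -
  have "ennreal (L f) \<le> 0" if "f \<in> unit_Cb" "\<forall>x\<in>topspace X - {}. f x = 0" for f
    using L_mono[of f "\<lambda>x. 0"] L_const[of 0] unit_Cb_real_Cb that by (simp add: ennreal_neg)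
  then show ?thesis
    unfolding vol_def by (auto intro!: antisym SUP_least)
qed

lemma zero_unit_Cb: "(\<lambda>x. 0) \<in> unit_Cb" and one_unit_Cb: "(\<lambda>x. 1) \<in> unit_Cb"
  unfolding unit_Cb_def by auto

lemma vol_topspace: "vol (topspace X) = ennreal (L (\<lambda>x. 1))"
  by (intro antisym vol_le vol_ge one_unit_Cb) auto

text \<open>The single estimate behind subadditivity and regularity: a function that exceeds \<open>\<epsilon>\<close> on a
  large compact set only inside the \<open>U n\<close> is dominated, up to small errors, by bumps supported in
  finitely many of the \<open>U n\<close>.\<close>

lemma L_le_sum_vol:
  assumes f: "f \<in> unit_Cb" and e: "0 < \<epsilon>"
    and K: "compactin X K"
      "\<And>f. \<lbrakk>f \<in> unit_Cb; \<forall>x\<in>K. f x = 0\<rbrakk> \<Longrightarrow> L f \<le> \<epsilon>"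
    and U: "\<And>n. openin X (U n)" and cover: "{x \<in> K. \<epsilon> \<le> f x} \<subseteq> (\<Union>n. U n)"
  shows "ennreal (L f) \<le> (\<Sum>n. vol (U n)) + ennreal (\<epsilon> * (L (\<lambda>x. 1) + 1))"
proof -
  have Ktop: "K \<subseteq> topspace X" using K(1) by (rule compactin_subset_topspace)
  have fc: "continuous_map X euclideanreal f" and f01: "\<And>x. x \<in> topspace X \<Longrightarrow> 0 \<le> f x \<and> f x \<le> 1"
    using f by (auto simp: unit_Cb_def)
  define C where "C = {x \<in> K. \<epsilon> \<le> f x}"
  have "closedin X {x \<in> topspace X. f x \<in> {\<epsilon>..}}"
    by (rule closedin_continuous_map_preimage[OF fc]) simp
  moreover have "C = K \<inter> {x \<in> topspace X. f x \<in> {\<epsilon>..}}" using Ktop by (auto simp: C_def)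
  ultimately have C: "compactin X C" using compact_Int_closedin[OF K(1)] by simp
  have "\<exists>n h. x \<in> U n \<and> h \<in> unit_Cb \<and> h x = 1 \<and> (\<forall>y\<in>topspace X - U n. h y = 0)" if x: "x \<in> C" for x
  proof -
    obtain n where n: "x \<in> U n" using x cover by (auto simp: C_def)
    have "compactin X {x}" using x C compactin_subset_topspace[OF C] by auto
    then show ?thesis
      using completely_regular_separation[OF creg, of "{x}" "U n"] U n
      unfolding unit_Cb_def by (smt (verit) empty_subsetI insert_subset mem_Collect_eq singletonI)
  qed
  then obtain n h where nh: "\<And>x. x \<in> C \<Longrightarrow> x \<in> U (n x)" "\<And>x. x \<in> C \<Longrightarrow> h x \<in> unit_Cb"
      "\<And>x. x \<in> C \<Longrightarrow> h x x = (1::real)" "\<And>x y. x \<in> C \<Longrightarrow> y \<in> topspace X - U (n x) \<Longrightarrow> h x y = 0"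
    by metis
  define V where "V x = {y \<in> topspace X. h x y \<in> {1/2<..}}" for x
  have "openin X (V x)" if "x \<in> C" for x
    unfolding V_def using nh(2)[OF that]
    by (intro openin_continuous_map_preimage[where Y = euclidean]) (auto simp: unit_Cb_def)
  moreover have "C \<subseteq> \<Union> (V ` C)"
    using nh(3) compactin_subset_topspace[OF C] by (auto simp: V_def)
  ultimately obtain \<F> where \<F>: "finite \<F>" "\<F> \<subseteq> V ` C" "C \<subseteq> \<Union> \<F>"
    using compactinD[OF C, of "V ` C"] by auto
  obtain D where D: "D \<subseteq> C" "finite D" "\<F> = V ` D"
    using finite_subset_image[OF \<F>(1,2)] by auto
  define N where "N = Suc (Max (insert 0 (n ` D)))"
  have N: "n x < N" if "x \<in> D" for x
    unfolding N_def using D(2) that by (auto intro: le_imp_less_Suc)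
  define s where "s k y = (\<Sum>x\<in>{x \<in> D. n x = k}. h x y)" for k y
  define H where "H k y = min 1 (2 * s k y)" for k y
  have h0: "0 \<le> h x y" if "x \<in> D" "y \<in> topspace X" for x y
    using nh(2)[of x] D(1) that by (auto simp: unit_Cb_def)
  have s0: "0 \<le> s k y" if "y \<in> topspace X" for k y
    unfolding s_def using h0 that by (intro sum_nonneg) auto
  have H: "H k \<in> unit_Cb" for k
  proof -
    have "continuous_map X euclideanreal (s k)"
      unfolding s_def using D(1,2) nh(2) by (intro continuous_map_sum) (auto simp: unit_Cb_def)
    then have "continuous_map X euclideanreal (H k)"
      unfolding H_def by (intro continuous_map_real_min continuous_map_real_mult_left) auto
    then show ?thesis using s0 by (auto simp: unit_Cb_def H_def)
  qed
  have HU: "H k y = 0" if "y \<in> topspace X - U k" for k y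
  proof -
    have "s k y = 0" unfolding s_def using nh(4) D(1) that by (intro sum.neutral) auto
    then show ?thesis by (simp add: H_def)
  qed
  have H1: "1 \<le> (\<Sum>k<N. H k y)" if y: "y \<in> C" for y
  proof -
    have yt: "y \<in> topspace X" using y compactin_subset_topspace[OF C] by auto
    obtain x where x: "x \<in> D" "1/2 < h x y"
      using y \<F>(3) D(3) by (auto simp: V_def)
    have "h x y \<le> s (n x) y"
      unfolding s_def using x D(2) h0 yt by (intro member_le_sum) auto
    then have "1 \<le> H (n x) y" using x by (simp add: H_def)
    also have "\<dots> \<le> (\<Sum>k<N. H k y)"
      using N[OF x(1)] H yt by (intro member_le_sum) (auto simp: unit_Cb_def)
    finally show ?thesis .
  qed
  define S where "S y = (\<Sum>k<N. H k y)" for y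
  have S: "S \<in> real_Cb" "L S = (\<Sum>k<N. L (H k))"
    using real_Cb_sum[of "{..<N}" H] H unit_Cb_real_Cb unfolding S_def by auto
  have S0: "0 \<le> S y" if "y \<in> topspace X" for y
    unfolding S_def using H that by (intro sum_nonneg) (auto simp: unit_Cb_def)
  \<comment> \<open>The remainder vanishes on \<open>K\<close>: where \<open>f\<close> exceeds \<open>\<epsilon>\<close>, the bumps already add up to \<open>1\<close>.\<close>
  define r where "r y = max 0 (f y - \<epsilon> - S y)" for y
  have r: "r \<in> unit_Cb"
  proof -
    have "continuous_map X euclideanreal r"
      unfolding r_def using fc S(1)
      by (intro continuous_map_real_max continuous_map_diff) (auto simp: real_Cb_def)
    moreover have "0 \<le> r y \<and> r y \<le> 1" if "y \<in> topspace X" for y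
      using f01[OF that] S0[OF that] e by (auto simp: r_def)
    ultimately show ?thesis by (simp add: unit_Cb_def)
  qed
  have "r y = 0" if "y \<in> K" for y
  proof (cases "\<epsilon> \<le> f y")
    case True
    then have "1 \<le> S y" using H1 that by (auto simp: S_def C_def)
    then show ?thesis using f01[of y] that Ktop e by (auto simp: r_def)
  next
    case False
    then show ?thesis using S0[of y] that Ktop by (auto simp: r_def)
  qed
  then have Lr: "L r \<le> \<epsilon>" using K(2)[OF r] by auto
  have sumCb: "(\<lambda>y. S y + r y) \<in> real_Cb" "(\<lambda>y. \<epsilon> + (S y + r y)) \<in> real_Cb"
    using S(1) unit_Cb_real_Cb[OF r] by auto
  have "L f \<le> L (\<lambda>y. \<epsilon> + (S y + r y))"
    using unit_Cb_real_Cb[OF f] sumCb by (intro L_mono) (auto simp: r_def)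
  also have "\<dots> = \<epsilon> * L (\<lambda>x. 1) + (L S + L r)"
    using L_plus[OF real_Cb_const sumCb(1), of \<epsilon>] L_plus[OF S(1) unit_Cb_real_Cb[OF r]] L_const[of \<epsilon>] by simp
  also have "\<dots> \<le> (\<Sum>k<N. L (H k)) + \<epsilon> * (L (\<lambda>x. 1) + 1)"
    using Lr S(2) by (simp add: algebra_simps)
  finally have "ennreal (L f) \<le> ennreal ((\<Sum>k<N. L (H k)) + \<epsilon> * (L (\<lambda>x. 1) + 1))"
    by (rule ennreal_leI)
  also have "\<dots> = (\<Sum>k<N. ennreal (L (H k))) + ennreal (\<epsilon> * (L (\<lambda>x. 1) + 1))"
    using L_unit_Cb_nonneg[OF H] L_one_nonneg e by (simp add: ennreal_plus sum_nonneg sum_ennreal)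
  also have "(\<Sum>k<N. ennreal (L (H k))) \<le> (\<Sum>k<N. vol (U k))"
    using H HU by (intro sum_mono vol_ge) auto
  also have "\<dots> \<le> (\<Sum>k. vol (U k))" by (rule sum_le_suminf) auto
  finally show ?thesis by (simp add: add_right_mono)
qed

lemma tight_compact:
  assumes "0 < \<epsilon>"
  obtains K where "compactin X K" "\<And>f. \<lbrakk>f \<in> unit_Cb; \<forall>x\<in>K. f x = 0\<rbrakk> \<Longrightarrow> L f \<le> \<epsilon>"
  using L_tight[OF assms] unfolding unit_Cb_def by auto

lemma small_multiple: "0 < e \<Longrightarrow> \<exists>\<epsilon>>0. \<epsilon> * (L (\<lambda>x. 1) + 1) \<le> e"
  using L_one_nonneg by (intro exI[of _ "e / (L (\<lambda>x. 1) + 1)"]) auto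

lemma vol_UN:
  assumes U: "\<And>n. openin X (U n)"
  shows "vol (\<Union>n. U n) \<le> (\<Sum>n. vol (U n))"
  unfolding vol_def[of "\<Union>n. U n"]
proof (rule SUP_least)
  fix f assume "f \<in> {f \<in> unit_Cb. \<forall>x\<in>topspace X - (\<Union>n. U n). f x = 0}"
  then have f: "f \<in> unit_Cb" "\<forall>x\<in>topspace X - (\<Union>n. U n). f x = 0" by auto
  show "ennreal (L f) \<le> (\<Sum>n. vol (U n))"
  proof (rule ennreal_le_epsilon)
    fix e :: real assume "0 < e"
    then obtain \<epsilon> where \<epsilon>: "0 < \<epsilon>" "\<epsilon> * (L (\<lambda>x. 1) + 1) \<le> e" using small_multiple by auto
    obtain K where K: "compactin X K" "\<And>f. \<lbrakk>f \<in> unit_Cb; \<forall>x\<in>K. f x = 0\<rbrakk> \<Longrightarrow> L f \<le> \<epsilon>"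
      using tight_compact[OF \<epsilon>(1)] by auto
    have "{x \<in> K. \<epsilon> \<le> f x} \<subseteq> (\<Union>n. U n)"
      using f(2) \<epsilon>(1) compactin_subset_topspace[OF K(1)] by force
    then have "ennreal (L f) \<le> (\<Sum>n. vol (U n)) + ennreal (\<epsilon> * (L (\<lambda>x. 1) + 1))"
      by (intro L_le_sum_vol[OF f(1) \<epsilon>(1) K U])
    also have "\<dots> \<le> (\<Sum>n. vol (U n)) + ennreal e"
      using \<epsilon>(2) by (intro add_left_mono ennreal_leI)
    finally show "ennreal (L f) \<le> (\<Sum>n. vol (U n)) + ennreal e" .
  qed
qed

definition outer :: "'a set \<Rightarrow> ennreal" where
  "outer A = (INF U\<in>{U. openin X U \<and> A \<subseteq> U}. vol U)"

lemma outer_le: "openin X U \<Longrightarrow> A \<subseteq> U \<Longrightarrow> outer A \<le> vol U"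
  unfolding outer_def by (rule INF_lower) auto

lemma outer_open: "openin X U \<Longrightarrow> outer U = vol U"
  by (rule antisym) (auto simp: outer_def intro!: INF_greatest vol_mono intro: INF_lower)

lemma outer_mono: "A \<subseteq> B \<Longrightarrow> outer A \<le> outer B"
  unfolding outer_def by (rule INF_superset_mono) auto

lemma outer_close:
  assumes "outer A < e"
  obtains U where "openin X U" "A \<subseteq> U" "vol U < e"
proof -
  from assms have "\<exists>U\<in>{U. openin X U \<and> A \<subseteq> U}. vol U < e"
    by (simp only: outer_def INF_less_iff)
  then show thesis using that by auto
qed

lemma outer_UN: "outer (\<Union>n. A n) \<le> (\<Sum>n. outer (A n))"
proof (rule ennreal_le_epsilon)
  fix e :: real assume e: "0 < e" and fin: "(\<Sum>n. outer (A n)) < top"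
  then have "outer (A n) < outer (A n) + e * (1/2) ^ Suc n" for n
    by (auto simp add: less_top dest!: ennreal_suminf_lessD)
  then have "\<exists>U. openin X U \<and> A n \<subseteq> U \<and> vol U < outer (A n) + e * (1/2) ^ Suc n" for n
    using outer_close by metis
  then obtain U where U: "\<And>n. openin X (U n)" "\<And>n. A n \<subseteq> U n"
      "\<And>n. vol (U n) < outer (A n) + e * (1/2) ^ Suc n"
    by metis
  have "outer (\<Union>n. A n) \<le> vol (\<Union>n. U n)"
    using U by (intro outer_le openin_Union) auto
  also have "\<dots> \<le> (\<Sum>n. vol (U n))" by (rule vol_UN[OF U(1)])
  also have "\<dots> \<le> (\<Sum>n. outer (A n) + e * (1/2) ^ Suc n)"
    using U(3) by (intro suminf_le less_imp_le) auto
  also have "\<dots> = (\<Sum>n. outer (A n)) + (\<Sum>n. ennreal e * ennreal ((1/2) ^ Suc n))"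
    using e by (subst suminf_add[symmetric])
      (auto simp del: ennreal_suminf_cmult simp add: ennreal_mult[symmetric])
  also have "\<dots> = (\<Sum>n. outer (A n)) + e"
    unfolding ennreal_suminf_cmult
    by (subst suminf_ennreal_eq[OF zero_le_power power_half_series]) auto
  finally show "outer (\<Union>n. A n) \<le> (\<Sum>n. outer (A n)) + ennreal e" .
qed

lemma outer_measure_space_outer: "outer_measure_space (Pow (topspace X)) outer"
  unfolding outer_measure_space_def positive_def increasing_def countably_subadditive_def
  using outer_UN outer_open[of "{}"] by (auto simp: vol_empty outer_mono)

text \<open>The key to the measurability of open sets: shaving \<open>\<epsilon>\<close> off a function supported in \<open>V \<inter> U\<close> leaves
  room for any function supported where it was below \<open>\<epsilon>\<close>, and that region covers \<open>V - U\<close>.\<close>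

lemma vol_split:
  assumes U: "openin X U" and V: "openin X V"
  shows "vol (V \<inter> U) + outer (V - U) \<le> vol V"
proof -
  have ne: "{f \<in> unit_Cb. \<forall>x\<in>topspace X - A. f x = 0} \<noteq> {}" for A using zero_unit_Cb by auto
  have "vol (V \<inter> U) + outer (V - U) =
      (SUP f\<in>{f \<in> unit_Cb. \<forall>x\<in>topspace X - V \<inter> U. f x = 0}. ennreal (L f) + outer (V - U))"
    unfolding vol_def by (rule ennreal_SUP_add_left[symmetric, OF ne])
  also have "\<dots> \<le> vol V"
  proof (rule SUP_least)
    fix f assume "f \<in> {f \<in> unit_Cb. \<forall>x\<in>topspace X - V \<inter> U. f x = 0}"
    then have f: "f \<in> unit_Cb" "\<And>x. x \<in> topspace X - V \<inter> U \<Longrightarrow> f x = 0" by auto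
    then have fc: "continuous_map X euclideanreal f"
        and f01: "\<And>x. x \<in> topspace X \<Longrightarrow> 0 \<le> f x \<and> f x \<le> 1" by (auto simp: unit_Cb_def)
    show "ennreal (L f) + outer (V - U) \<le> vol V"
    proof (rule ennreal_le_epsilon)
      fix e :: real assume "0 < e"
      then obtain \<epsilon> where \<epsilon>: "0 < \<epsilon>" "\<epsilon> * (L (\<lambda>x. 1) + 1) \<le> e" using small_multiple by auto
      have "openin X {x \<in> topspace X. f x \<in> {..<\<epsilon>}}"
        by (rule openin_continuous_map_preimage[OF fc]) simp
      then have W: "openin X (V \<inter> {x \<in> topspace X. f x \<in> {..<\<epsilon>}})" (is "openin X ?W")
        using V by auto
      have "outer (V - U) \<le> vol ?W"
        using f(2) \<epsilon>(1) openin_subset[OF V] by (intro outer_le[OF W]) auto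
      moreover have "ennreal (L f) + vol ?W \<le> vol V + ennreal e"
      proof -
        have "ennreal (L f) + vol ?W =
          (SUP g\<in>{g \<in> unit_Cb. \<forall>x\<in>topspace X - ?W. g x = 0}. ennreal (L f) + ennreal (L g))"
          unfolding vol_def by (rule ennreal_SUP_add_right[OF ne])
        also have "\<dots> \<le> vol V + ennreal e"
        proof (rule SUP_least)
          fix g assume "g \<in> {g \<in> unit_Cb. \<forall>x\<in>topspace X - ?W. g x = 0}"
          then have g: "g \<in> unit_Cb" "\<And>x. x \<in> topspace X - ?W \<Longrightarrow> g x = 0" by auto
          \<comment> \<open>At most \<open>1\<close>, since \<open>g\<close> lives where \<open>f < \<epsilon>\<close>.\<close>
          define k where "k x = max 0 (f x - \<epsilon>) + g x" for x
          have kc: "continuous_map X euclideanreal k"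
            unfolding k_def using fc g(1)
            by (intro continuous_map_add continuous_map_real_max continuous_map_diff) (auto simp: unit_Cb_def)
          have k01: "0 \<le> k x \<and> k x \<le> 1" if x: "x \<in> topspace X" for x
          proof (cases "x \<in> ?W")
            case True
            then show ?thesis using g(1) x by (auto simp: k_def unit_Cb_def)
          next
            case False
            then show ?thesis using g(2)[of x] f01[OF x] x \<epsilon>(1) by (auto simp: k_def)
          qed
          have k: "k \<in> unit_Cb" using kc k01 by (simp add: unit_Cb_def)
          have "k x = 0" if "x \<in> topspace X - V" for x
            using g(2)[of x] f(2)[of x] that \<epsilon>(1) by (auto simp: k_def)
          then have "ennreal (L k) \<le> vol V" by (rule vol_ge[OF k])
          have sumCb: "(\<lambda>x. k x + \<epsilon>) \<in> real_Cb" "(\<lambda>x. f x + g x) \<in> real_Cb"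
            using k f(1) g(1) unit_Cb_real_Cb by auto
          have "L f + L g = L (\<lambda>x. f x + g x)" using f(1) g(1) unit_Cb_real_Cb by (simp add: L_plus)
          also have "\<dots> \<le> L (\<lambda>x. k x + \<epsilon>)"
            by (rule L_mono[OF sumCb(2,1)]) (auto simp: k_def)
          also have "\<dots> = L k + \<epsilon> * L (\<lambda>x. 1)"
            using L_plus[OF unit_Cb_real_Cb[OF k] real_Cb_const[of \<epsilon>]] L_const[of \<epsilon>] by simp
          also have "\<dots> \<le> L k + e" using \<epsilon> by (simp add: algebra_simps)
          finally have "ennreal (L f + L g) \<le> ennreal (L k + e)" by (rule ennreal_leI)
          then have "ennreal (L f) + ennreal (L g) \<le> ennreal (L k) + ennreal e"
            using L_unit_Cb_nonneg f(1) g(1) k \<open>0 < e\<close> by (simp add: ennreal_plus)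
          also have "\<dots> \<le> vol V + ennreal e"
            using \<open>ennreal (L k) \<le> vol V\<close> by (rule add_right_mono)
          finally show "ennreal (L f) + ennreal (L g) \<le> vol V + ennreal e" .
        qed
        finally show ?thesis .
      qed
      ultimately show "ennreal (L f) + outer (V - U) \<le> vol V + ennreal e"
        by (meson add_left_mono order_trans)
    qed
  qed
  finally show ?thesis .
qed

definition riesz_measure :: "'a measure" where
  "riesz_measure = measure_of (topspace X) (sets (borel_of X)) outer"

lemma sets_riesz [simp]: "sets riesz_measure = sets (borel_of X)"
  unfolding riesz_measure_def using sets.space_closed[of "borel_of X"] sets.sigma_sets_eq[of "borel_of X"]
  by (simp add: sets_measure_of)

lemma space_riesz [simp]: "space riesz_measure = topspace X"
  using sets_eq_imp_space_eq[OF sets_riesz] by simp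

text \<open>By \<open>vol_split\<close> open sets, hence Borel sets, satisfy the Caratheodory condition for the outer measure.\<close>

lemma emeasure_riesz:
  assumes A: "A \<in> sets (borel_of X)"
  shows "emeasure riesz_measure A = outer A"
proof -
  interpret P: sigma_algebra "topspace X" "Pow (topspace X)" by (rule sigma_algebra_Pow)
  let ?\<Lambda> = "lambda_system (topspace X) (Pow (topspace X)) outer"
  have ms: "measure_space (topspace X) ?\<Lambda> outer"
    by (rule P.caratheodory_lemma[OF outer_measure_space_outer])
  then interpret S: sigma_algebra "topspace X" ?\<Lambda> by (simp add: measure_space_def)
  have "U \<in> ?\<Lambda>" if U: "openin X U" for U
    unfolding P.lambda_system_eq
  proof (intro CollectI conjI ballI antisym)
    show "U \<in> Pow (topspace X)" using openin_subset[OF U] by simp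
    fix E assume "E \<in> Pow (topspace X)"
    have "outer E \<le> outer ((\<Union>n. binaryset (E \<inter> U) (E - U) n))"
      by (rule outer_mono) (auto simp: UN_binaryset_eq)
    also have "\<dots> \<le> (\<Sum>n. outer (binaryset (E \<inter> U) (E - U) n))" by (rule outer_UN)
    also have "\<dots> = outer (E \<inter> U) + outer (E - U)"
      by (rule suminf_binaryset_eq) (simp add: outer_open vol_empty)
    finally show "outer E \<le> outer (E \<inter> U) + outer (E - U)" .
    show "outer (E \<inter> U) + outer (E - U) \<le> outer E"
      unfolding outer_def[of E]
    proof (rule INF_greatest)
      fix V assume "V \<in> {V. openin X V \<and> E \<subseteq> V}"
      then have V: "openin X V" "E \<subseteq> V" by auto
      have "outer (E \<inter> U) \<le> vol (V \<inter> U)" using U V by (intro outer_le) auto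
      moreover have "outer (E - U) \<le> outer (V - U)" using V by (intro outer_mono) auto
      ultimately have "outer (E \<inter> U) + outer (E - U) \<le> vol (V \<inter> U) + outer (V - U)"
        by (rule add_mono)
      also have "\<dots> \<le> vol V" by (rule vol_split[OF U V(1)])
      finally show "outer (E \<inter> U) + outer (E - U) \<le> vol V" .
    qed
  qed
  then have "sets (borel_of X) \<subseteq> ?\<Lambda>"
    unfolding sets_borel_of by (intro S.sigma_sets_subset) auto
  then have ca: "countably_additive (sets (borel_of X)) outer"
    using ms unfolding measure_space_def countably_additive_def by blast
  show ?thesis
    using riesz_measure_def
  proof (rule emeasure_measure_of)
    show "sets (borel_of X) \<subseteq> Pow (topspace X)" using sets.space_closed[of "borel_of X"] by simp
    show "positive (sets riesz_measure) outer"
      by (simp add: positive_def outer_open vol_empty)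
    show "countably_additive (sets riesz_measure) outer" using ca by simp
  qed (simp add: A)
qed

lemma finite_riesz: "finite_measure riesz_measure"
  using vol_le[of "topspace X"]
  by (intro finite_measureI) (auto simp: emeasure_riesz outer_open top_unique)

lemma vol_eq_measure: "openin X U \<Longrightarrow> vol U = ennreal (measure riesz_measure U)"
  using finite_measure.emeasure_eq_measure[OF finite_riesz, of U]
  by (simp add: emeasure_riesz openin_borel_of outer_open)

lemma L_le_measure:
  assumes "f \<in> unit_Cb" "openin X U" "\<And>x. x \<in> topspace X - U \<Longrightarrow> f x = 0"
  shows "L f \<le> measure riesz_measure U"
  using vol_ge[OF assms(1), of U] assms(3) vol_eq_measure[OF assms(2)] by (simp add: ennreal_le_iff)

text \<open>Outer regularity is built in. For inner regularity, the compact set inside \<open>U\<close> on which a nearly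
  optimal function for \<open>U\<close> is at least \<open>\<epsilon>\<close> carries almost all the mass, by \<open>L_le_sum_vol\<close> with a single
  open neighbourhood of it.\<close>

lemma finite_radon_riesz: "finite_radon X riesz_measure"
proof (rule finite_radonI[OF haus finite_riesz sets_riesz])
  interpret finite_measure riesz_measure by (rule finite_riesz)
  have outer: "\<exists>U. openin X U \<and> A \<subseteq> U \<and> measure riesz_measure U \<le> measure riesz_measure A + e"
    if A: "A \<in> sets (borel_of X)" and e: "0 < e" for A e
  proof -
    have "outer A < ennreal (measure riesz_measure A + e)"
      using emeasure_riesz[OF A] e by (simp add: emeasure_eq_measure ennreal_less_iff flip: emeasure_riesz[OF A])
    then obtain U where U: "openin X U" "A \<subseteq> U" "vol U < ennreal (measure riesz_measure A + e)"
      by (rule outer_close)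
    then have "measure riesz_measure U < measure riesz_measure A + e"
      by (simp add: vol_eq_measure ennreal_less_iff)
    with U show ?thesis by (intro exI[of _ U]) simp
  qed
  then show "\<exists>U. openin X U \<and> A \<subseteq> U \<and> measure riesz_measure U \<le> measure riesz_measure A + e"
    if "A \<in> sets (borel_of X)" "0 < e" for A e using that .
  show "\<exists>K. compactin X K \<and> K \<subseteq> U \<and> measure riesz_measure U \<le> measure riesz_measure K + e"
    if U: "openin X U" and e: "0 < e" for U e
  proof (cases "measure riesz_measure U < e")
    case True
    then show ?thesis by (intro exI[of _ "{}"]) simp
  next
    case False
    have e3: "0 < e/3" using e by simp
    have "ennreal (measure riesz_measure U - e/3) < vol U"
      using False e by (simp add: vol_eq_measure[OF U] ennreal_less_iff)
    then have "\<exists>f\<in>{f \<in> unit_Cb. \<forall>x\<in>topspace X - U. f x = 0}. ennreal (measure riesz_measure U - e/3) < ennreal (L f)"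
      by (simp only: vol_def less_SUP_iff)
    then obtain f where f: "f \<in> unit_Cb" "\<And>x. x \<in> topspace X - U \<Longrightarrow> f x = 0"
        "ennreal (measure riesz_measure U - e/3) < ennreal (L f)"
      by auto
    then have Lf: "measure riesz_measure U - e/3 < L f"
      using False e by (simp add: ennreal_less_iff)
    obtain \<epsilon> where \<epsilon>: "0 < \<epsilon>" "\<epsilon> * (L (\<lambda>x. 1) + 1) \<le> e/3" using small_multiple[OF e3] by auto
    obtain K where K: "compactin X K" "\<And>f. \<lbrakk>f \<in> unit_Cb; \<forall>x\<in>K. f x = 0\<rbrakk> \<Longrightarrow> L f \<le> \<epsilon>"
      using tight_compact[OF \<epsilon>(1)] by auto
    define C where "C = {x \<in> K. \<epsilon> \<le> f x}"
    have "closedin X {x \<in> topspace X. f x \<in> {\<epsilon>..}}"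
      using f(1) by (intro closedin_continuous_map_preimage[where Y = euclidean]) (auto simp: unit_Cb_def)
    moreover have "C = K \<inter> {x \<in> topspace X. f x \<in> {\<epsilon>..}}"
      using compactin_subset_topspace[OF K(1)] by (auto simp: C_def)
    ultimately have C: "compactin X C" using compact_Int_closedin[OF K(1)] by simp
    have CU: "C \<subseteq> U" using f(2) \<epsilon>(1) compactin_subset_topspace[OF C] by (force simp: C_def)
    obtain W where W: "openin X W" "C \<subseteq> W" "measure riesz_measure W \<le> measure riesz_measure C + e/3"
      using outer[OF closedin_borel_of[OF compactin_imp_closedin[OF haus C]] e3] by auto
    have "ennreal (L f) \<le> (\<Sum>n. vol (if n = (0::nat) then W else {})) + ennreal (\<epsilon> * (L (\<lambda>x. 1) + 1))"
      using W by (intro L_le_sum_vol[OF f(1) \<epsilon>(1) K]) (auto simp: C_def split: if_splits)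
    also have "(\<Sum>n. vol (if n = (0::nat) then W else {})) = (\<Sum>n\<in>{0::nat}. vol (if n = 0 then W else {}))"
      by (rule suminf_finite) (auto simp: vol_empty)
    also have "\<dots> + ennreal (\<epsilon> * (L (\<lambda>x. 1) + 1)) \<le> ennreal (measure riesz_measure W) + ennreal (e/3)"
      using \<epsilon>(2) by (auto simp: vol_eq_measure[OF W(1)] intro!: add_left_mono ennreal_leI)
    also have "\<dots> = ennreal (measure riesz_measure W + e/3)"
      using e by (simp add: ennreal_plus)
    finally have "L f \<le> measure riesz_measure W + e/3"
      using e by (simp add: ennreal_le_iff del: ennreal_plus)
    then show ?thesis using C CU Lf W(3) by (intro exI[of _ C]) auto
  qed
qed

text \<open>Cut \<open>n f\<close> into \<open>n\<close> layers of height \<open>1\<close>. Each layer lies between the indicators of two consecutive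
  superlevel sets, so the functional and the integral of \<open>n f\<close> differ by at most one layer, whatever \<open>n\<close> is.\<close>

lemma L_le_integral:
  assumes f: "f \<in> unit_Cb"
  shows "L f \<le> integral\<^sup>L riesz_measure f"
proof -
  interpret finite_measure riesz_measure by (rule finite_riesz)
  have fc: "continuous_map X euclideanreal f" and f01: "\<And>x. x \<in> topspace X \<Longrightarrow> 0 \<le> f x \<and> f x \<le> 1"
    using f by (auto simp: unit_Cb_def)
  have int: "integrable riesz_measure g" if "g \<in> real_Cb" for g
    using that finite_riesz by (intro bounded_continuous_integrable[of _ X]) (auto simp: real_Cb_def)
  have bound: "n * L f \<le> L (\<lambda>x. 1) + n * integral\<^sup>L riesz_measure f" for n :: nat
  proof -
    define g where "g i x = min 1 (max 0 (n * f x - real i))" for i x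
    define U where "U i = {x \<in> topspace X. n * f x \<in> {real i<..}}" for i
    have nfc: "continuous_map X euclideanreal (\<lambda>x. n * f x)"
      using fc by (intro continuous_map_real_mult_left)
    have U: "openin X (U i)" for i
      unfolding U_def by (rule openin_continuous_map_preimage[OF nfc]) simp
    have g: "g i \<in> unit_Cb" for i
      unfolding unit_Cb_def g_def
      by (auto intro!: continuous_map_real_min continuous_map_real_max continuous_map_diff nfc)
    have ident: "(\<Sum>i<N. min 1 (max 0 (y - real i))) = min (real N) y" if "0 \<le> y" for N y
      using that by (induction N) (auto simp: min_def max_def)
    have sum: "(\<Sum>i<n. g i x) = n * f x" if "x \<in> topspace X" for x
      using ident[of "n * f x" n] f01[OF that] by (simp add: g_def mult_left_le)
    have "n * L f = L (\<lambda>x. n * f x)" using unit_Cb_real_Cb[OF f] by (simp add: L_mult)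
    also have "\<dots> \<le> L (\<lambda>x. \<Sum>i<n. g i x)"
      using real_Cb_sum[of "{..<n}" g] g unit_Cb_real_Cb f sum by (intro L_mono) auto
    also have "\<dots> = (\<Sum>i<n. L (g i))" using real_Cb_sum[of "{..<n}" g] g unit_Cb_real_Cb by auto
    also have "\<dots> \<le> (\<Sum>i<n. measure riesz_measure (U i))"
      by (intro sum_mono L_le_measure g U) (auto simp: g_def U_def)
    also have "\<dots> \<le> measure riesz_measure (U 0) + (\<Sum>i<n. measure riesz_measure (U (Suc i)))"
      using sum.lessThan_Suc_shift[of "\<lambda>i. measure riesz_measure (U i)" n]
        measure_nonneg[of riesz_measure "U n"] by (simp del: measure_nonneg)
    also have "measure riesz_measure (U 0) \<le> L (\<lambda>x. 1)"
      using vol_le[of "U 0"] L_one_nonneg by (simp add: vol_eq_measure[OF U] ennreal_le_iff)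
    also have "(\<Sum>i<n. measure riesz_measure (U (Suc i))) \<le> (\<Sum>i<n. integral\<^sup>L riesz_measure (g i))"
    proof (rule sum_mono)
      fix i
      have "measure riesz_measure (U (Suc i)) = integral\<^sup>L riesz_measure (indicator (U (Suc i)))"
        using openin_borel_of[OF U] openin_subset[OF U] by (simp add: Int_absorb2)
      also have "\<dots> \<le> integral\<^sup>L riesz_measure (g i)"
        using openin_borel_of[OF U[of "Suc i"]]
        by (intro integral_mono int unit_Cb_real_Cb g integrable_real_indicator)
          (auto simp: g_def U_def indicator_def emeasure_eq_measure)
      finally show "measure riesz_measure (U (Suc i)) \<le> integral\<^sup>L riesz_measure (g i)" .
    qed
    also have "(\<Sum>i<n. integral\<^sup>L riesz_measure (g i)) = integral\<^sup>L riesz_measure (\<lambda>x. \<Sum>i<n. g i x)"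
      by (subst Bochner_Integration.integral_sum) (auto intro: int unit_Cb_real_Cb g)
    also have "\<dots> = integral\<^sup>L riesz_measure (\<lambda>x. n * f x)"
      by (rule Bochner_Integration.integral_cong) (auto simp: sum)
    finally show ?thesis by simp
  qed
  show ?thesis
  proof (rule ccontr)
    assume "\<not> ?thesis"
    then have d: "0 < L f - integral\<^sup>L riesz_measure f" by simp
    obtain n :: nat where "L (\<lambda>x. 1) < n * (L f - integral\<^sup>L riesz_measure f)"
      using reals_Archimedean3[OF d] by blast
    then show False using bound[of n] by (simp add: algebra_simps)
  qed
qed

text \<open>Applying the inequality to \<open>f\<close> and to \<open>1 - f\<close> gives equality because the total masses agree; an
  affine change of scale reaches all bounded functions.\<close>

theorem riesz_representation:
  "finite_radon X riesz_measure" "f \<in> real_Cb \<Longrightarrow> integral\<^sup>L riesz_measure f = L f"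
proof -
  show "finite_radon X riesz_measure" by (rule finite_radon_riesz)
  interpret finite_measure riesz_measure by (rule finite_riesz)
  have int: "integrable riesz_measure g" if "g \<in> real_Cb" for g
    using that finite_riesz by (intro bounded_continuous_integrable[of _ X]) (auto simp: real_Cb_def)
  have total: "measure riesz_measure (topspace X) = L (\<lambda>x. 1)"
    using vol_eq_measure[of "topspace X"] L_one_nonneg by (simp add: vol_topspace)
  have eq: "integral\<^sup>L riesz_measure g = L g" if g: "g \<in> unit_Cb" for g
  proof -
    have "(\<lambda>x. 1 - g x) \<in> unit_Cb"
      using g by (auto simp: unit_Cb_def intro!: continuous_map_diff)
    from L_le_integral[OF this] L_le_integral[OF g] show ?thesis
      using unit_Cb_real_Cb[OF g] int by (simp add: L_minus total)
  qed
  assume f: "f \<in> real_Cb"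
  then obtain c where c: "0 < c" "\<And>x. x \<in> topspace X \<Longrightarrow> \<bar>f x\<bar> \<le> c"
    unfolding real_Cb_def bounded_pos by auto
  define g where "g x = f x / (2 * c) + 1 / 2" for x
  have "continuous_map X euclideanreal g"
    unfolding g_def using f
    by (intro continuous_map_add continuous_map_real_divide) (use c in \<open>auto simp: real_Cb_def\<close>)
  moreover have "0 \<le> g x \<and> g x \<le> 1" if "x \<in> topspace X" for x
    using c(1) c(2)[OF that] by (auto simp: g_def field_simps abs_le_iff)
  ultimately have g: "g \<in> unit_Cb" by (simp add: unit_Cb_def)
  have f_eq: "f = (\<lambda>x. (2 * c) * g x + (- c))"
    using c(1) by (auto simp: g_def fun_eq_iff field_simps)
  have "L f = 2 * c * L g + (- c) * L (\<lambda>x. 1)"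
    using L_plus[OF real_Cb_scale[OF unit_Cb_real_Cb[OF g], of "2 * c"] real_Cb_const[of "- c"]] L_mult[OF unit_Cb_real_Cb[OF g], of "2 * c"] L_const[of "-c"]
    unfolding f_eq by simp
  moreover have "integral\<^sup>L riesz_measure f = 2 * c * L g + (- c) * L (\<lambda>x. 1)"
    unfolding f_eq using int[OF unit_Cb_real_Cb[OF g]] by (simp add: total eq[OF g])
  ultimately show "integral\<^sup>L riesz_measure f = L f" by simp
qed

end

section \<open>Measures determined by integrals of continuous functions\<close>

lemma continuous_map_distD:
  fixes f :: "'a \<Rightarrow> 'b::metric_space"
  assumes "continuous_map X euclidean f" "x \<in> topspace X" "0 < \<epsilon>"
  shows "\<exists>U. openin X U \<and> x \<in> U \<and> (\<forall>y\<in>U. dist (f y) (f x) < \<epsilon>)"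
proof -
  have "openin X {y \<in> topspace X. f y \<in> ball (f x) \<epsilon>}"
    by (rule openin_continuous_map_preimage[OF assms(1)]) simp
  then show ?thesis
    using assms by (intro exI[of _ "{y \<in> topspace X. f y \<in> ball (f x) \<epsilon>}"]) (auto simp: dist_commute)
qed

lemma continuous_map_distI:
  fixes f :: "'a \<Rightarrow> 'b::metric_space"
  assumes "\<And>x \<epsilon>. \<lbrakk>x \<in> topspace X; 0 < \<epsilon>\<rbrakk> \<Longrightarrow>
    \<exists>U. openin X U \<and> x \<in> U \<and> (\<forall>y\<in>U. dist (f y) (f x) < \<epsilon>)"
  shows "continuous_map X euclidean f"
  unfolding continuous_map_def
proof (intro conjI allI impI)
  fix V :: "'b set" assume V: "openin euclidean V"
  show "openin X {x \<in> topspace X. f x \<in> V}"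
  proof (subst openin_subopen, intro ballI)
    fix x assume x: "x \<in> {x \<in> topspace X. f x \<in> V}"
    have "open V" using V by simp
    then obtain \<epsilon> where \<epsilon>: "0 < \<epsilon>" "ball (f x) \<epsilon> \<subseteq> V"
      using x openE by blast
    obtain U where "openin X U" "x \<in> U" "\<forall>y\<in>U. dist (f y) (f x) < \<epsilon>"
      using assms[of x \<epsilon>] x \<epsilon> by auto
    then show "\<exists>T. openin X T \<and> x \<in> T \<and> T \<subseteq> {x \<in> topspace X. f x \<in> V}"
      using \<epsilon>(2) openin_subset[of X U]
      by (intro exI[of _ U]) (auto simp: dist_commute subset_iff)
  qed
qed simp

lemma continuous_map_compose_UNIV:
  assumes "continuous_map X euclidean f" "continuous_on UNIV g"
  shows "continuous_map X euclidean (\<lambda>x. g (f x))"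
  using continuous_map_compose[OF assms(1), of euclidean g] assms(2)
  by (simp add: continuous_map_iff_continuous2 o_def)

text \<open>Between a compact subset and an open set there is a continuous function, so integrals determine the
  measure of open sets, and these determine the rest by outer regularity.\<close>

lemma finite_radon_eqI:
  assumes creg: "completely_regular_space X" and haus: "Hausdorff_space X"
    and M: "finite_radon X M" and N: "finite_radon X N"
    and eq: "\<And>f. \<lbrakk>continuous_map X euclideanreal f; \<And>x. x \<in> topspace X \<Longrightarrow> 0 \<le> f x \<and> f x \<le> 1\<rbrakk> \<Longrightarrow>
      integral\<^sup>L M f = integral\<^sup>L N f"
  shows "M = N"
proof -
  have *: "measure M A \<le> measure N A"
    if M: "finite_radon X M" and N: "finite_radon X N" and A: "A \<in> sets (borel_of X)"
      and eq: "\<And>f. \<lbrakk>continuous_map X euclideanreal f; \<And>x. x \<in> topspace X \<Longrightarrow> 0 \<le> f x \<and> f x \<le> 1\<rbrakk> \<Longrightarrow>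
        integral\<^sup>L M f = integral\<^sup>L N f" for M N A
  proof -
    interpret M: finite_measure M by (rule finite_radon_finite[OF M])
    interpret N: finite_measure N by (rule finite_radon_finite[OF N])
    note sets = finite_radon_sets[OF M] finite_radon_sets[OF N]
    have int: "integrable M f" "integrable N f"
      if "continuous_map X euclideanreal f" "\<And>x. x \<in> topspace X \<Longrightarrow> 0 \<le> f x \<and> f x \<le> 1" for f
      using that M.finite_measure_axioms N.finite_measure_axioms sets
      by (auto intro!: bounded_continuous_integrable[of _ X] boundedI[where B = 1])
    have le: "measure M U \<le> measure N U" if U: "openin X U" for U
    proof (rule field_le_epsilon)
      fix e :: real assume "0 < e"
      then obtain K where K: "compactin X K" "K \<subseteq> U" "measure M U < measure M K + e"
        using finite_radon_inner[OF M U] by blast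
      obtain f :: "'a \<Rightarrow> real" where f: "continuous_map X euclideanreal f"
        "\<And>x. x \<in> topspace X \<Longrightarrow> 0 \<le> f x \<and> f x \<le> 1"
        "\<And>x. x \<in> K \<Longrightarrow> f x = 1" "\<And>x. x \<in> topspace X - U \<Longrightarrow> f x = 0"
        using completely_regular_separation[OF creg K(1) U K(2)] by metis
      have KB: "K \<in> sets (borel_of X)" by (rule closedin_borel_of[OF compactin_imp_closedin[OF haus K(1)]])
      have "measure M K = integral\<^sup>L M (indicator K)"
        using compactin_subset_topspace[OF K(1)] by (simp add: finite_radon_space[OF M] Int_absorb2)
      also have "\<dots> \<le> integral\<^sup>L M f"
        using KB f by (intro integral_mono int f integrable_real_indicator)
          (auto simp: sets indicator_def finite_radon_space[OF M] M.emeasure_eq_measure)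
      also have "\<dots> = integral\<^sup>L N f" by (rule eq[OF f(1,2)])
      also have "\<dots> \<le> integral\<^sup>L N (indicator U)"
        using openin_borel_of[OF U] f by (intro integral_mono int f integrable_real_indicator)
          (auto simp: sets indicator_def finite_radon_space[OF N] N.emeasure_eq_measure)
      also have "\<dots> = measure N U"
        using openin_subset[OF U] by (simp add: finite_radon_space[OF N] Int_absorb2)
      finally show "measure M U \<le> measure N U + e" using K(3) by simp
    qed
    show ?thesis
    proof (rule field_le_epsilon)
      fix e :: real assume "0 < e"
      then obtain U where U: "openin X U" "A \<subseteq> U" "measure N U < measure N A + e"
        using finite_radon_outer[OF N A] by blast
      have "measure M A \<le> measure M U"
        using U by (intro M.finite_measure_mono) (auto simp: sets openin_borel_of)
      with le[OF U(1)] U(3) show "measure M A \<le> measure N A + e" by simp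
    qed
  qed
  interpret M: finite_measure M by (rule finite_radon_finite[OF M])
  interpret N: finite_measure N by (rule finite_radon_finite[OF N])
  show ?thesis
  proof (rule measure_eqI)
    show "sets M = sets N" by (simp add: finite_radon_sets[OF M] finite_radon_sets[OF N])
    fix A assume "A \<in> sets M"
    then have A: "A \<in> sets (borel_of X)" by (simp add: finite_radon_sets[OF M])
    have "measure M A = measure N A"
    proof (rule antisym)
      show "measure M A \<le> measure N A" using eq by (intro *[OF M N A]) blast
      show "measure N A \<le> measure M A" using eq[symmetric] by (intro *[OF N M A]) blast
    qed
    then show "emeasure M A = emeasure N A"
      by (simp add: M.emeasure_eq_measure N.emeasure_eq_measure)
  qed
qed

lemma Cb_add: "f \<in> Cb X \<Longrightarrow> g \<in> Cb X \<Longrightarrow> (\<lambda>x. f x + g x) \<in> Cb X"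
  unfolding Cb_def by (auto intro!: continuous_map_add bounded_plus_comp)

lemma Cb_scale:
  assumes "f \<in> Cb X"
  shows "(\<lambda>x. c * f x) \<in> Cb X"
proof -
  obtain B where "\<And>x. x \<in> topspace X \<Longrightarrow> cmod (f x) \<le> B"
    using assms unfolding Cb_def bounded_iff by auto
  then have "bounded ((\<lambda>x. c * f x) ` topspace X)"
    by (intro boundedI[where B = "cmod c * B"]) (auto simp: norm_mult intro!: mult_left_mono)
  then show ?thesis
    using assms continuous_map_compose_UNIV[of X f "\<lambda>z. c * z"] unfolding Cb_def
    by (auto intro: continuous_intros)
qed

lemma Cb_const: "(\<lambda>x. c) \<in> Cb X"
  unfolding Cb_def by (auto intro!: boundedI[where B = "cmod c"])

lemma Cb_diff: "f \<in> Cb X \<Longrightarrow> g \<in> Cb X \<Longrightarrow> (\<lambda>x. f x - g x) \<in> Cb X"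
  using Cb_add[of f X "\<lambda>x. (-1) * g x"] Cb_scale[of g X "-1"] by simp

lemma Cb_of_real:
  assumes "continuous_map X euclideanreal g" "bounded (g ` topspace X)"
  shows "(\<lambda>x. complex_of_real (g x)) \<in> Cb X"
proof -
  obtain B where "\<And>x. x \<in> topspace X \<Longrightarrow> \<bar>g x\<bar> \<le> B"
    using assms unfolding bounded_iff by auto
  then have "bounded ((\<lambda>x. complex_of_real (g x)) ` topspace X)"
    by (intro boundedI[where B = B]) auto
  then show ?thesis
    using assms continuous_map_compose_UNIV[of X g complex_of_real] unfolding Cb_def
    by (auto intro: continuous_intros)
qed

lemma locally_compact_Hausdorff_imp_completely_regular:
  "locally_compact_space X \<Longrightarrow> Hausdorff_space X \<Longrightarrow> completely_regular_space X"
  by (simp add: completely_regular_eq_regular_space locally_compact_Hausdorff_imp_regular_space)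

lemma Cb_bump:
  assumes "locally_compact_space X" "Hausdorff_space X" "openin X U" "x \<in> U"
  obtains f where "f \<in> Cb X" "\<And>y. y \<in> topspace X \<Longrightarrow> f y \<in> \<real>\<^sub>\<ge>\<^sub>0" "f x = 1"
    "\<And>y. y \<in> topspace X - U \<Longrightarrow> f y = 0"
proof -
  have "compactin X {x}" using openin_subset[OF assms(3)] assms(4) by auto
  then obtain g :: "'a \<Rightarrow> real" where g: "continuous_map X euclideanreal g"
    "\<And>y. y \<in> topspace X \<Longrightarrow> 0 \<le> g y \<and> g y \<le> 1" "g x = 1" "\<And>y. y \<in> topspace X - U \<Longrightarrow> g y = 0"
    using completely_regular_separation[of X "{x}" U] assms locally_compact_Hausdorff_imp_completely_regular
    by (metis empty_subsetI insert_subset singletonI)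
  then have "bounded (g ` topspace X)" by (auto intro!: boundedI[where B = 1])
  then show thesis
    using g by (intro that[of "\<lambda>y. complex_of_real (g y)"] Cb_of_real) auto
qed

lemma Cb_Re_Im:
  assumes "f \<in> Cb X"
  shows "continuous_map X euclideanreal (\<lambda>x. Re (f x))" "bounded ((\<lambda>x. Re (f x)) ` topspace X)"
    "continuous_map X euclideanreal (\<lambda>x. Im (f x))" "bounded ((\<lambda>x. Im (f x)) ` topspace X)"
proof -
  obtain B where B: "\<And>x. x \<in> topspace X \<Longrightarrow> cmod (f x) \<le> B"
    using assms unfolding Cb_def bounded_iff by auto
  show "bounded ((\<lambda>x. Re (f x)) ` topspace X)" "bounded ((\<lambda>x. Im (f x)) ` topspace X)"
    using B order_trans[OF abs_Re_le_cmod] order_trans[OF abs_Im_le_cmod]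
    by (auto intro!: boundedI[where B = B])
  show "continuous_map X euclideanreal (\<lambda>x. Re (f x))" "continuous_map X euclideanreal (\<lambda>x. Im (f x))"
    using assms continuous_map_compose_UNIV[of X f Re] continuous_map_compose_UNIV[of X f Im]
      continuous_on_Re[OF continuous_on_id] continuous_on_Im[OF continuous_on_id]
    unfolding Cb_def by auto
qed

text \<open>For the difference of the two measures, real test functions separate the real and the imaginary part;
  in each of them the positive and the negative variation have equal integrals and hence cancel.\<close>

lemma Mb_eqI:
  assumes creg: "completely_regular_space X" and haus: "Hausdorff_space X"
    and \<mu>: "\<mu> \<in> Mb X" and \<nu>: "\<nu> \<in> Mb X"
    and eq: "\<And>f. f \<in> Cb X \<Longrightarrow> pairing X f \<mu> = pairing X f \<nu>"
  shows "\<mu> = \<nu>"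
proof -
  define \<delta> where "\<delta> A = \<mu> A + (-1) * \<nu> A" for A
  have \<delta>_eq: "\<delta> = (\<lambda>A. \<mu> A + (-1) * \<nu> A)" by (simp add: \<delta>_def fun_eq_iff)
  have \<delta>: "\<delta> \<in> Mb X" unfolding \<delta>_eq using \<mu> \<nu> by (intro Mb_add[OF haus] Mb_scale[OF haus])
  have "pairing X f \<delta> = pairing X f \<mu> + (-1) * pairing X f \<nu>" if "f \<in> Cb X" for f
    unfolding \<delta>_eq using that \<mu> \<nu> pairing_add[OF haus \<mu> Mb_scale[OF haus \<nu>], of f "-1"]
      pairing_scale[OF haus \<nu>, of f "-1"] by simp
  then have zero: "pairing X f \<delta> = 0" if "f \<in> Cb X" for f using that eq by simp
  have vanish: "\<rho> A = 0" if \<rho>: "radon_signed X \<rho>"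
    and z: "\<And>g. continuous_map X euclideanreal g \<Longrightarrow> bounded (g ` topspace X) \<Longrightarrow>
      real_pairing X (\<lambda>x. complex_of_real (g x)) \<rho> = 0" for \<rho> A
  proof -
    let ?p = "pos_variation X \<rho>" and ?n = "pos_variation X (\<lambda>A. - \<rho> A)"
    have "?p = ?n"
    proof (rule finite_radon_eqI[OF creg haus])
      show "finite_radon X ?p" "finite_radon X ?n" using \<rho> unfolding radon_signed_def by auto
      fix f :: "'a \<Rightarrow> real"
      assume f: "continuous_map X euclideanreal f" "\<And>x. x \<in> topspace X \<Longrightarrow> 0 \<le> f x \<and> f x \<le> 1"
      then have "bounded (f ` topspace X)" by (auto intro!: boundedI[where B = 1])
      then have "complex_of_real (integral\<^sup>L ?p f) - complex_of_real (integral\<^sup>L ?n f) = 0"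
        using z[OF f(1)] unfolding real_pairing_def by simp
      then show "integral\<^sup>L ?p f = integral\<^sup>L ?n f"
        by (metis eq_iff_diff_eq_0 of_real_eq_iff)
    qed
    then show "\<rho> A = 0"
    proof (cases "A \<in> sets (borel_of X)")
      case True
      then show ?thesis
        using jordan_decomposition[of X \<rho> A] \<rho> \<open>?p = ?n\<close> unfolding radon_signed_def by simp
    next
      case False
      then show ?thesis using \<rho> unfolding radon_signed_def signed_measure_def by simp
    qed
  qed
  have parts: "real_pairing X (\<lambda>x. complex_of_real (g x)) (\<lambda>A. Re (\<delta> A)) = 0 \<and>
      real_pairing X (\<lambda>x. complex_of_real (g x)) (\<lambda>A. Im (\<delta> A)) = 0"
    if g: "continuous_map X euclideanreal g" "bounded (g ` topspace X)" for g
  proof -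
    have real: "real_pairing X (\<lambda>x. complex_of_real (g x)) \<rho> =
        complex_of_real (integral\<^sup>L (pos_variation X \<rho>) g - integral\<^sup>L (pos_variation X (\<lambda>A. - \<rho> A)) g)" for \<rho>
      unfolding real_pairing_def by simp
    show ?thesis
      using zero[OF Cb_of_real[OF g]] unfolding pairing_real_pairing real
      by (simp add: complex_eq_iff)
  qed
  have "Re (\<delta> A) = 0" "Im (\<delta> A) = 0" for A
    using \<delta> parts vanish unfolding Mb_iff by blast+
  then have "\<delta> A = 0" for A by (simp add: complex_eq_iff)
  then show ?thesis by (auto simp: \<delta>_def fun_eq_iff)
qed

lemma pairing_cong:
  assumes "\<And>x. x \<in> topspace X \<Longrightarrow> f x = g x"
  shows "pairing X f \<mu> = pairing X g \<mu>"
  unfolding pairing_def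
  by (intro arg_cong2[where f = "(+)"] arg_cong2[where f = "(-)"] arg_cong2[where f = "(*)"]
    Bochner_Integration.integral_cong refl) (simp_all add: assms)

lemma Cb_cong: "f \<in> Cb X \<Longrightarrow> (\<And>x. x \<in> topspace X \<Longrightarrow> f x = g x) \<Longrightarrow> g \<in> Cb X"
  unfolding Cb_def by (auto intro: continuous_map_eq cong: image_cong)

section \<open>Integrating out one variable\<close>

lemma continuous_map_slice_left:
  "continuous_map (prod_topology X Y) Z F \<Longrightarrow> t \<in> topspace Y \<Longrightarrow> continuous_map X Z (\<lambda>s. F (s, t))"
  using continuous_map_compose[of X "prod_topology X Y" "\<lambda>s. (s, t)" Z F]
  by (simp add: o_def continuous_map_pairedI)

lemma continuous_map_slice_right:
  "continuous_map (prod_topology X Y) Z F \<Longrightarrow> s \<in> topspace X \<Longrightarrow> continuous_map Y Z (\<lambda>t. F (s, t))"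
  using continuous_map_compose[of Y "prod_topology X Y" "\<lambda>t. (s, t)" Z F]
  by (simp add: o_def continuous_map_pairedI)

lemma Cb_slice_left: "F \<in> Cb (prod_topology X Y) \<Longrightarrow> t \<in> topspace Y \<Longrightarrow> (\<lambda>s. F (s, t)) \<in> Cb X"
  unfolding Cb_def by (auto intro: continuous_map_slice_left elim!: bounded_subset)

lemma Cb_slice_right: "F \<in> Cb (prod_topology X Y) \<Longrightarrow> s \<in> topspace X \<Longrightarrow> (\<lambda>t. F (s, t)) \<in> Cb Y"
  unfolding Cb_def by (auto intro: continuous_map_slice_right elim!: bounded_subset)

text \<open>A continuous function of two variables depends on one of them uniformly over compact sets of
  the other.\<close>

lemma uniform_over_compact_right:
  fixes F :: "'a \<times> 'b \<Rightarrow> 'c::metric_space"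
  assumes F: "continuous_map (prod_topology X Y) euclidean F" and K: "compactin Y K"
    and s: "s \<in> topspace X" and e: "0 < \<epsilon>"
  shows "\<exists>U. openin X U \<and> s \<in> U \<and> (\<forall>s'\<in>U. \<forall>t\<in>K. dist (F (s', t)) (F (s, t)) < \<epsilon>)"
proof -
  define W where "W = {p \<in> topspace (prod_topology X Y). dist (F p) (F (s, snd p)) \<in> {..<\<epsilon>}}"
  have "continuous_map (prod_topology X Y) euclidean (\<lambda>p. F (s, snd p))"
    using continuous_map_compose[OF continuous_map_snd continuous_map_slice_right[OF F s]]
    by (simp add: o_def)
  then have "continuous_map (prod_topology X Y) (prod_topology euclidean euclidean) (\<lambda>p. (F p, F (s, snd p)))"
    using F by (intro continuous_map_pairedI)
  then have "continuous_map (prod_topology X Y) euclidean (\<lambda>p. (F p, F (s, snd p)))"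
    by (simp add: euclidean_product_topology)
  then have "continuous_map (prod_topology X Y) euclideanreal (\<lambda>p. dist (F p) (F (s, snd p)))"
    using continuous_map_compose_UNIV[of _ _ "\<lambda>p. dist (fst p) (snd p)"]
    by (fastforce intro: continuous_intros)
  then have W: "openin (prod_topology X Y) W"
    unfolding W_def by (rule openin_continuous_map_preimage) simp
  have "{s} \<times> K \<subseteq> W"
    using s e compactin_subset_topspace[OF K] by (auto simp: W_def)
  then obtain U V where UV: "openin X U" "openin Y V" "s \<in> U" "K \<subseteq> V" "U \<times> V \<subseteq> W"
    using tube_lemma_right[OF W K s] by blast
  show ?thesis
  proof (intro exI[of _ U] conjI ballI UV)
    fix s' t assume "s' \<in> U" "t \<in> K"
    then have "(s', t) \<in> W" using UV by auto
    then show "dist (F (s', t)) (F (s, t)) < \<epsilon>" by (simp add: W_def)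
  qed
qed

lemma uniform_over_compact_left:
  fixes F :: "'a \<times> 'b \<Rightarrow> 'c::metric_space"
  assumes F: "continuous_map (prod_topology X Y) euclidean F" and K: "compactin X K"
    and t: "t \<in> topspace Y" and e: "0 < \<epsilon>"
  shows "\<exists>U. openin Y U \<and> t \<in> U \<and> (\<forall>t'\<in>U. \<forall>s\<in>K. dist (F (s, t')) (F (s, t)) < \<epsilon>)"
proof -
  have "continuous_map (prod_topology Y X) euclidean (F \<circ> (\<lambda>p. (snd p, fst p)))"
    by (rule continuous_map_compose[OF _ F]) (intro continuous_map_pairedI continuous_map_snd continuous_map_fst)
  from uniform_over_compact_right[OF this K t e] show ?thesis by (simp add: o_def)
qed

text \<open>The form of all estimates below: a small bound on a compact set of almost full measure, and a crude
  bound elsewhere.\<close>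

lemma integral_bound_off_compact:
  fixes f :: "'a \<Rightarrow> 'b::{banach, second_countable_topology}"
  assumes M: "finite_radon X M" and K: "K \<in> sets (borel_of X)" and f: "f \<in> borel_measurable M"
    and bound: "\<And>x. x \<in> topspace X \<Longrightarrow> norm (f x) \<le> a + b * indicator (topspace X - K) x"
  shows "norm (integral\<^sup>L M f) \<le> a * measure M (topspace X) + b * measure M (topspace X - K)"
proof -
  interpret finite_measure M by (rule finite_radon_finite[OF M])
  note [simp] = finite_radon_space[OF M] finite_radon_sets[OF M]
  have B: "topspace X - K \<in> sets M" using K by auto
  have int: "integrable M (\<lambda>x. a + b * indicator (topspace X - K) x)"
    using B by (intro Bochner_Integration.integrable_add integrable_mult_right integrable_real_indicator)
      (auto simp: emeasure_eq_measure)
  have "integrable M f"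
    using bound by (intro Bochner_Integration.integrable_bound[OF int f] AE_I2)
      (auto intro: order_trans[OF _ abs_ge_self])
  then have "norm (integral\<^sup>L M f) \<le> integral\<^sup>L M (\<lambda>x. a + b * indicator (topspace X - K) x)"
    using bound by (intro order_trans[OF integral_norm_bound integral_mono] int integrable_norm) auto
  also have "\<dots> = a * measure M (topspace X) + b * measure M (topspace X - K)"
    using B by (subst Bochner_Integration.integral_add)
      (auto simp: emeasure_eq_measure Int_absorb2 intro!: integrable_mult_right integrable_real_indicator)
  finally show ?thesis .
qed

lemma finite_radon_tight:
  assumes H: "Hausdorff_space X" and M: "finite_radon X M" and e: "0 < \<epsilon>"
  obtains K where "compactin X K" "K \<in> sets (borel_of X)" "measure M (topspace X - K) < \<epsilon>"
proof -
  interpret finite_measure M by (rule finite_radon_finite[OF M])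
  obtain K where K: "compactin X K" "measure M (topspace X) < measure M K + \<epsilon>"
    using finite_radon_inner[OF M _ e, of "topspace X"] by auto
  have KB: "K \<in> sets (borel_of X)" by (rule closedin_borel_of[OF compactin_imp_closedin[OF H K(1)]])
  have "measure M (topspace X - K) = measure M (topspace X) - measure M K"
    using KB compactin_subset_topspace[OF K(1)]
    by (intro finite_measure_Diff) (auto simp: finite_radon_sets[OF M])
  then show thesis using that[OF K(1) KB] K(2) by simp
qed

text \<open>The integrand varies little with \<open>t\<close>, uniformly over a compact set carrying almost all the mass.\<close>

lemma partial_integral:
  fixes F :: "'a \<times> 'b \<Rightarrow> 'c::{banach, second_countable_topology}"
  assumes H: "Hausdorff_space X" and M: "finite_radon X M"
    and F: "continuous_map (prod_topology X Y) euclidean F" "bounded (F ` topspace (prod_topology X Y))"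
  shows "continuous_map Y euclidean (\<lambda>t. integral\<^sup>L M (\<lambda>s. F (s, t)))"
    and "bounded ((\<lambda>t. integral\<^sup>L M (\<lambda>s. F (s, t))) ` topspace Y)"
proof -
  interpret finite_measure M by (rule finite_radon_finite[OF M])
  obtain c where c: "0 < c" "\<And>s t. s \<in> topspace X \<Longrightarrow> t \<in> topspace Y \<Longrightarrow> norm (F (s, t)) \<le> c"
    using F(2) unfolding bounded_pos by auto
  have int: "integrable M (\<lambda>s. F (s, t))" if "t \<in> topspace Y" for t
    using c that by (intro bounded_continuous_integrable[of M X] continuous_map_slice_left[OF F(1)]
        finite_measure_axioms finite_radon_sets[OF M] boundedI[where B = c]) auto
  show "bounded ((\<lambda>t. integral\<^sup>L M (\<lambda>s. F (s, t))) ` topspace Y)"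
  proof (rule boundedI)
    fix y assume "y \<in> (\<lambda>t. integral\<^sup>L M (\<lambda>s. F (s, t))) ` topspace Y"
    then obtain t where t: "t \<in> topspace Y" "y = integral\<^sup>L M (\<lambda>s. F (s, t))" by auto
    show "norm y \<le> c * measure M (topspace X) + 0 * measure M (topspace X - {})"
      unfolding t(2) using c t int[OF t(1)]
      by (intro integral_bound_off_compact[OF M]) auto
  qed
  show "continuous_map Y euclidean (\<lambda>t. integral\<^sup>L M (\<lambda>s. F (s, t)))"
  proof (rule continuous_map_distI)
    fix t \<epsilon> assume t: "t \<in> topspace Y" and e: "(0::real) < \<epsilon>"
    let ?m = "measure M (topspace X)"
    have d: "0 < \<epsilon> / (?m + 2 * c + 1)" (is "0 < ?d")
      using e c(1) by (intro divide_pos_pos) (auto intro: add_nonneg_pos)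
    obtain K where K: "compactin X K" "K \<in> sets (borel_of X)" "measure M (topspace X - K) < ?d"
      using finite_radon_tight[OF H M d] by blast
    obtain U where U: "openin Y U" "t \<in> U" "\<And>t' s. \<lbrakk>t' \<in> U; s \<in> K\<rbrakk> \<Longrightarrow> dist (F (s, t')) (F (s, t)) < ?d"
      using uniform_over_compact_left[OF F(1) K(1) t d] by blast
    show "\<exists>U. openin Y U \<and> t \<in> U \<and>
        (\<forall>y\<in>U. dist (integral\<^sup>L M (\<lambda>s. F (s, y))) (integral\<^sup>L M (\<lambda>s. F (s, t))) < \<epsilon>)"
    proof (intro exI[of _ U] conjI ballI U)
      fix y assume y: "y \<in> U"
      then have yt: "y \<in> topspace Y" using openin_subset[OF U(1)] by auto
      have "dist (integral\<^sup>L M (\<lambda>s. F (s, y))) (integral\<^sup>L M (\<lambda>s. F (s, t)))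
          = norm (integral\<^sup>L M (\<lambda>s. F (s, y) - F (s, t)))"
        using int[OF yt] int[OF t] by (simp add: dist_norm)
      also have "\<dots> \<le> ?d * ?m + (2 * c) * measure M (topspace X - K)"
      proof (rule integral_bound_off_compact[OF M K(2)])
        show "(\<lambda>s. F (s, y) - F (s, t)) \<in> borel_measurable M"
          using int[OF yt] int[OF t] by auto
        fix s assume s: "s \<in> topspace X"
        show "norm (F (s, y) - F (s, t)) \<le> ?d + 2 * c * indicat_real (topspace X - K) s"
        proof (cases "s \<in> K")
          case True
          then show ?thesis using U(3)[OF y True] by (simp add: dist_norm)
        next
          case False
          have "norm (F (s, y) - F (s, t)) \<le> norm (F (s, y)) + norm (F (s, t))"
            by (rule norm_triangle_ineq4)
          then show ?thesis using False s d c(2)[OF s yt] c(2)[OF s t] by simp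
        qed
      qed
      also have "\<dots> \<le> ?d * ?m + (2 * c) * ?d"
        using K(3) c(1) by (intro add_left_mono mult_left_mono) auto
      also have "\<dots> < ?d * (?m + 2 * c + 1)"
      proof -
        have "x * m + 2 * c * x < x * (m + 2 * c + 1)" if "0 < x" for x m :: real
          using that by (simp add: algebra_simps)
        from this[OF d] show ?thesis .
      qed
      also have "\<dots> = \<epsilon>"
        using c(1) measure_nonneg[of M "topspace X"] by (simp del: measure_nonneg)
      finally show "dist (integral\<^sup>L M (\<lambda>s. F (s, y))) (integral\<^sup>L M (\<lambda>s. F (s, t))) < \<epsilon>" .
    qed
  qed
qed

lemma partial_pairing:
  assumes H: "Hausdorff_space X" and \<mu>: "\<mu> \<in> Mb X" and F: "F \<in> Cb (prod_topology X Y)"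
  shows "(\<lambda>t. pairing X (\<lambda>s. F (s, t)) \<mu>) \<in> Cb Y"
  using \<mu>
proof (induction rule: Mb_induct[OF H, consumes 1, case_names pos add scale])
  case (pos M)
  have "(\<lambda>t. integral\<^sup>L M (\<lambda>s. F (s, t))) \<in> Cb Y"
    using partial_integral[OF H pos, of Y F] F unfolding Cb_def by simp
  then show ?case
    by (rule Cb_cong) (simp add: pairing_pos[OF H pos] Cb_slice_left[OF F])
next
  case (add \<mu> \<nu>)
  show ?case
    by (rule Cb_cong[OF Cb_add[OF add(3,4)]]) (simp add: pairing_add[OF H add(1,2)] Cb_slice_left[OF F])
next
  case (scale c \<mu>)
  show ?case
    by (rule Cb_cong[OF Cb_scale[OF scale(2), of c]]) (simp add: pairing_scale[OF H scale(1)] Cb_slice_left[OF F])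
qed

lemma pairing_add_fun:
  assumes H: "Hausdorff_space X" and \<mu>: "\<mu> \<in> Mb X" and f: "f \<in> Cb X" and g: "g \<in> Cb X"
  shows "pairing X (\<lambda>x. f x + g x) \<mu> = pairing X f \<mu> + pairing X g \<mu>"
  using \<mu>
proof (induction rule: Mb_induct[OF H, consumes 1, case_names pos add scale])
  case (pos M)
  then show ?case
    using f g by (simp add: pairing_pos[OF H pos] Cb_add Cb_integrable)
next
  case (add \<mu> \<nu>)
  then show ?case using f g by (simp add: pairing_add[OF H add(1,2)] Cb_add)
next
  case (scale c \<mu>)
  then show ?case using f g by (simp add: pairing_scale[OF H scale(1)] Cb_add algebra_simps)
qed

lemma pairing_scale_fun:
  assumes H: "Hausdorff_space X" and \<mu>: "\<mu> \<in> Mb X" and f: "f \<in> Cb X"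
  shows "pairing X (\<lambda>x. c * f x) \<mu> = c * pairing X f \<mu>"
  using \<mu>
proof (induction rule: Mb_induct[OF H, consumes 1, case_names pos add scale])
  case (pos M)
  then show ?case
    using f by (simp add: pairing_pos[OF H pos] Cb_scale Cb_integrable)
next
  case (add \<mu> \<nu>)
  then show ?case using f by (simp add: pairing_add[OF H add(1,2)] Cb_scale algebra_simps)
next
  case (scale d \<mu>)
  then show ?case using f by (simp add: pairing_scale[OF H scale(1)] Cb_scale algebra_simps)
qed

lemma dirac_eq_pos_cmeas:
  assumes "s \<in> topspace X"
  shows "dirac X s = pos_cmeas (point_mass X s)"
proof
  fix A show "dirac X s A = pos_cmeas (point_mass X s) A"
  proof (cases "A \<in> sets (borel_of X)")
    case True
    then show ?thesis using emeasure_point_mass[OF assms True]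
      by (simp add: dirac_def pos_cmeas_def measure_def indicator_def)
  next
    case False
    then show ?thesis by (simp add: dirac_def pos_cmeas_def measure_notin_sets)
  qed
qed

lemma dirac_Mb: "Hausdorff_space X \<Longrightarrow> s \<in> topspace X \<Longrightarrow> dirac X s \<in> Mb X"
  by (simp add: dirac_eq_pos_cmeas Mb_pos finite_radon_point_mass)

lemma pairing_dirac:
  "Hausdorff_space X \<Longrightarrow> s \<in> topspace X \<Longrightarrow> f \<in> Cb X \<Longrightarrow> pairing X f (dirac X s) = f s"
  by (simp add: dirac_eq_pos_cmeas pairing_pos finite_radon_point_mass integral_point_mass Cb_def)

lemma C0_subset_Cb: "f \<in> C0 X \<Longrightarrow> f \<in> Cb X"
proof -
  assume f: "f \<in> C0 X"
  then have fc: "continuous_map X euclidean f" and K: "compactin X {x \<in> topspace X. 1 \<le> cmod (f x)}"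
    unfolding C0_def by auto
  have "compact (f ` {x \<in> topspace X. 1 \<le> cmod (f x)})"
    using image_compactin[OF K fc] by simp
  then have "bounded (f ` {x \<in> topspace X. 1 \<le> cmod (f x)})" by (rule compact_imp_bounded)
  then obtain B where B: "\<And>x. x \<in> topspace X \<Longrightarrow> 1 \<le> cmod (f x) \<Longrightarrow> cmod (f x) \<le> B"
    unfolding bounded_iff by auto
  have "bounded (f ` topspace X)"
  proof (rule boundedI)
    fix y assume "y \<in> f ` topspace X"
    then show "cmod y \<le> max 1 B" using B by (cases "1 \<le> cmod y") (auto simp: le_max_iff_disj)
  qed
  with fc show "f \<in> Cb X" by (simp add: Cb_def)
qed

lemma nonneg_Reals_iff: "z \<in> \<real>\<^sub>\<ge>\<^sub>0 \<longleftrightarrow> (\<exists>r\<ge>0. z = complex_of_real r)"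
  by (auto simp: nonneg_Reals_def)

text \<open>Disjoint Borel pieces of a compact set, each inside one of the given neighbourhoods; a function that is
  nearly constant on the neighbourhoods then has nearly a finite sum as integral.\<close>

lemma finite_borel_partition:
  assumes H: "Hausdorff_space X" and K: "compactin X K"
    and U: "\<And>x. x \<in> K \<Longrightarrow> openin X (U x)" "\<And>x. x \<in> K \<Longrightarrow> x \<in> U x"
  obtains n :: nat and y :: "nat \<Rightarrow> 'a" and A :: "nat \<Rightarrow> 'a set"
  where "\<And>i. i < n \<Longrightarrow> y i \<in> K" "\<And>i. i < n \<Longrightarrow> A i \<subseteq> U (y i)"
    "\<And>i. A i \<in> sets (borel_of X)" "disjoint_family A" "(\<Union>i<n. A i) = K"
proof -
  obtain \<F> where \<F>: "finite \<F>" "\<F> \<subseteq> U ` K" "K \<subseteq> \<Union> \<F>"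
  proof -
    have "\<exists>\<F>. finite \<F> \<and> \<F> \<subseteq> U ` K \<and> K \<subseteq> \<Union> \<F>"
      by (rule compactinD[OF K]) (use U in auto)
    then show thesis using that by blast
  qed
  obtain D where D: "D \<subseteq> K" "finite D" "\<F> = U ` D"
    using finite_subset_image[OF \<F>(1,2)] by auto
  obtain n y where y: "D = y ` {..<n::nat}"
    using finite_imp_nat_seg_image_inj_on[OF D(2)] by (metis lessThan_def)
  define V where "V i = (if i < n then U (y i) \<inter> K else {})" for i
  define A where "A = disjointed V"
  have V: "V i \<in> sets (borel_of X)" for i
  proof (cases "i < n")
    case True
    then have "y i \<in> K" using y D(1) by auto
    then show ?thesis
      using openin_borel_of[OF U(1)] closedin_borel_of[OF compactin_imp_closedin[OF H K]]
      by (simp add: V_def sets.Int)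
  qed (simp add: V_def)
  show thesis
  proof (rule that)
    show "y i \<in> K" if "i < n" for i using y D(1) that by auto
    show "A i \<subseteq> U (y i)" if "i < n" for i
      using disjointed_subset[of V i] that unfolding A_def V_def by auto
    show "A i \<in> sets (borel_of X)" for i
      using sets.range_disjointed_sets[of V "borel_of X"] V unfolding A_def by auto
    show "disjoint_family A" unfolding A_def by (rule disjoint_family_disjointed)
    show "(\<Union>i<n. A i) = K"
    proof -
      have "A i = {}" if "\<not> i < n" for i
        using disjointed_subset[of V i] that unfolding A_def V_def by auto
      then have "(\<Union>i<n. A i) = (\<Union>i. A i)" by blast
      also have "\<dots> = (\<Union>i. V i)" unfolding A_def by (rule UN_disjointed_eq)
      also have "\<dots> = K" using \<F>(3) D(3) y unfolding V_def by (auto split: if_splits)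
      finally show ?thesis .
    qed
  qed
qed

section \<open>Positive unital functionals\<close>

lemma Cb_norm:
  assumes "f \<in> Cb X"
  shows "continuous_map X euclideanreal (\<lambda>x. cmod (f x))" "bounded ((\<lambda>x. cmod (f x)) ` topspace X)"
  using assms unfolding Cb_def bounded_iff by (auto intro: continuous_map_norm)

text \<open>Both the comultiplication at a point of \<open>Q \<times> Q\<close> and the conditional expectation at a point of the
  group are of this kind.\<close>

locale state =
  fixes X :: "'a topology" and \<phi> :: "('a \<Rightarrow> complex) \<Rightarrow> complex"
  assumes add: "f \<in> Cb X \<Longrightarrow> g \<in> Cb X \<Longrightarrow> \<phi> (\<lambda>x. f x + g x) = \<phi> f + \<phi> g"
    and scale: "f \<in> Cb X \<Longrightarrow> \<phi> (\<lambda>x. c * f x) = c * \<phi> f"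
    and pos: "f \<in> Cb X \<Longrightarrow> (\<And>x. x \<in> topspace X \<Longrightarrow> f x \<in> \<real>\<^sub>\<ge>\<^sub>0) \<Longrightarrow> \<phi> f \<in> \<real>\<^sub>\<ge>\<^sub>0"
    and one: "\<phi> (\<lambda>x. 1) = 1"
begin

lemma diff: "f \<in> Cb X \<Longrightarrow> g \<in> Cb X \<Longrightarrow> \<phi> (\<lambda>x. f x - g x) = \<phi> f - \<phi> g"
  using add[of f "\<lambda>x. (-1) * g x"] Cb_scale[of g X "-1"] scale[of g "-1"] by simp

lemma const: "\<phi> (\<lambda>x. c) = c"
  using scale[OF Cb_const[of 1], of c] one by simp

lemma of_real:
  assumes g: "continuous_map X euclideanreal g" "bounded (g ` topspace X)"
  shows "Im (\<phi> (\<lambda>x. complex_of_real (g x))) = 0"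
proof -
  obtain c where c: "\<And>x. x \<in> topspace X \<Longrightarrow> \<bar>g x\<bar> \<le> c"
    using g(2) unfolding bounded_iff by auto
  note G = Cb_of_real[OF g]
  have "0 \<le> g x + c" if "x \<in> topspace X" for x using c[OF that] by simp
  then have "complex_of_real (g x) + complex_of_real c \<in> \<real>\<^sub>\<ge>\<^sub>0" if "x \<in> topspace X" for x
    using that by (simp flip: of_real_add)
  then have "\<phi> (\<lambda>x. complex_of_real (g x) + complex_of_real c) \<in> \<real>\<^sub>\<ge>\<^sub>0"
    by (intro pos Cb_add G Cb_const)
  then show ?thesis
    using add[OF G Cb_const] const by (auto simp: nonneg_Reals_iff complex_eq_iff)
qed

lemma mono:
  assumes f: "continuous_map X euclideanreal f" "bounded (f ` topspace X)"
    and g: "continuous_map X euclideanreal g" "bounded (g ` topspace X)"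
    and le: "\<And>x. x \<in> topspace X \<Longrightarrow> f x \<le> g x"
  shows "Re (\<phi> (\<lambda>x. complex_of_real (f x))) \<le> Re (\<phi> (\<lambda>x. complex_of_real (g x)))"
proof -
  have "\<phi> (\<lambda>x. complex_of_real (g x) - complex_of_real (f x)) \<in> \<real>\<^sub>\<ge>\<^sub>0"
    by (intro pos Cb_diff Cb_of_real f g) (simp add: le flip: of_real_diff)
  then show ?thesis
    using diff[OF Cb_of_real[OF g] Cb_of_real[OF f]] by (auto simp: nonneg_Reals_iff complex_eq_iff)
qed

lemma split:
  assumes f: "f \<in> Cb X"
  shows "Re (\<phi> f) = Re (\<phi> (\<lambda>x. complex_of_real (Re (f x))))"
    "Im (\<phi> f) = Re (\<phi> (\<lambda>x. complex_of_real (Im (f x))))"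
proof -
  note R = Cb_of_real[OF Cb_Re_Im(1,2)[OF f]] and I = Cb_of_real[OF Cb_Re_Im(3,4)[OF f]]
  have "f = (\<lambda>x. complex_of_real (Re (f x)) + \<i> * complex_of_real (Im (f x)))"
    by (simp add: fun_eq_iff complex_eq_iff)
  then have "\<phi> f = \<phi> (\<lambda>x. complex_of_real (Re (f x))) + \<i> * \<phi> (\<lambda>x. complex_of_real (Im (f x)))"
    using add[OF R Cb_scale[OF I, of \<i>]] scale[OF I, of \<i>] by simp
  then show "Re (\<phi> f) = Re (\<phi> (\<lambda>x. complex_of_real (Re (f x))))"
    "Im (\<phi> f) = Re (\<phi> (\<lambda>x. complex_of_real (Im (f x))))"
    using of_real[OF Cb_Re_Im(1,2)[OF f]] of_real[OF Cb_Re_Im(3,4)[OF f]] by simp_all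
qed

text \<open>Rotating the value onto the positive axis reduces the bound to the real case.\<close>

lemma norm_le:
  assumes f: "f \<in> Cb X"
  shows "cmod (\<phi> f) \<le> Re (\<phi> (\<lambda>x. complex_of_real (cmod (f x))))"
proof -
  obtain u where u: "cmod u = 1" "u * \<phi> f = complex_of_real (cmod (\<phi> f))"
  proof (cases "\<phi> f = 0")
    case True
    then show thesis by (intro that[of 1]) auto
  next
    case False
    then show thesis
      by (intro that[of "cnj (\<phi> f) / cmod (\<phi> f)"])
        (auto simp: norm_divide complex_norm_square[symmetric] mult.commute power2_eq_square)
  qed
  have uf: "(\<lambda>x. u * f x) \<in> Cb X" by (rule Cb_scale[OF f])
  have "cmod (\<phi> f) = Re (\<phi> (\<lambda>x. u * f x))" using u(2) scale[OF f, of u] by simp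
  also have "\<dots> = Re (\<phi> (\<lambda>x. complex_of_real (Re (u * f x))))" by (rule split(1)[OF uf])
  also have "\<dots> \<le> Re (\<phi> (\<lambda>x. complex_of_real (cmod (f x))))"
  proof (rule mono[OF Cb_Re_Im(1,2)[OF uf] Cb_norm[OF f]])
    fix x show "Re (u * f x) \<le> cmod (f x)"
      using complex_Re_le_cmod[of "u * f x"] u(1) by (simp add: norm_mult)
  qed
  finally show ?thesis .
qed

end

section \<open>Hypergroups from comultiplications\<close>

text \<open>What the comultiplication on \<open>Q\<close> is going to satisfy. The set \<open>S s t\<close> plays the role of the support of
  \<open>\<epsilon>\<^sub>s * \<epsilon>\<^sub>t\<close>: a nonnegative function has value \<open>0\<close> at \<open>(s, t)\<close> exactly if it vanishes there. Its
  compactness, boundedness over compact sets and upper semicontinuity yield tightness and the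
  Michael continuity of supports.\<close>

locale comultiplication =
  fixes X :: "'a topology"
    and F :: "('a \<Rightarrow> complex) \<Rightarrow> 'a \<times> 'a \<Rightarrow> complex"
    and S :: "'a \<Rightarrow> 'a \<Rightarrow> 'a set"
    and e :: 'a
    and invol :: "'a \<Rightarrow> 'a"
  assumes lc: "locally_compact_space X" and haus: "Hausdorff_space X"
    and F_Cb: "f \<in> Cb X \<Longrightarrow> F f \<in> Cb (prod_topology X X)"
    and F_add: "\<lbrakk>f \<in> Cb X; g \<in> Cb X; s \<in> topspace X; t \<in> topspace X\<rbrakk> \<Longrightarrow>
      F (\<lambda>x. f x + g x) (s, t) = F f (s, t) + F g (s, t)"
    and F_scale: "\<lbrakk>f \<in> Cb X; s \<in> topspace X; t \<in> topspace X\<rbrakk> \<Longrightarrow>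
      F (\<lambda>x. c * f x) (s, t) = c * F f (s, t)"
    and F_one: "\<lbrakk>s \<in> topspace X; t \<in> topspace X\<rbrakk> \<Longrightarrow> F (\<lambda>x. 1) (s, t) = 1"
    and F_pos: "\<lbrakk>f \<in> Cb X; \<And>x. x \<in> topspace X \<Longrightarrow> f x \<in> \<real>\<^sub>\<ge>\<^sub>0; s \<in> topspace X; t \<in> topspace X\<rbrakk> \<Longrightarrow>
      F f (s, t) \<in> \<real>\<^sub>\<ge>\<^sub>0"
    and F_zero_iff: "\<lbrakk>f \<in> Cb X; \<And>x. x \<in> topspace X \<Longrightarrow> f x \<in> \<real>\<^sub>\<ge>\<^sub>0; s \<in> topspace X; t \<in> topspace X\<rbrakk> \<Longrightarrow>
      F f (s, t) = 0 \<longleftrightarrow> (\<forall>x\<in>S s t. f x = 0)"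
    and S_compact: "\<lbrakk>s \<in> topspace X; t \<in> topspace X\<rbrakk> \<Longrightarrow> compactin X (S s t)"
    and S_bounded: "\<lbrakk>compactin X K; compactin X L\<rbrakk> \<Longrightarrow>
      \<exists>C. compactin X C \<and> (\<forall>s\<in>K. \<forall>t\<in>L. S s t \<subseteq> C)"
    and S_upper: "openin X W \<Longrightarrow>
      openin (prod_topology X X) {p \<in> topspace (prod_topology X X). S (fst p) (snd p) \<subseteq> W}"
    and coassoc: "\<lbrakk>f \<in> Cb X; s \<in> topspace X; t \<in> topspace X; u \<in> topspace X\<rbrakk> \<Longrightarrow>
      F (\<lambda>x. F f (x, u)) (s, t) = F (\<lambda>x. F f (s, x)) (t, u)"
    and e_topspace: "e \<in> topspace X"
    and F_unit: "\<lbrakk>f \<in> Cb X; s \<in> topspace X\<rbrakk> \<Longrightarrow> F f (e, s) = f s"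
      "\<lbrakk>f \<in> Cb X; s \<in> topspace X\<rbrakk> \<Longrightarrow> F f (s, e) = f s"
    and invol_homeo: "homeomorphic_map X X invol"
    and invol_invol: "s \<in> topspace X \<Longrightarrow> invol (invol s) = s"
    and F_invol: "\<lbrakk>f \<in> Cb X; s \<in> topspace X; t \<in> topspace X\<rbrakk> \<Longrightarrow>
      F (f \<circ> invol) (s, t) = F f (invol t, invol s)"
    and e_in_S: "\<lbrakk>s \<in> topspace X; t \<in> topspace X\<rbrakk> \<Longrightarrow> e \<in> S s t \<longleftrightarrow> s = invol t"
begin

lemma creg: "completely_regular_space X"
  by (rule locally_compact_Hausdorff_imp_completely_regular[OF lc haus])

lemma S_subset: "s \<in> topspace X \<Longrightarrow> t \<in> topspace X \<Longrightarrow> S s t \<subseteq> topspace X"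
  using S_compact compactin_subset_topspace by blast

lemma F_state: "s \<in> topspace X \<Longrightarrow> t \<in> topspace X \<Longrightarrow> state X (\<lambda>f. F f (s, t))"
  by unfold_locales (simp_all add: F_add F_scale F_one F_pos)

lemmas F_const = state.const[OF F_state]

lemma F_diff: "\<lbrakk>f \<in> Cb X; g \<in> Cb X; s \<in> topspace X; t \<in> topspace X\<rbrakk> \<Longrightarrow>
    F (\<lambda>x. f x - g x) (s, t) = F f (s, t) - F g (s, t)"
  by (rule state.diff[OF F_state])

lemma F_split:
  assumes "f \<in> Cb X" "s \<in> topspace X" "t \<in> topspace X"
  shows "Re (F f (s, t)) = Re (F (\<lambda>x. complex_of_real (Re (f x))) (s, t))"
    "Im (F f (s, t)) = Re (F (\<lambda>x. complex_of_real (Im (f x))) (s, t))"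
  using state.split[OF F_state] assms by blast+

text \<open>The excess of \<open>g\<close> over \<open>c\<close> vanishes on the support, so it does not contribute.\<close>

lemma F_le_on_S:
  assumes g: "continuous_map X euclideanreal g" "bounded (g ` topspace X)"
    and s: "s \<in> topspace X" and t: "t \<in> topspace X" and le: "\<And>x. x \<in> S s t \<Longrightarrow> g x \<le> c"
  shows "Re (F (\<lambda>x. complex_of_real (g x)) (s, t)) \<le> c"
proof -
  interpret st: state X "\<lambda>f. F f (s, t)" by (rule F_state[OF s t])
  define h where "h x = max 0 (g x - c)" for x
  have hc: "continuous_map X euclideanreal h"
    unfolding h_def using g by (intro continuous_map_real_max continuous_map_diff) auto
  obtain B where B: "\<And>x. x \<in> topspace X \<Longrightarrow> \<bar>g x\<bar> \<le> B"
    using g(2) unfolding bounded_iff by auto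
  have hb: "bounded (h ` topspace X)"
  proof (rule boundedI)
    fix y assume "y \<in> h ` topspace X"
    then obtain x where "x \<in> topspace X" "y = h x" by auto
    then show "norm y \<le> B + \<bar>c\<bar>" using B[of x] by (auto simp: h_def)
  qed
  have chc: "continuous_map X euclideanreal (\<lambda>x. c + h x)" "bounded ((\<lambda>x. c + h x) ` topspace X)"
    using hc hb by (auto intro!: continuous_map_add bounded_plus_comp simp: image_constant_conv)
  note Hh = Cb_of_real[OF hc hb]
  have "\<forall>x\<in>S s t. complex_of_real (h x) = 0" using le by (auto simp: h_def max_def intro: antisym)
  moreover have "complex_of_real (h x) \<in> \<real>\<^sub>\<ge>\<^sub>0" for x by (simp add: h_def)
  ultimately have zero: "F (\<lambda>x. complex_of_real (h x)) (s, t) = 0"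
    using F_zero_iff[OF Hh _ s t] by blast
  have "Re (F (\<lambda>x. complex_of_real (g x)) (s, t)) \<le> Re (F (\<lambda>x. complex_of_real (c + h x)) (s, t))"
    by (rule st.mono[OF g chc]) (simp add: h_def)
  also have "\<dots> = c"
    using st.add[OF Cb_const Hh, of "complex_of_real c"] st.const zero by simp
  finally show ?thesis .
qed

lemma F_norm_le:
  assumes f: "f \<in> Cb X" and s: "s \<in> topspace X" and t: "t \<in> topspace X"
    and le: "\<And>x. x \<in> S s t \<Longrightarrow> cmod (f x) \<le> c"
  shows "cmod (F f (s, t)) \<le> c"
  using state.norm_le[OF F_state[OF s t] f] F_le_on_S[OF Cb_norm[OF f] s t le] by linarith

lemma F_cong:
  assumes "f \<in> Cb X" "g \<in> Cb X" "s \<in> topspace X" "t \<in> topspace X" "\<And>x. x \<in> S s t \<Longrightarrow> f x = g x"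
  shows "F f (s, t) = F g (s, t)"
  using F_norm_le[OF Cb_diff[OF assms(1,2)] assms(3,4), of 0] assms(5) F_diff[OF assms(1-4)] by simp

lemma F_sum:
  assumes "finite I" "\<And>i. i \<in> I \<Longrightarrow> h i \<in> Cb X" and s: "s \<in> topspace X" and t: "t \<in> topspace X"
  shows "(\<lambda>x. \<Sum>i\<in>I. c i * h i x) \<in> Cb X \<and>
    F (\<lambda>x. \<Sum>i\<in>I. c i * h i x) (s, t) = (\<Sum>i\<in>I. c i * F (h i) (s, t))"
  using assms(1,2)
proof (induction I rule: finite_induct)
  case empty
  then show ?case using F_const[OF s t, of 0] Cb_const by simp
next
  case (insert i I)
  have 1: "(\<lambda>x. c i * h i x) \<in> Cb X" using insert by (intro Cb_scale) auto
  have 2: "(\<lambda>x. \<Sum>i\<in>I. c i * h i x) \<in> Cb X" using insert by auto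
  show ?case
    using insert F_add[OF 1 2 s t] F_scale[OF _ s t, of "h i" "c i"] Cb_add[OF 1 2] by simp
qed

lemma F_slices_Cb:
  assumes H: "H \<in> Cb (prod_topology X X)" and t: "t \<in> topspace X" and u: "u \<in> topspace X"
  shows "(\<lambda>s. F (\<lambda>x. H (s, x)) (t, u)) \<in> Cb X"
proof -
  have Hs: "(\<lambda>x. H (s, x)) \<in> Cb X" if "s \<in> topspace X" for s
    by (rule Cb_slice_right[OF H that])
  obtain c where c: "\<And>s x. s \<in> topspace X \<Longrightarrow> x \<in> topspace X \<Longrightarrow> cmod (H (s, x)) \<le> c"
    using H unfolding Cb_def bounded_iff by auto
  have "continuous_map X euclidean (\<lambda>s. F (\<lambda>x. H (s, x)) (t, u))"
  proof (rule continuous_map_distI)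
    fix s \<epsilon> assume s: "s \<in> topspace X" and \<epsilon>: "(0::real) < \<epsilon>"
    have "continuous_map (prod_topology X X) euclidean H" using H by (simp add: Cb_def)
    from uniform_over_compact_right[OF this S_compact[OF t u] s, of "\<epsilon>/2"]
    obtain U where U: "openin X U" "s \<in> U"
        "\<And>s' x. s' \<in> U \<Longrightarrow> x \<in> S t u \<Longrightarrow> dist (H (s', x)) (H (s, x)) < \<epsilon>/2"
      using \<epsilon> by auto
    show "\<exists>U. openin X U \<and> s \<in> U \<and>
        (\<forall>y\<in>U. dist (F (\<lambda>x. H (y, x)) (t, u)) (F (\<lambda>x. H (s, x)) (t, u)) < \<epsilon>)"
    proof (intro exI[of _ U] conjI ballI U)
      fix y assume y: "y \<in> U"
      then have yt: "y \<in> topspace X" using openin_subset[OF U(1)] by auto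
      have "cmod (F (\<lambda>x. H (y, x) - H (s, x)) (t, u)) \<le> \<epsilon>/2"
        using U(3)[OF y] by (intro F_norm_le Cb_diff Hs yt s t u) (auto simp: dist_norm intro: less_imp_le)
      then show "dist (F (\<lambda>x. H (y, x)) (t, u)) (F (\<lambda>x. H (s, x)) (t, u)) < \<epsilon>"
        using F_diff[OF Hs[OF yt] Hs[OF s] t u] \<epsilon> by (simp add: dist_norm)
    qed
  qed
  moreover have "bounded ((\<lambda>s. F (\<lambda>x. H (s, x)) (t, u)) ` topspace X)"
    using c S_subset[OF t u] by (intro boundedI[where B = c]) (auto intro!: F_norm_le Hs t u)
  ultimately show ?thesis by (simp add: Cb_def)
qed

text \<open>On a compact set carrying almost all mass the integral over \<open>s\<close> is close to a finite sum,
  uniformly for \<open>x\<close> in the compact support of the functional; finite sums commute with it.\<close>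

lemma F_integral_exchange_radon:
  assumes M: "finite_radon X M" and H: "H \<in> Cb (prod_topology X X)"
    and t: "t \<in> topspace X" and u: "u \<in> topspace X"
  shows "F (\<lambda>x. integral\<^sup>L M (\<lambda>s. H (s, x))) (t, u) = integral\<^sup>L M (\<lambda>s. F (\<lambda>x. H (s, x)) (t, u))"
proof -
  interpret finite_measure M by (rule finite_radon_finite[OF M])
  note [simp] = finite_radon_space[OF M] finite_radon_sets[OF M]
  let ?m = "measure M (topspace X)"
  have Hc: "continuous_map (prod_topology X X) euclidean H" using H by (simp add: Cb_def)
  have Hr: "(\<lambda>x. H (s, x)) \<in> Cb X" if "s \<in> topspace X" for s
    by (rule Cb_slice_right[OF H that])
  have Hl: "(\<lambda>s. H (s, x)) \<in> Cb X" if "x \<in> topspace X" for x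
    by (rule Cb_slice_left[OF H that])
  have int: "(\<lambda>x. integral\<^sup>L M (\<lambda>s. H (s, x))) \<in> Cb X"
    using partial_integral[OF haus M, of X H] H unfolding Cb_def by simp
  have FH: "(\<lambda>s. F (\<lambda>x. H (s, x)) (t, u)) \<in> Cb X" by (rule F_slices_Cb[OF H t u])
  obtain c where c: "0 < c" "\<And>s x. s \<in> topspace X \<Longrightarrow> x \<in> topspace X \<Longrightarrow> cmod (H (s, x)) \<le> c"
    using H unfolding Cb_def bounded_pos by auto
  have close: "cmod (F (\<lambda>x. integral\<^sup>L M (\<lambda>s. H (s, x))) (t, u) - integral\<^sup>L M (\<lambda>s. F (\<lambda>x. H (s, x)) (t, u)))
      \<le> 2 * (\<epsilon> * ?m + c * \<epsilon>)" if \<epsilon>: "0 < \<epsilon>" for \<epsilon>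
  proof -
    obtain K where K: "compactin X K" "K \<in> sets (borel_of X)" "measure M (topspace X - K) < \<epsilon>"
      using finite_radon_tight[OF haus M \<epsilon>] by blast
    have Kt: "K \<subseteq> topspace X" by (rule compactin_subset_topspace[OF K(1)])
    have "\<exists>U. openin X U \<and> s \<in> U \<and> (\<forall>s'\<in>U. \<forall>x\<in>S t u. dist (H (s', x)) (H (s, x)) < \<epsilon>)" if "s \<in> K" for s
      using that Kt by (intro uniform_over_compact_right[OF Hc S_compact[OF t u] _ \<epsilon>]) auto
    then obtain U where U: "\<And>s. s \<in> K \<Longrightarrow> openin X (U s)" "\<And>s. s \<in> K \<Longrightarrow> s \<in> U s"
        "\<And>s s' x. \<lbrakk>s \<in> K; s' \<in> U s; x \<in> S t u\<rbrakk> \<Longrightarrow> dist (H (s', x)) (H (s, x)) < \<epsilon>"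
      by metis
    obtain n :: nat and y A where yA: "\<And>i. i < n \<Longrightarrow> y i \<in> K" "\<And>i. i < n \<Longrightarrow> A i \<subseteq> U (y i)"
        "\<And>i. A i \<in> sets (borel_of X)" "disjoint_family A" "(\<Union>i<n. A i) = K"
      using finite_borel_partition[OF haus K(1), of U] U(1,2) by metis
    have yt: "y i \<in> topspace X" if "i < n" for i using yA(1)[OF that] Kt by auto
    have ind: "(\<Sum>i<n. indicator (A i) s * z i) = (if s \<in> K then z (THE i. i < n \<and> s \<in> A i) else 0)"
      for z :: "nat \<Rightarrow> complex" and s
    proof (cases "s \<in> K")
      case True
      then obtain i where i: "i < n" "s \<in> A i" using yA(5) by auto
      have only: "j = i" if "s \<in> A j" for j
        using yA(4) i(2) that unfolding disjoint_family_on_def by blast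
      have "(THE i. i < n \<and> s \<in> A i) = i" using i only by blast
      moreover have "(\<Sum>j<n. indicator (A j) s * z j) = (\<Sum>j<n. if j = i then z i else 0)"
      proof (rule sum.cong)
        fix j
        show "indicator (A j) s * z j = (if j = i then z i else 0)"
          using only[of j] i(2) by (cases "j = i") (auto simp: indicator_def)
      qed simp
      ultimately show ?thesis using True i by simp
    next
      case False
      then show ?thesis using yA(5) by (auto simp: indicator_def intro!: sum.neutral)
    qed
    have approx: "cmod (H (s, x) - (\<Sum>i<n. indicator (A i) s * H (y i, x))) \<le> \<epsilon> + c * indicator (topspace X - K) s"
      if s: "s \<in> topspace X" and x: "x \<in> S t u" for s x
    proof (cases "s \<in> K")
      case True
      then obtain i where i: "i < n" "s \<in> A i" using yA(5) by auto
      have only: "j = i" if "s \<in> A j" for j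
        using yA(4) i(2) that unfolding disjoint_family_on_def by blast
      have "(THE i. i < n \<and> s \<in> A i) = i" using i only by blast
      then have "(\<Sum>i<n. indicator (A i) s * H (y i, x)) = H (y i, x)"
        using True ind[of s "\<lambda>i. H (y i, x)"] by simp
      moreover have "dist (H (s, x)) (H (y i, x)) < \<epsilon>"
        using yA(1)[OF i(1)] yA(2)[OF i(1)] i(2) x by (intro U(3)) auto
      ultimately show ?thesis using True by (simp add: dist_norm)
    next
      case False
      then show ?thesis
        using ind[of s "\<lambda>i. H (y i, x)"] c(2)[OF s, of x] S_subset[OF t u] x s \<epsilon> by auto
    qed
    have intA: "integrable M (\<lambda>s. indicator (A i) s * z)" "integral\<^sup>L M (\<lambda>s. indicator (A i) s * z) = measure M (A i) * z"
      for i and z :: complex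
    proof -
      have A: "A i \<in> sets M" using yA(3) by simp
      have eq: "(\<lambda>s. indicator (A i) s * z) = (\<lambda>s. indicat_real (A i) s *\<^sub>R z)"
        by (auto simp: indicator_def fun_eq_iff)
      show "integrable M (\<lambda>s. indicator (A i) s * z)"
        unfolding eq using A by (intro integrable_scaleR_left integrable_real_indicator) (auto simp: emeasure_eq_measure)
      show "integral\<^sup>L M (\<lambda>s. indicator (A i) s * z) = measure M (A i) * z"
        unfolding eq using A borel_of_subset[OF yA(3)]
        by (subst integral_scaleR_left) (auto simp: emeasure_eq_measure scaleR_conv_of_real Int_absorb2 intro!: integrable_real_indicator)
    qed
    have step: "cmod (integral\<^sup>L M g - (\<Sum>i<n. measure M (A i) * z i)) \<le> \<epsilon> * ?m + c * \<epsilon>"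
      if g: "g \<in> Cb X" and b: "\<And>s. s \<in> topspace X \<Longrightarrow>
        cmod (g s - (\<Sum>i<n. indicator (A i) s * z i)) \<le> \<epsilon> + c * indicator (topspace X - K) s"
      for g :: "'a \<Rightarrow> complex" and z :: "nat \<Rightarrow> complex"
    proof -
      have gi: "integrable M g" by (rule Cb_integrable[OF M g])
      have si: "integrable M (\<lambda>s. \<Sum>i<n. indicator (A i) s * z i)"
        by (intro Bochner_Integration.integrable_sum intA)
      have "cmod (integral\<^sup>L M (\<lambda>s. g s - (\<Sum>i<n. indicator (A i) s * z i)))
          \<le> \<epsilon> * ?m + c * measure M (topspace X - K)"
        using gi si by (intro integral_bound_off_compact[OF M K(2) _ b]) auto
      also have "\<dots> \<le> \<epsilon> * ?m + c * \<epsilon>" using K(3) c(1) by (intro add_left_mono mult_left_mono) auto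
      also have "integral\<^sup>L M (\<lambda>s. g s - (\<Sum>i<n. indicator (A i) s * z i)) =
          integral\<^sup>L M g - (\<Sum>i<n. measure M (A i) * z i)"
        unfolding Bochner_Integration.integral_diff[OF gi si] Bochner_Integration.integral_sum[OF intA(1)] intA(2) ..
      finally show ?thesis .
    qed
    \<comment> \<open>The finite sum that is close to both sides.\<close>
    define \<sigma> where "\<sigma> x = (\<Sum>i<n. measure M (A i) * H (y i, x))" for x
    have \<sigma>: "\<sigma> \<in> Cb X" "F \<sigma> (t, u) = (\<Sum>i<n. measure M (A i) * F (\<lambda>x. H (y i, x)) (t, u))"
      using F_sum[OF _ _ t u, of "{..<n}" "\<lambda>i x. H (y i, x)" "\<lambda>i. complex_of_real (measure M (A i))"] Hr yt
      unfolding \<sigma>_def by auto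
    have "cmod (F (\<lambda>x. integral\<^sup>L M (\<lambda>s. H (s, x)) - \<sigma> x) (t, u)) \<le> \<epsilon> * ?m + c * \<epsilon>"
      unfolding \<sigma>_def
    proof (rule F_norm_le[OF _ t u])
      show "(\<lambda>x. integral\<^sup>L M (\<lambda>s. H (s, x)) - (\<Sum>i<n. measure M (A i) * H (y i, x))) \<in> Cb X"
        using Cb_diff[OF int \<sigma>(1)] unfolding \<sigma>_def .
      fix x assume x: "x \<in> S t u"
      then show "cmod (integral\<^sup>L M (\<lambda>s. H (s, x)) - (\<Sum>i<n. measure M (A i) * H (y i, x))) \<le> \<epsilon> * ?m + c * \<epsilon>"
        using S_subset[OF t u] by (intro step Hl approx) auto
    qed
    then have 1: "cmod (F (\<lambda>x. integral\<^sup>L M (\<lambda>s. H (s, x))) (t, u) - F \<sigma> (t, u)) \<le> \<epsilon> * ?m + c * \<epsilon>"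
      using F_diff[OF int \<sigma>(1) t u] by simp
    have 2: "cmod (integral\<^sup>L M (\<lambda>s. F (\<lambda>x. H (s, x)) (t, u)) - F \<sigma> (t, u)) \<le> \<epsilon> * ?m + c * \<epsilon>"
      unfolding \<sigma>(2)
    proof (rule step[OF FH])
      fix s assume s: "s \<in> topspace X"
      note sm = F_sum[OF _ _ t u, of "{..<n}" "\<lambda>i x. H (y i, x)" "\<lambda>i. indicator (A i) s"]
      have "(\<lambda>x. \<Sum>i<n. indicator (A i) s * H (y i, x)) \<in> Cb X" using sm Hr yt by auto
      moreover have "F (\<lambda>x. \<Sum>i<n. indicator (A i) s * H (y i, x)) (t, u) =
          (\<Sum>i<n. indicator (A i) s * F (\<lambda>x. H (y i, x)) (t, u))"
        using sm Hr yt by auto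
      ultimately show "cmod (F (\<lambda>x. H (s, x)) (t, u) - (\<Sum>i<n. indicator (A i) s * F (\<lambda>x. H (y i, x)) (t, u)))
          \<le> \<epsilon> + c * indicator (topspace X - K) s"
        using F_norm_le[OF Cb_diff[OF Hr[OF s]] t u approx[OF s]] F_diff[OF Hr[OF s] _ t u] by simp
    qed
    let ?a = "F (\<lambda>x. integral\<^sup>L M (\<lambda>s. H (s, x))) (t, u)" and ?b = "integral\<^sup>L M (\<lambda>s. F (\<lambda>x. H (s, x)) (t, u))"
    have "cmod (?a - ?b) = cmod ((?a - F \<sigma> (t, u)) - (?b - F \<sigma> (t, u)))" by simp
    also have "\<dots> \<le> cmod (?a - F \<sigma> (t, u)) + cmod (?b - F \<sigma> (t, u))" by (rule norm_triangle_ineq4)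
    finally show ?thesis using 1 2 by simp
  qed
  have "cmod (F (\<lambda>x. integral\<^sup>L M (\<lambda>s. H (s, x))) (t, u) - integral\<^sup>L M (\<lambda>s. F (\<lambda>x. H (s, x)) (t, u))) \<le> 0 + r"
    if r: "0 < r" for r
  proof -
    have p: "0 < ?m + c" using c(1) measure_nonneg[of M "topspace X"] by linarith
    then have "0 < r / (2 * (?m + c))" using r by simp
    from close[OF this] have "cmod (F (\<lambda>x. integral\<^sup>L M (\<lambda>s. H (s, x))) (t, u) - integral\<^sup>L M (\<lambda>s. F (\<lambda>x. H (s, x)) (t, u)))
      \<le> 2 * (r / (2 * (?m + c)) * ?m + c * (r / (2 * (?m + c))))" .
    also have "\<dots> = (r / (2 * (?m + c))) * (2 * (?m + c))" by (simp only: algebra_simps)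
    also have "\<dots> = r" using p by simp
    finally show ?thesis by simp
  qed
  then have "cmod (F (\<lambda>x. integral\<^sup>L M (\<lambda>s. H (s, x))) (t, u) - integral\<^sup>L M (\<lambda>s. F (\<lambda>x. H (s, x)) (t, u))) \<le> 0"
    by (rule field_le_epsilon)
  then show ?thesis by simp
qed

lemma F_pairing_exchange:
  assumes \<mu>: "\<mu> \<in> Mb X" and H: "H \<in> Cb (prod_topology X X)"
    and t: "t \<in> topspace X" and u: "u \<in> topspace X"
  shows "F (\<lambda>x. pairing X (\<lambda>s. H (s, x)) \<mu>) (t, u) = pairing X (\<lambda>s. F (\<lambda>x. H (s, x)) (t, u)) \<mu>"
proof -
  note part = partial_pairing[OF haus _ H] and FH = F_slices_Cb[OF H t u]
  have cong: "F f (t, u) = F g (t, u)" if "f \<in> Cb X" "\<And>x. x \<in> topspace X \<Longrightarrow> f x = g x" for f g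
    using that S_subset[OF t u] by (intro F_cong Cb_cong[OF that] t u) auto
  show ?thesis
    using \<mu>
  proof (induction rule: Mb_induct[OF haus, consumes 1, case_names pos add scale])
    case (pos M)
    have "F (\<lambda>x. pairing X (\<lambda>s. H (s, x)) (pos_cmeas M)) (t, u) = F (\<lambda>x. integral\<^sup>L M (\<lambda>s. H (s, x))) (t, u)"
      by (rule cong[OF part[OF Mb_pos[OF haus pos]]]) (simp add: pairing_pos[OF haus pos] Cb_slice_left[OF H])
    then show ?case
      using F_integral_exchange_radon[OF pos H t u] by (simp add: pairing_pos[OF haus pos FH])
  next
    case (add \<mu> \<nu>)
    have "F (\<lambda>x. pairing X (\<lambda>s. H (s, x)) (\<lambda>A. \<mu> A + \<nu> A)) (t, u) =
        F (\<lambda>x. pairing X (\<lambda>s. H (s, x)) \<mu> + pairing X (\<lambda>s. H (s, x)) \<nu>) (t, u)"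
      by (rule cong[OF part[OF Mb_add[OF haus add(1,2)]]]) (simp add: pairing_add[OF haus add(1,2)] Cb_slice_left[OF H])
    then show ?case
      using add F_add[OF part[OF add(1)] part[OF add(2)] t u] by (simp add: pairing_add[OF haus add(1,2) FH])
  next
    case (scale c \<mu>)
    have "F (\<lambda>x. pairing X (\<lambda>s. H (s, x)) (\<lambda>A. c * \<mu> A)) (t, u) = F (\<lambda>x. c * pairing X (\<lambda>s. H (s, x)) \<mu>) (t, u)"
      by (rule cong[OF part[OF Mb_scale[OF haus scale(1)]]]) (simp add: pairing_scale[OF haus scale(1)] Cb_slice_left[OF H])
    then show ?case
      using scale F_scale[OF part[OF scale(1)] t u] by (simp add: pairing_scale[OF haus scale(1) FH])
  qed
qed

definition is_conv :: "'a cmeas \<Rightarrow> 'a cmeas \<Rightarrow> 'a cmeas \<Rightarrow> bool" where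
  "is_conv \<mu> \<nu> \<kappa> \<longleftrightarrow> \<kappa> \<in> Mb X \<and>
     (\<forall>f\<in>Cb X. pairing X f \<kappa> = pairing X (\<lambda>t. pairing X (\<lambda>s. F f (s, t)) \<mu>) \<nu>)"

lemma is_conv_unique: "is_conv \<mu> \<nu> \<kappa> \<Longrightarrow> is_conv \<mu> \<nu> \<kappa>' \<Longrightarrow> \<kappa> = \<kappa>'"
  unfolding is_conv_def by (intro Mb_eqI[OF creg haus]) auto

lemma inner_Cb: "\<mu> \<in> Mb X \<Longrightarrow> f \<in> Cb X \<Longrightarrow> (\<lambda>t. pairing X (\<lambda>s. F f (s, t)) \<mu>) \<in> Cb X"
  by (rule partial_pairing[OF haus _ F_Cb])

lemma slice_Cb: "f \<in> Cb X \<Longrightarrow> t \<in> topspace X \<Longrightarrow> (\<lambda>s. F f (s, t)) \<in> Cb X"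
  by (rule Cb_slice_left[OF F_Cb])

lemma is_conv_add_left:
  assumes \<mu>: "\<mu> \<in> Mb X" and \<mu>': "\<mu>' \<in> Mb X" and \<nu>: "\<nu> \<in> Mb X"
    and "is_conv \<mu> \<nu> \<kappa>" "is_conv \<mu>' \<nu> \<kappa>'"
  shows "is_conv (\<lambda>A. \<mu> A + \<mu>' A) \<nu> (\<lambda>A. \<kappa> A + \<kappa>' A)"
proof -
  have "pairing X (\<lambda>t. pairing X (\<lambda>s. F f (s, t)) (\<lambda>A. \<mu> A + \<mu>' A)) \<nu> =
      pairing X (\<lambda>t. pairing X (\<lambda>s. F f (s, t)) \<mu> + pairing X (\<lambda>s. F f (s, t)) \<mu>') \<nu>"
    if "f \<in> Cb X" for f
    by (rule pairing_cong) (simp add: pairing_add[OF haus \<mu> \<mu>'] slice_Cb[OF that])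
  then show ?thesis
    using assms unfolding is_conv_def
    by (auto simp: Mb_add[OF haus] pairing_add[OF haus] pairing_add_fun[OF haus \<nu> inner_Cb inner_Cb])
qed

lemma is_conv_scale_left:
  assumes \<mu>: "\<mu> \<in> Mb X" and \<nu>: "\<nu> \<in> Mb X" and "is_conv \<mu> \<nu> \<kappa>"
  shows "is_conv (\<lambda>A. c * \<mu> A) \<nu> (\<lambda>A. c * \<kappa> A)"
proof -
  have "pairing X (\<lambda>t. pairing X (\<lambda>s. F f (s, t)) (\<lambda>A. c * \<mu> A)) \<nu> =
      pairing X (\<lambda>t. c * pairing X (\<lambda>s. F f (s, t)) \<mu>) \<nu>"
    if "f \<in> Cb X" for f
    by (rule pairing_cong) (simp add: pairing_scale[OF haus \<mu>] slice_Cb[OF that])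
  then show ?thesis
    using assms unfolding is_conv_def
    by (auto simp: Mb_scale[OF haus] pairing_scale[OF haus] pairing_scale_fun[OF haus \<nu> inner_Cb])
qed

lemma is_conv_add_right:
  assumes "\<mu> \<in> Mb X" "\<nu> \<in> Mb X" "\<nu>' \<in> Mb X" "is_conv \<mu> \<nu> \<kappa>" "is_conv \<mu> \<nu>' \<kappa>'"
  shows "is_conv \<mu> (\<lambda>A. \<nu> A + \<nu>' A) (\<lambda>A. \<kappa> A + \<kappa>' A)"
  using assms unfolding is_conv_def by (auto simp: Mb_add[OF haus] pairing_add[OF haus] inner_Cb)

lemma is_conv_scale_right:
  assumes "\<mu> \<in> Mb X" "\<nu> \<in> Mb X" "is_conv \<mu> \<nu> \<kappa>"
  shows "is_conv \<mu> (\<lambda>A. c * \<nu> A) (\<lambda>A. c * \<kappa> A)"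
  using assms unfolding is_conv_def by (auto simp: Mb_scale[OF haus] pairing_scale[OF haus] inner_Cb)

text \<open>For positive measures the double integral is a positive functional; it is tight since the
  supports \<open>S s t\<close> stay in a compact set while \<open>s\<close> and \<open>t\<close> range over compact sets of almost full
  measure.\<close>

lemma conv_positive:
  assumes M: "finite_radon X M" and N: "finite_radon X N"
  obtains R where "finite_radon X R" "is_conv (pos_cmeas M) (pos_cmeas N) (pos_cmeas R)"
proof -
  interpret M: finite_measure M by (rule finite_radon_finite[OF M])
  interpret N: finite_measure N by (rule finite_radon_finite[OF N])
  define G where "G g p = Re (F (\<lambda>x. complex_of_real (g x)) p)" for g p
  define L where "L g = integral\<^sup>L N (\<lambda>t. integral\<^sup>L M (\<lambda>s. G g (s, t)))" for g
  have G: "continuous_map (prod_topology X X) euclideanreal (G g)" "bounded (G g ` topspace (prod_topology X X))"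
    if "continuous_map X euclideanreal g" "bounded (g ` topspace X)" for g
    using Cb_Re_Im(1,2)[OF F_Cb[OF Cb_of_real[OF that]]] unfolding G_def by auto
  have Gs: "integrable M (\<lambda>s. G g (s, t))"
    if g: "continuous_map X euclideanreal g" "bounded (g ` topspace X)" and t: "t \<in> topspace X" for g t
    unfolding G_def
    using Cb_integrable[OF M slice_Cb[OF Cb_of_real[OF g] t]] by auto
  have Gi: "integrable N (\<lambda>t. integral\<^sup>L M (\<lambda>s. G g (s, t)))"
    if "continuous_map X euclideanreal g" "bounded (g ` topspace X)" for g
    using partial_integral[OF haus M G[OF that]]
    by (intro bounded_continuous_integrable[of N X]) (auto simp: N.finite_measure_axioms finite_radon_sets[OF N])
  have L_add: "L (\<lambda>x. f x + g x) = L f + L g"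
    if f: "continuous_map X euclideanreal f" "bounded (f ` topspace X)"
      and g: "continuous_map X euclideanreal g" "bounded (g ` topspace X)" for f g
  proof -
    have "L (\<lambda>x. f x + g x) = integral\<^sup>L N (\<lambda>t. integral\<^sup>L M (\<lambda>s. G f (s, t)) + integral\<^sup>L M (\<lambda>s. G g (s, t)))"
      unfolding L_def
    proof (rule Bochner_Integration.integral_cong)
      fix t assume "t \<in> space N"
      then have t: "t \<in> topspace X" by (simp add: finite_radon_space[OF N])
      have "integral\<^sup>L M (\<lambda>s. G (\<lambda>x. f x + g x) (s, t)) = integral\<^sup>L M (\<lambda>s. G f (s, t) + G g (s, t))"
        by (rule Bochner_Integration.integral_cong)
          (auto simp: G_def finite_radon_space[OF M] F_add[OF Cb_of_real[OF f] Cb_of_real[OF g] _ t])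
      then show "integral\<^sup>L M (\<lambda>s. G (\<lambda>x. f x + g x) (s, t)) =
          integral\<^sup>L M (\<lambda>s. G f (s, t)) + integral\<^sup>L M (\<lambda>s. G g (s, t))"
        using Gs[OF f t] Gs[OF g t] by simp
    qed simp
    then show ?thesis using Gi[OF f] Gi[OF g] by (simp add: L_def)
  qed
  have L_scale: "L (\<lambda>x. c * f x) = c * L f"
    if f: "continuous_map X euclideanreal f" "bounded (f ` topspace X)" for f c
  proof -
    have "L (\<lambda>x. c * f x) = integral\<^sup>L N (\<lambda>t. c * integral\<^sup>L M (\<lambda>s. G f (s, t)))"
      unfolding L_def
    proof (rule Bochner_Integration.integral_cong)
      fix t assume "t \<in> space N"
      then have t: "t \<in> topspace X" by (simp add: finite_radon_space[OF N])
      have "integral\<^sup>L M (\<lambda>s. G (\<lambda>x. c * f x) (s, t)) = integral\<^sup>L M (\<lambda>s. c * G f (s, t))"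
        by (rule Bochner_Integration.integral_cong)
          (auto simp: G_def finite_radon_space[OF M] F_scale[OF Cb_of_real[OF f] _ t])
      then show "integral\<^sup>L M (\<lambda>s. G (\<lambda>x. c * f x) (s, t)) = c * integral\<^sup>L M (\<lambda>s. G f (s, t))"
        by simp
    qed simp
    then show ?thesis by (simp add: L_def)
  qed
  have G_le: "G g (s, t) \<le> c"
    if "continuous_map X euclideanreal g" "bounded (g ` topspace X)" "s \<in> topspace X" "t \<in> topspace X"
      "\<And>x. x \<in> S s t \<Longrightarrow> g x \<le> c" for g s t c
    unfolding G_def by (rule F_le_on_S[OF that])
  have G_pos: "0 \<le> G g (s, t)"
    if g: "continuous_map X euclideanreal g" "bounded (g ` topspace X)"
      and pos: "\<And>x. x \<in> topspace X \<Longrightarrow> 0 \<le> g x" and st: "s \<in> topspace X" "t \<in> topspace X" for g s t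
    using F_pos[OF Cb_of_real[OF g] _ st] pos by (auto simp: G_def nonneg_Reals_iff)
  interpret T: tight_functional X L
  proof (unfold_locales, rule creg, rule haus)
    show "0 \<le> L f" if f: "continuous_map X euclideanreal f" "bounded (f ` topspace X)"
      and pos: "\<And>x. x \<in> topspace X \<Longrightarrow> 0 \<le> f x" for f
      unfolding L_def by (intro integral_nonneg_AE AE_I2 G_pos[OF f pos])
        (auto simp: finite_radon_space[OF M] finite_radon_space[OF N])
    show "\<exists>K. compactin X K \<and> (\<forall>f. continuous_map X euclideanreal f \<and>
        (\<forall>x\<in>topspace X. 0 \<le> f x \<and> f x \<le> 1) \<and> (\<forall>x\<in>K. f x = 0) \<longrightarrow> L f \<le> \<epsilon>)" if \<epsilon>: "0 < \<epsilon>" for \<epsilon>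
    proof -
      let ?m = "measure M (topspace X)" and ?n = "measure N (topspace X)"
      \<comment> \<open>Chosen so that the errors off the two compact sets, \<open>\<delta> ?n\<close> and \<open>?m \<delta>\<close>, add up to at most \<open>\<epsilon>\<close>.\<close>
      define \<delta> where "\<delta> = \<epsilon> / (?m + ?n + 1)"
      have pos: "0 < ?m + ?n + 1" by (simp add: add_nonneg_pos)
      then have \<delta>: "0 < \<delta>" using \<epsilon> by (simp add: \<delta>_def)
      obtain K1 where K1: "compactin X K1" "K1 \<in> sets (borel_of X)" "measure M (topspace X - K1) < \<delta>"
        using finite_radon_tight[OF haus M \<delta>] by blast
      obtain K2 where K2: "compactin X K2" "K2 \<in> sets (borel_of X)" "measure N (topspace X - K2) < \<delta>"
        using finite_radon_tight[OF haus N \<delta>] by blast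
      obtain C where C: "compactin X C" "\<And>s t. s \<in> K1 \<Longrightarrow> t \<in> K2 \<Longrightarrow> S s t \<subseteq> C"
        using S_bounded[OF K1(1) K2(1)] by blast
      have "L f \<le> \<epsilon>" if f: "continuous_map X euclideanreal f"
        "\<And>x. x \<in> topspace X \<Longrightarrow> 0 \<le> f x \<and> f x \<le> 1" "\<And>x. x \<in> C \<Longrightarrow> f x = 0" for f
      proof -
        have b: "bounded (f ` topspace X)" using f(2) by (auto intro!: boundedI[where B = 1])
        have G1: "0 \<le> G f (s, t)" "G f (s, t) \<le> 1" if "s \<in> topspace X" "t \<in> topspace X" for s t
          using G_pos[OF f(1) b _ that] G_le[OF f(1) b that, of 1] f(2) S_subset[OF that] by auto
        have G0: "G f (s, t) = 0" if st: "s \<in> K1" "t \<in> K2" for s t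
        proof -
          have top: "s \<in> topspace X" "t \<in> topspace X"
            using st compactin_subset_topspace K1(1) K2(1) by blast+
          have "G f (s, t) \<le> 0" using C(2)[OF st] f(3) by (intro G_le[OF f(1) b top]) force
          then show ?thesis using G1(1)[OF top] by simp
        qed
        have inner: "norm (integral\<^sup>L M (\<lambda>s. G f (s, t))) \<le> \<delta> + ?m * indicator (topspace X - K2) t"
          if t: "t \<in> topspace X" for t
        proof (cases "t \<in> K2")
          case True
          have "norm (integral\<^sup>L M (\<lambda>s. G f (s, t))) \<le> 0 * ?m + 1 * measure M (topspace X - K1)"
            using Gs[OF f(1) b t] G0 G1 True t
            by (intro integral_bound_off_compact[OF M K1(2)]) (auto simp: indicator_def)
          then show ?thesis using K1(3) True by simp
        next
          case False
          have "norm (integral\<^sup>L M (\<lambda>s. G f (s, t))) \<le> 1 * ?m + 0 * measure M (topspace X - K1)"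
            using Gs[OF f(1) b t] G1 t by (intro integral_bound_off_compact[OF M K1(2)]) auto
          then show ?thesis using False t \<delta> by simp
        qed
        have "norm (L f) \<le> \<delta> * ?n + ?m * measure N (topspace X - K2)"
          unfolding L_def using Gi[OF f(1) b] inner
          by (intro integral_bound_off_compact[OF N K2(2)]) auto
        also have "\<dots> \<le> \<delta> * ?n + ?m * \<delta>"
          using K2(3) by (intro add_left_mono mult_left_mono) auto
        also have "\<dots> \<le> \<delta> * (?m + ?n + 1)" using \<delta> by (simp add: algebra_simps)
        also have "\<dots> = \<epsilon>" using pos by (simp add: \<delta>_def)
        finally show ?thesis by simp
      qed
      then show ?thesis using C(1) by blast
    qed
  qed (use L_add L_scale in auto)
  let ?R = "T.riesz_measure"
  have R: "finite_radon X ?R" by (rule T.riesz_representation(1))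
  have L_eq: "integral\<^sup>L ?R g = L g" if "continuous_map X euclideanreal g" "bounded (g ` topspace X)" for g
    using that by (intro T.riesz_representation(2)) (simp add: T.real_Cb_def)
  have "is_conv (pos_cmeas M) (pos_cmeas N) (pos_cmeas ?R)"
    unfolding is_conv_def
  proof (intro conjI ballI Mb_pos[OF haus R])
    fix f assume f: "f \<in> Cb X"
    note reim = Cb_Re_Im[OF f]
    have slice: "integral\<^sup>L M (\<lambda>s. F f (s, t)) =
        Complex (integral\<^sup>L M (\<lambda>s. G (\<lambda>x. Re (f x)) (s, t))) (integral\<^sup>L M (\<lambda>s. G (\<lambda>x. Im (f x)) (s, t)))"
      if t: "t \<in> topspace X" for t
    proof -
      have i: "integrable M (\<lambda>s. F f (s, t))" by (rule Cb_integrable[OF M slice_Cb[OF f t]])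
      have "integral\<^sup>L M (\<lambda>s. Re (F f (s, t))) = integral\<^sup>L M (\<lambda>s. G (\<lambda>x. Re (f x)) (s, t))"
        "integral\<^sup>L M (\<lambda>s. Im (F f (s, t))) = integral\<^sup>L M (\<lambda>s. G (\<lambda>x. Im (f x)) (s, t))"
        by (intro Bochner_Integration.integral_cong refl;
          simp add: G_def finite_radon_space[OF M] F_split[OF f _ t])+
      then show ?thesis using i by (simp add: complex_eq_iff)
    qed
    have iN: "integrable N (\<lambda>t. integral\<^sup>L M (\<lambda>s. F f (s, t)))"
      using Cb_integrable[OF N inner_Cb[OF Mb_pos[OF haus M] f]]
      by (rule Bochner_Integration.integrable_cong[THEN iffD1, rotated -1])
        (auto simp: finite_radon_space[OF N] pairing_pos[OF haus M slice_Cb[OF f]])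
    have "pairing X (\<lambda>t. pairing X (\<lambda>s. F f (s, t)) (pos_cmeas M)) (pos_cmeas N) =
        integral\<^sup>L N (\<lambda>t. pairing X (\<lambda>s. F f (s, t)) (pos_cmeas M))"
      by (rule pairing_pos[OF haus N inner_Cb[OF Mb_pos[OF haus M] f]])
    also have "\<dots> = integral\<^sup>L N (\<lambda>t. integral\<^sup>L M (\<lambda>s. F f (s, t)))"
      by (rule Bochner_Integration.integral_cong)
        (auto simp: finite_radon_space[OF N] pairing_pos[OF haus M slice_Cb[OF f]])
    also have "\<dots> = Complex (L (\<lambda>x. Re (f x))) (L (\<lambda>x. Im (f x)))"
    proof -
      have "integral\<^sup>L N (\<lambda>t. Re (integral\<^sup>L M (\<lambda>s. F f (s, t)))) = L (\<lambda>x. Re (f x))"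
        "integral\<^sup>L N (\<lambda>t. Im (integral\<^sup>L M (\<lambda>s. F f (s, t)))) = L (\<lambda>x. Im (f x))"
        unfolding L_def
        by (intro Bochner_Integration.integral_cong refl; simp add: finite_radon_space[OF N] slice)+
      then show ?thesis using iN by (simp add: complex_eq_iff)
    qed
    also have "\<dots> = integral\<^sup>L ?R f"
      using L_eq[OF reim(1,2)] L_eq[OF reim(3,4)] Cb_integrable[OF R f] by (simp add: complex_eq_iff)
    also have "\<dots> = pairing X f (pos_cmeas ?R)" by (rule pairing_pos[OF haus R f, symmetric])
    finally show "pairing X f (pos_cmeas ?R) =
        pairing X (\<lambda>t. pairing X (\<lambda>s. F f (s, t)) (pos_cmeas M)) (pos_cmeas N)" by simp
  qed
  with R show thesis by (rule that)
qed

lemma is_conv_exists: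
  assumes \<mu>: "\<mu> \<in> Mb X" and \<nu>: "\<nu> \<in> Mb X"
  shows "\<exists>\<kappa>. is_conv \<mu> \<nu> \<kappa>"
  using \<mu>
proof (induction rule: Mb_induct[OF haus, consumes 1, case_names pos add scale])
  case (pos M)
  show ?case
    using \<nu>
  proof (induction rule: Mb_induct[OF haus, consumes 1, case_names pos add scale])
    case (pos N)
    show ?case by (rule conv_positive[OF \<open>finite_radon X M\<close> pos]) blast
  qed (use Mb_pos[OF haus pos] is_conv_add_right is_conv_scale_right in blast)+
qed (use \<nu> is_conv_add_left is_conv_scale_left in blast)+

definition conv :: "'a cmeas \<Rightarrow> 'a cmeas \<Rightarrow> 'a cmeas" where
  "conv \<mu> \<nu> = (THE \<kappa>. is_conv \<mu> \<nu> \<kappa>)"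

lemma is_conv_conv: "\<mu> \<in> Mb X \<Longrightarrow> \<nu> \<in> Mb X \<Longrightarrow> is_conv \<mu> \<nu> (conv \<mu> \<nu>)"
proof -
  assume "\<mu> \<in> Mb X" "\<nu> \<in> Mb X"
  then obtain \<kappa> where "is_conv \<mu> \<nu> \<kappa>" using is_conv_exists by blast
  then show "is_conv \<mu> \<nu> (conv \<mu> \<nu>)"
    unfolding conv_def by (rule theI[of "is_conv \<mu> \<nu>" \<kappa>]) (rule is_conv_unique[OF _ \<open>is_conv \<mu> \<nu> \<kappa>\<close>])
qed

lemma conv_eqI: "\<mu> \<in> Mb X \<Longrightarrow> \<nu> \<in> Mb X \<Longrightarrow> is_conv \<mu> \<nu> \<kappa> \<Longrightarrow> conv \<mu> \<nu> = \<kappa>"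
  using is_conv_conv is_conv_unique by blast

lemma conv_Mb: "\<mu> \<in> Mb X \<Longrightarrow> \<nu> \<in> Mb X \<Longrightarrow> conv \<mu> \<nu> \<in> Mb X"
  using is_conv_conv unfolding is_conv_def by blast

lemma pairing_conv: "\<mu> \<in> Mb X \<Longrightarrow> \<nu> \<in> Mb X \<Longrightarrow> f \<in> Cb X \<Longrightarrow>
    pairing X f (conv \<mu> \<nu>) = pairing X (\<lambda>t. pairing X (\<lambda>s. F f (s, t)) \<mu>) \<nu>"
  using is_conv_conv unfolding is_conv_def by blast

lemma pairing_conv_dirac:
  assumes s: "s \<in> topspace X" and t: "t \<in> topspace X" and f: "f \<in> Cb X"
  shows "pairing X f (conv (dirac X s) (dirac X t)) = F f (s, t)"
proof -
  have "pairing X (\<lambda>t. pairing X (\<lambda>s. F f (s, t)) (dirac X s)) (dirac X t) = pairing X (\<lambda>s. F f (s, t)) (dirac X s)"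
    by (rule pairing_dirac[OF haus t inner_Cb[OF dirac_Mb[OF haus s] f]])
  also have "\<dots> = F f (s, t)" by (rule pairing_dirac[OF haus s slice_Cb[OF f t]])
  finally show ?thesis using pairing_conv[OF dirac_Mb[OF haus s] dirac_Mb[OF haus t] f] by simp
qed

lemma dirac_conv_measure:
  assumes s: "s \<in> topspace X" and t: "t \<in> topspace X"
  obtains R where "finite_radon X R" "conv (dirac X s) (dirac X t) = pos_cmeas R"
    "\<And>f. f \<in> Cb X \<Longrightarrow> integral\<^sup>L R f = F f (s, t)"
proof -
  obtain R where R: "finite_radon X R" "is_conv (dirac X s) (dirac X t) (pos_cmeas R)"
    using conv_positive[OF finite_radon_point_mass[OF haus s] finite_radon_point_mass[OF haus t]]
    unfolding dirac_eq_pos_cmeas[OF s] dirac_eq_pos_cmeas[OF t] .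
  have eq: "conv (dirac X s) (dirac X t) = pos_cmeas R"
    by (rule conv_eqI[OF dirac_Mb[OF haus s] dirac_Mb[OF haus t] R(2)])
  have "integral\<^sup>L R f = F f (s, t)" if "f \<in> Cb X" for f
    using pairing_conv_dirac[OF s t that] unfolding eq pairing_pos[OF haus R(1) that] .
  with R(1) eq show thesis by (rule that)
qed

lemma conv_dirac_Mp:
  assumes s: "s \<in> topspace X" and t: "t \<in> topspace X"
  shows "conv (dirac X s) (dirac X t) \<in> Mp X"
proof -
  obtain R where R: "finite_radon X R" "conv (dirac X s) (dirac X t) = pos_cmeas R"
    "\<And>f. f \<in> Cb X \<Longrightarrow> integral\<^sup>L R f = F f (s, t)"
    using dirac_conv_measure[OF s t] by blast
  have "complex_of_real (measure R (topspace X)) = integral\<^sup>L R (\<lambda>x. 1)"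
    by (simp add: finite_radon_space[OF R(1)] scaleR_conv_of_real)
  also have "\<dots> = 1" using R(3)[OF Cb_const[of 1]] F_one[OF s t] by simp
  finally show ?thesis
    unfolding Mp_def R(2) using Mb_pos[OF haus R(1)] by (simp add: pos_cmeas_def)
qed

text \<open>Functions between compact and open sets translate null open sets of the representing measure into
  zeros of \<open>F\<close>, which by assumption means disjointness from \<open>S s t\<close>.\<close>

lemma msupport_conv_dirac:
  assumes s: "s \<in> topspace X" and t: "t \<in> topspace X"
  shows "msupport X (conv (dirac X s) (dirac X t)) = S s t"
proof -
  obtain R where R: "finite_radon X R" "conv (dirac X s) (dirac X t) = pos_cmeas R"
    "\<And>f. f \<in> Cb X \<Longrightarrow> integral\<^sup>L R f = F f (s, t)"
    using dirac_conv_measure[OF s t] by blast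
  interpret R: finite_measure R by (rule finite_radon_finite[OF R(1)])
  note [simp] = finite_radon_space[OF R(1)] finite_radon_sets[OF R(1)]
  have St: "S s t \<subseteq> topspace X" by (rule S_subset[OF s t])
  have null_off: "measure R U = 0" if U: "openin X U" and d: "U \<inter> S s t = {}" for U
  proof (rule ccontr)
    assume "measure R U \<noteq> 0"
    then have "0 < measure R U" by (simp add: zero_less_measure_iff)
    then obtain K where K: "compactin X K" "K \<subseteq> U" "measure R U < measure R K + measure R U"
      using finite_radon_inner[OF R(1) U] by blast
    obtain g :: "'a \<Rightarrow> real" where g: "continuous_map X euclideanreal g"
      "\<And>y. y \<in> topspace X \<Longrightarrow> 0 \<le> g y \<and> g y \<le> 1" "\<And>y. y \<in> K \<Longrightarrow> g y = 1"
      "\<And>y. y \<in> topspace X - U \<Longrightarrow> g y = 0"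
      using completely_regular_separation[OF creg K(1) U K(2)] by metis
    have b: "bounded (g ` topspace X)" using g(2) by (auto intro!: boundedI[where B = 1])
    have "\<forall>x\<in>S s t. complex_of_real (g x) = 0" using g(4) St d by auto
    then have "F (\<lambda>x. complex_of_real (g x)) (s, t) = 0"
      using F_zero_iff[OF Cb_of_real[OF g(1) b] _ s t] g(2) by simp
    then have "integral\<^sup>L R (\<lambda>x. complex_of_real (g x)) = 0"
      using R(3)[OF Cb_of_real[OF g(1) b]] by simp
    then have zero: "integral\<^sup>L R g = 0" by simp
    have KB: "K \<in> sets (borel_of X)" by (rule closedin_borel_of[OF compactin_imp_closedin[OF haus K(1)]])
    have "measure R K = integral\<^sup>L R (indicator K)"
      using compactin_subset_topspace[OF K(1)] by (simp add: Int_absorb2)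
    also have "\<dots> \<le> integral\<^sup>L R g"
      using KB g bounded_continuous_integrable[OF R.finite_measure_axioms finite_radon_sets[OF R(1)] g(1) b]
      by (intro integral_mono integrable_real_indicator) (auto simp: indicator_def R.emeasure_eq_measure)
    finally show False using K(3) zero by simp
  qed
  have pos_on: "U \<inter> S s t = {}" if U: "openin X U" and z: "measure R U = 0" for U
  proof (rule ccontr)
    assume "U \<inter> S s t \<noteq> {}"
    then obtain x where x: "x \<in> U" "x \<in> S s t" by auto
    obtain f where f: "f \<in> Cb X" "\<And>y. y \<in> topspace X \<Longrightarrow> f y \<in> \<real>\<^sub>\<ge>\<^sub>0" "f x = 1"
      "\<And>y. y \<in> topspace X - U \<Longrightarrow> f y = 0"
      using Cb_bump[OF lc haus U x(1)] by metis
    have "AE y in R. f y = 0"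
    proof (rule AE_I[of _ _ U])
      show "{y \<in> space R. \<not> f y = 0} \<subseteq> U" using f(4) by auto
    qed (use z openin_borel_of[OF U] in \<open>auto simp: R.emeasure_eq_measure\<close>)
    then have "integral\<^sup>L R f = 0" by (rule integral_eq_zero_AE)
    then have "F f (s, t) = 0" using R(3)[OF f(1)] by simp
    then show False using F_zero_iff[OF f(1,2) s t] x(2) f(3) by auto
  qed
  have null_iff: "(\<forall>A\<in>sets (borel_of X). A \<subseteq> U \<longrightarrow> pos_cmeas R A = 0) \<longleftrightarrow> U \<inter> S s t = {}"
    if U: "openin X U" for U
  proof
    assume "\<forall>A\<in>sets (borel_of X). A \<subseteq> U \<longrightarrow> pos_cmeas R A = 0"
    then have "measure R U = 0" using openin_borel_of[OF U] by (auto simp: pos_cmeas_def)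
    then show "U \<inter> S s t = {}" by (rule pos_on[OF U])
  next
    assume "U \<inter> S s t = {}"
    then have "measure R U = 0" by (rule null_off[OF U])
    then show "\<forall>A\<in>sets (borel_of X). A \<subseteq> U \<longrightarrow> pos_cmeas R A = 0"
      using R.finite_measure_mono[of _ U] openin_borel_of[OF U]
      by (auto simp: pos_cmeas_def) (metis measure_le_0_iff)
  qed
  have "openin X (topspace X - S s t)"
    using compactin_imp_closedin[OF haus S_compact[OF s t]] by (simp add: openin_diff)
  then have "\<Union>{U. openin X U \<and> U \<inter> S s t = {}} = topspace X - S s t"
    by (auto dest: openin_subset)
  moreover have "{U. openin X U \<and> (\<forall>A\<in>sets (borel_of X). A \<subseteq> U \<longrightarrow> pos_cmeas R A = 0)} =
      {U. openin X U \<and> U \<inter> S s t = {}}"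
    using null_iff by (intro Collect_cong conj_cong refl) blast
  ultimately show ?thesis
    unfolding msupport_def R(2) using St by (simp add: double_diff)
qed

lemma conv_bilinear:
  "\<mu> \<in> Mb X \<Longrightarrow> \<mu>' \<in> Mb X \<Longrightarrow> \<nu> \<in> Mb X \<Longrightarrow> conv (\<lambda>A. \<mu> A + \<mu>' A) \<nu> = (\<lambda>A. conv \<mu> \<nu> A + conv \<mu>' \<nu> A)"
  "\<mu> \<in> Mb X \<Longrightarrow> \<nu> \<in> Mb X \<Longrightarrow> \<nu>' \<in> Mb X \<Longrightarrow> conv \<mu> (\<lambda>A. \<nu> A + \<nu>' A) = (\<lambda>A. conv \<mu> \<nu> A + conv \<mu> \<nu>' A)"
  "\<mu> \<in> Mb X \<Longrightarrow> \<nu> \<in> Mb X \<Longrightarrow> conv (\<lambda>A. c * \<mu> A) \<nu> = (\<lambda>A. c * conv \<mu> \<nu> A)"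
  "\<mu> \<in> Mb X \<Longrightarrow> \<nu> \<in> Mb X \<Longrightarrow> conv \<mu> (\<lambda>A. c * \<nu> A) = (\<lambda>A. c * conv \<mu> \<nu> A)"
  by (intro conv_eqI is_conv_add_left is_conv_add_right is_conv_scale_left is_conv_scale_right
      is_conv_conv Mb_add[OF haus] Mb_scale[OF haus]; assumption)+

text \<open>Both sides unfold to iterated pairings over the three measures; the exchange lemma moves the pairing
  with \<open>\<mu>\<close> inside the comultiplication, and the integrands then agree by coassociativity.\<close>

lemma conv_assoc:
  assumes \<mu>: "\<mu> \<in> Mb X" and \<nu>: "\<nu> \<in> Mb X" and \<kappa>: "\<kappa> \<in> Mb X"
  shows "conv (conv \<mu> \<nu>) \<kappa> = conv \<mu> (conv \<nu> \<kappa>)"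
proof (rule Mb_eqI[OF creg haus])
  show "conv (conv \<mu> \<nu>) \<kappa> \<in> Mb X" "conv \<mu> (conv \<nu> \<kappa>) \<in> Mb X"
    using assms by (simp_all add: conv_Mb)
  fix f assume f: "f \<in> Cb X"
  let ?g = "\<lambda>x. pairing X (\<lambda>s. F f (s, x)) \<mu>"
  have "pairing X f (conv (conv \<mu> \<nu>) \<kappa>) = pairing X (\<lambda>u. pairing X (\<lambda>x. F f (x, u)) (conv \<mu> \<nu>)) \<kappa>"
    using assms f by (simp add: pairing_conv conv_Mb)
  also have "\<dots> = pairing X (\<lambda>u. pairing X (\<lambda>t. F ?g (t, u)) \<nu>) \<kappa>"
  proof (rule pairing_cong)
    fix u assume u: "u \<in> topspace X"
    have "pairing X (\<lambda>x. F f (x, u)) (conv \<mu> \<nu>) =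
        pairing X (\<lambda>t. pairing X (\<lambda>s. F (\<lambda>x. F f (x, u)) (s, t)) \<mu>) \<nu>"
      by (rule pairing_conv[OF \<mu> \<nu> slice_Cb[OF f u]])
    also have "\<dots> = pairing X (\<lambda>t. F ?g (t, u)) \<nu>"
    proof (rule pairing_cong)
      fix t assume t: "t \<in> topspace X"
      have "pairing X (\<lambda>s. F (\<lambda>x. F f (x, u)) (s, t)) \<mu> = pairing X (\<lambda>s. F (\<lambda>x. F f (s, x)) (t, u)) \<mu>"
        by (rule pairing_cong) (simp add: coassoc[OF f _ t u])
      also have "\<dots> = F ?g (t, u)" by (rule F_pairing_exchange[OF \<mu> F_Cb[OF f] t u, symmetric])
      finally show "pairing X (\<lambda>s. F (\<lambda>x. F f (x, u)) (s, t)) \<mu> = F ?g (t, u)" .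
    qed
    finally show "pairing X (\<lambda>x. F f (x, u)) (conv \<mu> \<nu>) = pairing X (\<lambda>t. F ?g (t, u)) \<nu>" .
  qed
  also have "\<dots> = pairing X f (conv \<mu> (conv \<nu> \<kappa>))"
    using assms f inner_Cb[OF \<mu> f] by (simp add: pairing_conv conv_Mb)
  finally show "pairing X f (conv (conv \<mu> \<nu>) \<kappa>) = pairing X f (conv \<mu> (conv \<nu> \<kappa>))" .
qed

lemma continuous_conv_dirac:
  "continuous_map (prod_topology X X) (weak_topology X) (\<lambda>(s, t). conv (dirac X s) (dirac X t))"
  unfolding weak_topology_def
proof (rule continuous_map_pullback')
  show "continuous_map (prod_topology X X) (product_topology (\<lambda>_. euclidean) (C0 X))
      ((\<lambda>\<mu>. \<lambda>f\<in>C0 X. pairing X f \<mu>) \<circ> (\<lambda>(s, t). conv (dirac X s) (dirac X t)))"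
    unfolding continuous_map_componentwise
  proof (intro conjI ballI)
    fix f assume f: "f \<in> C0 X"
    have "continuous_map (prod_topology X X) euclidean (F f)"
      using F_Cb[OF C0_subset_Cb[OF f]] by (simp add: Cb_def)
    then show "continuous_map (prod_topology X X) euclidean
        (\<lambda>p. ((\<lambda>\<mu>. \<lambda>f\<in>C0 X. pairing X f \<mu>) \<circ> (\<lambda>(s, t). conv (dirac X s) (dirac X t))) p f)"
      by (rule continuous_map_eq) (use f in \<open>auto simp: pairing_conv_dirac C0_subset_Cb\<close>)
  qed auto
  show "topspace (prod_topology X X) \<subseteq> (\<lambda>(s, t). conv (dirac X s) (dirac X t)) -` Mp X"
    by (auto intro: conv_dirac_Mp)
qed

text \<open>Of the two conditions defining a subbasic set, inclusion in \<open>W\<close> is open by upper semicontinuity; and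
  a support meeting \<open>V\<close> is detected by a bump function in \<open>V\<close> having nonzero comultiplication.\<close>

lemma continuous_support:
  "continuous_map (prod_topology X X) (michael_topology X)
    (\<lambda>(s, t). msupport X (conv (dirac X s) (dirac X t)))"
proof -
  have ne: "S s t \<noteq> {}" if st: "s \<in> topspace X" "t \<in> topspace X" for s t
    using F_zero_iff[OF Cb_const[of 1] _ st] F_one[OF st] by auto
  have meets: "openin (prod_topology X X) {p \<in> topspace (prod_topology X X). S (fst p) (snd p) \<inter> V \<noteq> {}}"
    if V: "openin X V" for V
  proof (subst openin_subopen, intro ballI)
    fix p assume "p \<in> {p \<in> topspace (prod_topology X X). S (fst p) (snd p) \<inter> V \<noteq> {}}"
    then obtain s t x where p: "p = (s, t)" "s \<in> topspace X" "t \<in> topspace X" "x \<in> S s t" "x \<in> V"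
      by (cases p) auto
    obtain f where f: "f \<in> Cb X" "\<And>y. y \<in> topspace X \<Longrightarrow> f y \<in> \<real>\<^sub>\<ge>\<^sub>0" "f x = 1"
      "\<And>y. y \<in> topspace X - V \<Longrightarrow> f y = 0"
      using Cb_bump[OF lc haus V p(5)] by metis
    have "continuous_map (prod_topology X X) euclidean (F f)" using F_Cb[OF f(1)] by (simp add: Cb_def)
    then have o: "openin (prod_topology X X) {q \<in> topspace (prod_topology X X). F f q \<in> - {0}}"
      by (rule openin_continuous_map_preimage) (simp add: open_Compl)
    have "F f p \<noteq> 0" using F_zero_iff[OF f(1,2) p(2,3)] p(1,4) f(3) by auto
    then have "p \<in> {q \<in> topspace (prod_topology X X). F f q \<in> - {0}}" using p by auto
    moreover have "{q \<in> topspace (prod_topology X X). F f q \<in> - {0}}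
        \<subseteq> {p \<in> topspace (prod_topology X X). S (fst p) (snd p) \<inter> V \<noteq> {}}"
    proof
      fix q assume "q \<in> {q \<in> topspace (prod_topology X X). F f q \<in> - {0}}"
      then obtain s' t' where q: "q = (s', t')" "s' \<in> topspace X" "t' \<in> topspace X" "F f (s', t') \<noteq> 0"
        by (cases q) auto
      then obtain y where "y \<in> S s' t'" "f y \<noteq> 0" using F_zero_iff[OF f(1,2) q(2,3)] by auto
      then have "y \<in> S s' t' \<inter> V" using f(4)[of y] S_subset[OF q(2,3)] by auto
      then show "q \<in> {p \<in> topspace (prod_topology X X). S (fst p) (snd p) \<inter> V \<noteq> {}}" using q by auto
    qed
    ultimately show "\<exists>T. openin (prod_topology X X) T \<and> p \<in> T \<and>
        T \<subseteq> {p \<in> topspace (prod_topology X X). S (fst p) (snd p) \<inter> V \<noteq> {}}"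
      using o by blast
  qed
  let ?\<phi> = "\<lambda>(s, t). msupport X (conv (dirac X s) (dirac X t))"
  let ?B = "{{F. compactin X F \<and> F \<noteq> {} \<and> F \<subseteq> W \<and> F \<inter> V \<noteq> {}} | V W. openin X V \<and> openin X W}"
  have pre: "?\<phi> -` {F. compactin X F \<and> F \<noteq> {} \<and> F \<subseteq> W \<and> F \<inter> V \<noteq> {}} \<inter> topspace (prod_topology X X) =
      {p \<in> topspace (prod_topology X X). S (fst p) (snd p) \<subseteq> W} \<inter>
      {p \<in> topspace (prod_topology X X). S (fst p) (snd p) \<inter> V \<noteq> {}}" for V W
    using ne S_compact by (auto simp: msupport_conv_dirac)
  show ?thesis
    unfolding michael_topology_def
  proof (rule continuous_on_generated_topo)
    fix U assume "U \<in> ?B"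
    then obtain V W where U: "U = {F. compactin X F \<and> F \<noteq> {} \<and> F \<subseteq> W \<and> F \<inter> V \<noteq> {}}" "openin X V" "openin X W"
      by blast
    show "openin (prod_topology X X) (?\<phi> -` U \<inter> topspace (prod_topology X X))"
      unfolding U(1) pre using S_upper[OF U(3)] meets[OF U(2)] by (rule openin_Int)
  next
    show "?\<phi> ` topspace (prod_topology X X) \<subseteq> \<Union> ?B"
    proof
      fix K assume "K \<in> ?\<phi> ` topspace (prod_topology X X)"
      then obtain s t where "s \<in> topspace X" "t \<in> topspace X" "K = S s t"
        by (auto simp: msupport_conv_dirac)
      then have "K \<in> {F. compactin X F \<and> F \<noteq> {} \<and> F \<subseteq> topspace X \<and> F \<inter> topspace X \<noteq> {}}"
        using ne[of s t] S_compact[of s t] S_subset[of s t] by (simp add: Int_absorb2)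
      then show "K \<in> \<Union> ?B" using openin_topspace[of X] by blast
    qed
  qed
qed

theorem hypergroup_conv: "hypergroup X conv e invol"
proof
  show "locally_compact_space X" "Hausdorff_space X" by (rule lc, rule haus)
  show "conv \<mu> \<nu> \<in> Mb X" if "\<mu> \<in> Mb X" "\<nu> \<in> Mb X" for \<mu> \<nu> using that by (rule conv_Mb)
  show "pairing X f (conv \<mu> \<nu>) = pairing X (\<lambda>t. pairing X (\<lambda>s. pairing X f (conv (dirac X s) (dirac X t))) \<mu>) \<nu>"
    if "\<mu> \<in> Mb X" "\<nu> \<in> Mb X" "f \<in> Cb X" for \<mu> \<nu> f
  proof -
    have "pairing X (\<lambda>t. pairing X (\<lambda>s. pairing X f (conv (dirac X s) (dirac X t))) \<mu>) \<nu> =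
        pairing X (\<lambda>t. pairing X (\<lambda>s. F f (s, t)) \<mu>) \<nu>"
      using that(3) by (intro pairing_cong) (simp add: pairing_conv_dirac)
    then show ?thesis using pairing_conv[OF that] by simp
  qed
  show "(\<lambda>A. 0) \<in> Mb X" by (rule Mb_zero[OF haus])
  show "(\<lambda>A. \<mu> A + \<nu> A) \<in> Mb X" if "\<mu> \<in> Mb X" "\<nu> \<in> Mb X" for \<mu> \<nu> using that by (rule Mb_add[OF haus])
  show "(\<lambda>A. c * \<mu> A) \<in> Mb X" if "\<mu> \<in> Mb X" for c \<mu> using that by (rule Mb_scale[OF haus])
  show "conv (conv \<mu> \<nu>) \<kappa> = conv \<mu> (conv \<nu> \<kappa>)" if "\<mu> \<in> Mb X" "\<nu> \<in> Mb X" "\<kappa> \<in> Mb X" for \<mu> \<nu> \<kappa>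
    using that by (rule conv_assoc)
  show "conv (dirac X s) (dirac X t) \<in> Mp X \<and> compactin X (msupport X (conv (dirac X s) (dirac X t)))"
    if "s \<in> topspace X" "t \<in> topspace X" for s t
    using that by (simp add: conv_dirac_Mp msupport_conv_dirac S_compact)
  show "continuous_map (prod_topology X X) (weak_topology X) (\<lambda>(s, t). conv (dirac X s) (dirac X t))"
    by (rule continuous_conv_dirac)
  show "continuous_map (prod_topology X X) (michael_topology X)
      (\<lambda>(s, t). msupport X (conv (dirac X s) (dirac X t)))"
    by (rule continuous_support)
  show "e \<in> topspace X" by (rule e_topspace)
  show "conv (dirac X e) (dirac X s) = dirac X s" "conv (dirac X s) (dirac X e) = dirac X s"
    if s: "s \<in> topspace X" for s
  proof -
    note d = dirac_Mb[OF haus s] dirac_Mb[OF haus e_topspace]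
    show "conv (dirac X e) (dirac X s) = dirac X s"
      using s d by (intro Mb_eqI[OF creg haus] conv_Mb)
        (simp_all add: pairing_conv_dirac e_topspace F_unit pairing_dirac[OF haus])
    show "conv (dirac X s) (dirac X e) = dirac X s"
      using s d by (intro Mb_eqI[OF creg haus] conv_Mb)
        (simp_all add: pairing_conv_dirac e_topspace F_unit pairing_dirac[OF haus])
  qed
  show "homeomorphic_map X X invol" by (rule invol_homeo)
  show "invol (invol s) = s" if "s \<in> topspace X" for s using that by (rule invol_invol)
  show "pairing X (f \<circ> invol) (conv (dirac X s) (dirac X t)) =
      pairing X f (conv (dirac X (invol t)) (dirac X (invol s)))"
    if st: "s \<in> topspace X" "t \<in> topspace X" and f: "f \<in> Cb X" for s t f
  proof -
    have ic: "continuous_map X X invol" by (rule homeomorphic_imp_continuous_map[OF invol_homeo])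
    then have im: "invol ` topspace X \<subseteq> topspace X" by (rule continuous_map_image_subset_topspace)
    have "bounded (f ` topspace X)" using f by (simp add: Cb_def)
    then have "bounded ((f \<circ> invol) ` topspace X)"
      by (rule bounded_subset) (use im in auto)
    then have "f \<circ> invol \<in> Cb X"
      using f continuous_map_compose[OF ic] by (auto simp: Cb_def)
    moreover have "invol s \<in> topspace X" "invol t \<in> topspace X" using im st by auto
    ultimately show ?thesis using st f by (simp add: pairing_conv_dirac F_invol)
  qed
  show "e \<in> msupport X (conv (dirac X s) (dirac X t)) \<longleftrightarrow> s = invol t"
    if "s \<in> topspace X" "t \<in> topspace X" for s t
    using that by (simp add: msupport_conv_dirac e_in_S)
qed (rule conv_bilinear; assumption)+

end

section \<open>Conditional expectations act fibrewise\<close>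

lemma compact_closed_subset: "compact K \<Longrightarrow> closed C \<Longrightarrow> C \<subseteq> K \<Longrightarrow> compact C"
  using compact_Int_closed[of K C] by (simp add: inf.absorb2)

lemma Cb_euclidean_iff: "f \<in> Cb euclidean \<longleftrightarrow> f \<in> bcontfun"
  unfolding Cb_def bcontfun_def by (simp add: continuous_map_iff_continuous2)

lemma apply_Bcontfun: "f \<in> Cb euclidean \<Longrightarrow> apply_bcontfun (Bcontfun f) = f"
  by (simp add: Cb_euclidean_iff Bcontfun_inverse)

lemma apply_bcontfun_Cb: "apply_bcontfun x \<in> Cb euclidean"
  unfolding Cb_euclidean_iff by (rule apply_bcontfun)

lemma Cb_mult:
  fixes f g :: "'a::topological_space \<Rightarrow> complex"
  assumes f: "f \<in> Cb euclidean" and g: "g \<in> Cb euclidean"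
  shows "(\<lambda>x. f x * g x) \<in> Cb euclidean"
  using apply_bcontfun_Cb[of "bc_mult (Bcontfun f) (Bcontfun g)"]
  by (simp add: bc_mult.rep_eq apply_Bcontfun[OF f] apply_Bcontfun[OF g])

lemma Cb_euclideanI:
  fixes f :: "'a::topological_space \<Rightarrow> complex"
  shows "continuous_on UNIV f \<Longrightarrow> (\<And>x. cmod (f x) \<le> c) \<Longrightarrow> f \<in> Cb euclidean"
  unfolding Cb_euclidean_iff by (rule bcontfun_normI)

lemma Cb_euclideanD:
  fixes f :: "'a::topological_space \<Rightarrow> complex"
  assumes "f \<in> Cb euclidean"
  shows "continuous_on UNIV f" "\<exists>c>0. \<forall>x. cmod (f x) \<le> c"
  using assms unfolding Cb_def by (auto simp: continuous_map_iff_continuous2 bounded_pos)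

lemma Cb_real:
  fixes g :: "'a::topological_space \<Rightarrow> real"
  shows "continuous_on UNIV g \<Longrightarrow> (\<And>x. \<bar>g x\<bar> \<le> c) \<Longrightarrow> (\<lambda>x. complex_of_real (g x)) \<in> Cb euclidean"
  by (rule Cb_euclideanI[where c = c]) (auto intro!: continuous_intros)

lemma C0_euclidean_iff:
  "f \<in> C0 (euclidean :: 'a::topological_space topology) \<longleftrightarrow>
    continuous_on UNIV f \<and> (\<forall>r>0. compact {x. r \<le> cmod (f x)})"
  unfolding C0_def by (simp add: continuous_map_iff_continuous2)

lemma Kc_euclidean_iff:
  "f \<in> Kc (euclidean :: 'a::t2_space topology) \<longleftrightarrow>
    continuous_on UNIV f \<and> (\<exists>K. compact K \<and> (\<forall>x. x \<notin> K \<longrightarrow> f x = 0))"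
proof -
  have "compact (closure {x. f x \<noteq> 0}) \<longleftrightarrow> (\<exists>K. compact K \<and> (\<forall>x. x \<notin> K \<longrightarrow> f x = 0))"
  proof
    assume "compact (closure {x. f x \<noteq> 0})"
    then show "\<exists>K. compact K \<and> (\<forall>x. x \<notin> K \<longrightarrow> f x = 0)"
      using closure_subset[of "{x. f x \<noteq> 0}"] by blast
  next
    assume "\<exists>K. compact K \<and> (\<forall>x. x \<notin> K \<longrightarrow> f x = 0)"
    then obtain K where K: "compact K" "\<And>x. x \<notin> K \<Longrightarrow> f x = 0" by blast
    have "closure {x. f x \<noteq> 0} \<subseteq> K"
      using K by (intro closure_minimal compact_imp_closed) auto
    then show "compact (closure {x. f x \<noteq> 0})"
      by (rule compact_closed_subset[OF K(1) closed_closure])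
  qed
  then show ?thesis
    unfolding Kc_def by (simp add: continuous_map_iff_continuous2)
qed

lemma Kc_plus_euclidean_iff:
  "f \<in> Kc_plus (euclidean :: 'a::t2_space topology) \<longleftrightarrow>
    f \<in> Kc euclidean \<and> (\<forall>x. f x \<in> \<real>\<^sub>\<ge>\<^sub>0)"
  unfolding Kc_plus_def by simp

lemma continuous_superlevel_closed:
  fixes f :: "'a::topological_space \<Rightarrow> complex"
  assumes "continuous_on UNIV f"
  shows "closed {x. r \<le> cmod (f x)}"
  using assms by (intro closed_Collect_le continuous_intros)

lemma Kc_subset_C0:
  assumes "f \<in> Kc X"
  shows "f \<in> C0 X"
proof -
  have f: "continuous_map X euclidean f" and K: "compactin X (X closure_of {x \<in> topspace X. f x \<noteq> 0})"
    using assms unfolding Kc_def by auto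
  have "compactin X {x \<in> topspace X. r \<le> cmod (f x)}" if "r > 0" for r
  proof (rule closed_compactin[OF K])
    have "closedin X {x \<in> topspace X. f x \<in> {z. r \<le> cmod z}}"
      by (rule closedin_continuous_map_preimage[OF f]) (simp add: closed_Collect_le continuous_intros)
    then show "closedin X {x \<in> topspace X. r \<le> cmod (f x)}" by simp
    show "{x \<in> topspace X. r \<le> cmod (f x)} \<subseteq> X closure_of {x \<in> topspace X. f x \<noteq> 0}"
      using that by (intro order_trans[OF _ closure_of_subset]) auto
  qed
  then show ?thesis using f by (simp add: C0_def)
qed

lemma C0_add:
  fixes f g :: "'a::t2_space \<Rightarrow> complex"
  assumes f: "f \<in> C0 euclidean" and g: "g \<in> C0 euclidean"
  shows "(\<lambda>x. f x + g x) \<in> C0 euclidean"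
proof -
  have cont: "continuous_on UNIV (\<lambda>x. f x + g x)"
    using f g by (auto simp: C0_euclidean_iff intro!: continuous_intros)
  have "compact {x. r \<le> cmod (f x + g x)}" if r: "r > 0" for r
  proof -
    have "compact ({x. r/2 \<le> cmod (f x)} \<union> {x. r/2 \<le> cmod (g x)})"
      using f g half_gt_zero[OF r] unfolding C0_euclidean_iff by blast
    moreover have "{x. r \<le> cmod (f x + g x)} \<subseteq> {x. r/2 \<le> cmod (f x)} \<union> {x. r/2 \<le> cmod (g x)}"
    proof
      fix x assume "x \<in> {x. r \<le> cmod (f x + g x)}"
      then have "r \<le> cmod (f x) + cmod (g x)" using norm_triangle_ineq[of "f x" "g x"] by simp
      then show "x \<in> {x. r/2 \<le> cmod (f x)} \<union> {x. r/2 \<le> cmod (g x)}" by auto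
    qed
    ultimately show ?thesis
      by (intro compact_closed_subset[OF _ continuous_superlevel_closed[OF cont]])
  qed
  with cont show ?thesis by (simp add: C0_euclidean_iff)
qed

lemma C0_mult_Cb:
  fixes f g :: "'a::t2_space \<Rightarrow> complex"
  assumes f: "f \<in> C0 euclidean" and g: "g \<in> Cb euclidean"
  shows "(\<lambda>x. g x * f x) \<in> C0 euclidean"
proof -
  obtain c where c: "c > 0" "\<And>x. cmod (g x) \<le> c" using Cb_euclideanD(2)[OF g] by blast
  have cont: "continuous_on UNIV (\<lambda>x. g x * f x)"
    using f Cb_euclideanD(1)[OF g] by (auto simp: C0_euclidean_iff intro!: continuous_intros)
  have "compact {x. r \<le> cmod (g x * f x)}" if r: "r > 0" for r
  proof -
    have "compact {x. r / c \<le> cmod (f x)}" using f r c by (simp add: C0_euclidean_iff)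
    moreover have "{x. r \<le> cmod (g x * f x)} \<subseteq> {x. r / c \<le> cmod (f x)}"
    proof
      fix x assume "x \<in> {x. r \<le> cmod (g x * f x)}"
      then have "r \<le> cmod (g x) * cmod (f x)" by (simp add: norm_mult)
      also have "\<dots> \<le> c * cmod (f x)" using c(2) by (intro mult_right_mono) auto
      finally show "x \<in> {x. r / c \<le> cmod (f x)}" using c by (simp add: field_simps)
    qed
    ultimately show ?thesis
      by (intro compact_closed_subset[OF _ continuous_superlevel_closed[OF cont]])
  qed
  with cont show ?thesis by (simp add: C0_euclidean_iff)
qed

lemma Hausdorff_space_t2: "Hausdorff_space (euclidean :: 'a::t2_space topology)"
  unfolding Hausdorff_space_def disjnt_def using hausdorff by auto

locale expectation =
  fixes P :: "('g::t2_space \<Rightarrow>\<^sub>C complex) \<Rightarrow> ('g \<Rightarrow>\<^sub>C complex)"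
  assumes loc_compact: "locally_compact_space (euclidean :: 'g topology)"
    and P: "cond_expectation (range P) P"
    and P_Kc_plus: "apply_bcontfun f \<in> Kc_plus euclidean \<Longrightarrow> apply_bcontfun (P f) \<in> Kc_plus euclidean"
    and P_faithful: "\<lbrakk>apply_bcontfun f \<in> Kc_plus euclidean; Re (apply_bcontfun f p) > 0\<rbrakk> \<Longrightarrow>
      Re (can P p (P f)) > 0"
begin

lemma ex_Kc_plus:
  obtains f :: "'g \<Rightarrow> complex" where "f \<in> Cb euclidean" "f \<in> Kc_plus euclidean" "f p = 1"
proof -
  obtain U K where UK: "open U" "compact K" "p \<in> U" "U \<subseteq> K"
    using loc_compact[unfolded locally_compact_space_def, rule_format, of p] by auto
  obtain f :: "'g \<Rightarrow> complex" where f: "f \<in> Cb euclidean" "\<And>x. x \<in> topspace euclidean \<Longrightarrow> f x \<in> \<real>\<^sub>\<ge>\<^sub>0" "f p = 1"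
    "\<And>x. x \<in> topspace euclidean - U \<Longrightarrow> f x = 0"
    using Cb_bump[OF loc_compact Hausdorff_space_t2, of U p] UK by auto
  have "f x = 0" if "x \<notin> K" for x using f(4)[of x] that UK(4) by auto
  then have "f \<in> Kc_plus euclidean"
    unfolding Kc_plus_euclidean_iff Kc_euclidean_iff
    using Cb_euclideanD(1)[OF f(1)] f(2) UK(2) by auto
  then show thesis using f(1,3) that by blast
qed

text \<open>The value of \<open>P f\<close> at \<open>p\<close> for a plain function \<open>f\<close>; meaningful for bounded continuous \<open>f\<close>.\<close>

definition E :: "'g \<Rightarrow> ('g \<Rightarrow> complex) \<Rightarrow> complex" where
  "E p f = apply_bcontfun (P (Bcontfun f)) p"

lemma P_linear: "bounded_linear P" and P_idem: "P (P x) = P x"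
  and P_scale: "P (bc_scale c x) = bc_scale c (P x)"
  and P_subalgebra: "cstar_subalgebra (range P)"
  and P_pos: "bc_le 0 (P (bc_mult (bc_cnj x) x))"
  and P_bimodule: "P (bc_mult (bc_mult (P y) x) (P z)) = bc_mult (bc_mult (P y) (P x)) (P z)"
  using P unfolding cond_expectation_def by auto

lemma E_Cb: "(\<lambda>p. E p f) \<in> Cb euclidean"
  unfolding E_def by (rule apply_bcontfun_Cb)

lemma E_apply: "E p (apply_bcontfun x) = apply_bcontfun (P x) p"
  unfolding E_def by (simp add: apply_bcontfun_inverse)

lemma E_add: "f \<in> Cb euclidean \<Longrightarrow> g \<in> Cb euclidean \<Longrightarrow> E p (\<lambda>x. f x + g x) = E p f + E p g"
proof -
  assume f: "f \<in> Cb euclidean" and g: "g \<in> Cb euclidean"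
  have "(\<lambda>x. f x + g x) = apply_bcontfun (Bcontfun f + Bcontfun g)"
    by (simp add: fun_eq_iff apply_Bcontfun f g)
  then have "E p (\<lambda>x. f x + g x) = apply_bcontfun (P (Bcontfun f + Bcontfun g)) p"
    by (simp only: E_apply)
  then show ?thesis
    by (simp add: E_def linear_add[OF bounded_linear.linear[OF P_linear]])
qed

lemma E_scale: "f \<in> Cb euclidean \<Longrightarrow> E p (\<lambda>x. c * f x) = c * E p f"
proof -
  assume f: "f \<in> Cb euclidean"
  have "(\<lambda>x. c * f x) = apply_bcontfun (bc_scale c (Bcontfun f))"
    by (simp add: fun_eq_iff apply_Bcontfun f bc_scale.rep_eq)
  then have "E p (\<lambda>x. c * f x) = apply_bcontfun (P (bc_scale c (Bcontfun f))) p"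
    by (simp add: E_apply)
  then show ?thesis by (simp add: E_def P_scale bc_scale.rep_eq)
qed

text \<open>Positive functions have the form \<open>h\<^sup>* h\<close> with \<open>h\<close> the square root.\<close>

lemma E_pos:
  assumes f: "f \<in> Cb euclidean" and pos: "\<And>x. f x \<in> \<real>\<^sub>\<ge>\<^sub>0"
  shows "E p f \<in> \<real>\<^sub>\<ge>\<^sub>0"
proof -
  define h where "h x = complex_of_real (sqrt (Re (f x)))" for x
  obtain c where c: "\<And>x. cmod (f x) \<le> c" using Cb_euclideanD(2)[OF f] by blast
  have h: "h \<in> Cb euclidean"
    unfolding h_def
  proof (rule Cb_real[where c = "sqrt c"])
    show "continuous_on UNIV (\<lambda>x. sqrt (Re (f x)))"
      using Cb_euclideanD(1)[OF f] by (intro continuous_intros)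
    show "\<bar>sqrt (Re (f x))\<bar> \<le> sqrt c" for x
      using pos[of x] order_trans[OF complex_Re_le_cmod c, of x] by (auto simp: nonneg_Reals_iff)
  qed
  have "f x = cnj (h x) * h x" for x
    using pos[of x] by (auto simp: h_def nonneg_Reals_iff simp flip: of_real_mult)
  then have "f = apply_bcontfun (bc_mult (bc_cnj (Bcontfun h)) (Bcontfun h))"
    by (simp add: fun_eq_iff apply_Bcontfun h bc_mult.rep_eq bc_cnj.rep_eq)
  then have "E p f = apply_bcontfun (P (bc_mult (bc_cnj (Bcontfun h)) (Bcontfun h))) p"
    by (simp add: E_apply)
  then show ?thesis using P_pos[of "Bcontfun h"] by (simp add: bc_le_def)
qed

text \<open>The range of \<open>P\<close>, in terms of plain functions.\<close>

definition rangeP :: "('g \<Rightarrow> complex) set" where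
  "rangeP = {d \<in> Cb euclidean. \<forall>p. E p d = d p}"

lemma rangeP_iff: "d \<in> rangeP \<longleftrightarrow> (\<exists>x. d = apply_bcontfun (P x))"
proof
  assume "d \<in> rangeP"
  then have "d = apply_bcontfun (P (Bcontfun d))" by (simp add: rangeP_def E_def fun_eq_iff)
  then show "\<exists>x. d = apply_bcontfun (P x)" ..
next
  assume "\<exists>x. d = apply_bcontfun (P x)"
  then show "d \<in> rangeP" by (auto simp: rangeP_def E_apply P_idem apply_bcontfun_Cb)
qed

lemma rangeP_Cb: "d \<in> rangeP \<Longrightarrow> d \<in> Cb euclidean" and rangeP_E: "d \<in> rangeP \<Longrightarrow> E p d = d p"
  by (auto simp: rangeP_def)

lemma E_rangeP: "(\<lambda>p. E p f) \<in> rangeP"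
  unfolding E_def rangeP_iff by blast

lemma rangeP_add: "d \<in> rangeP \<Longrightarrow> d' \<in> rangeP \<Longrightarrow> (\<lambda>x. d x + d' x) \<in> rangeP"
  by (simp add: rangeP_def Cb_add E_add)

lemma rangeP_scale: "d \<in> rangeP \<Longrightarrow> (\<lambda>x. c * d x) \<in> rangeP"
  by (simp add: rangeP_def Cb_scale E_scale)

lemma rangeP_mult: "d \<in> rangeP \<Longrightarrow> d' \<in> rangeP \<Longrightarrow> (\<lambda>x. d x * d' x) \<in> rangeP"
proof -
  assume "d \<in> rangeP" "d' \<in> rangeP"
  then obtain x y where xy: "d = apply_bcontfun (P x)" "d' = apply_bcontfun (P y)"
    unfolding rangeP_iff by blast
  have "bc_mult (P x) (P y) \<in> range P"
    using P_subalgebra unfolding cstar_subalgebra_def by blast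
  then obtain z where "P z = bc_mult (P x) (P y)" by (metis rangeE)
  then show ?thesis
    unfolding rangeP_iff xy by (intro exI[of _ z]) (simp add: bc_mult.rep_eq)
qed

lemma rangeP_cnj: "d \<in> rangeP \<Longrightarrow> (\<lambda>x. cnj (d x)) \<in> rangeP"
proof -
  assume "d \<in> rangeP"
  then obtain x where x: "d = apply_bcontfun (P x)" unfolding rangeP_iff by blast
  have "bc_cnj (P x) \<in> range P"
    using P_subalgebra unfolding cstar_subalgebra_def by blast
  then obtain z where "P z = bc_cnj (P x)" by (metis rangeE)
  then show ?thesis
    unfolding rangeP_iff x by (intro exI[of _ z]) (simp add: bc_cnj.rep_eq)
qed

lemma E_bimodule:
  assumes d: "d \<in> rangeP" and f: "f \<in> Cb euclidean" and d': "d' \<in> rangeP"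
  shows "E p (\<lambda>x. d x * f x * d' x) = d p * E p f * d' p"
proof -
  obtain y z where yz: "d = apply_bcontfun (P y)" "d' = apply_bcontfun (P z)"
    using d d' unfolding rangeP_iff by blast
  have "(\<lambda>x. d x * f x * d' x) = apply_bcontfun (bc_mult (bc_mult (P y) (Bcontfun f)) (P z))"
    by (simp add: yz bc_mult.rep_eq fun_eq_iff apply_Bcontfun f)
  then have "E p (\<lambda>x. d x * f x * d' x) = apply_bcontfun (P (bc_mult (bc_mult (P y) (Bcontfun f)) (P z))) p"
    by (simp add: E_apply)
  then show ?thesis by (simp add: P_bimodule bc_mult.rep_eq E_def yz)
qed

lemma E_Kc_plus: "f \<in> Cb euclidean \<Longrightarrow> f \<in> Kc_plus euclidean \<Longrightarrow> (\<lambda>p. E p f) \<in> Kc_plus euclidean"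
  unfolding E_def using P_Kc_plus[of "Bcontfun f"] by (simp add: apply_Bcontfun)

lemma E_faithful:
  assumes f: "f \<in> Cb euclidean" "f \<in> Kc_plus euclidean" and p: "f p \<noteq> 0"
  shows "Re (E p f) > 0"
proof -
  have "apply_bcontfun (Bcontfun f) \<in> C0 euclidean"
    using f Kc_subset_C0[of f] by (simp add: apply_Bcontfun Kc_plus_euclidean_iff)
  then have B: "P (Bcontfun f) \<in> algB P" unfolding algB_def by blast
  have "Re (f p) > 0"
    using f(2) p unfolding Kc_plus_euclidean_iff nonneg_Reals_iff
    by (metis Re_complex_of_real less_eq_real_def of_real_0)
  then have "Re (can P p (P (Bcontfun f))) > 0"
    using f by (intro P_faithful) (simp_all add: apply_Bcontfun)
  then show ?thesis using B by (simp add: can_def E_def)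
qed

text \<open>Averages of bumps supply, near every point, a compactly supported element of the range.\<close>

lemma ex_rangeP_Kc_plus:
  obtains b where "b \<in> rangeP" "b \<in> Kc_plus euclidean" "Re (b p) > 0"
proof -
  obtain f where f: "f \<in> Cb euclidean" "f \<in> Kc_plus euclidean" "f p = 1" by (rule ex_Kc_plus)
  show thesis
    by (rule that[OF E_rangeP E_Kc_plus[OF f(1,2)] E_faithful[OF f(1,2)]]) (simp add: f(3))
qed

text \<open>The range is unital: \<open>P 1\<close> is a unit of the range, and the range vanishes nowhere.\<close>

lemma E_one: "E p (\<lambda>x. 1) = 1"
proof -
  obtain b where b: "b \<in> rangeP" "Re (b p) > 0" by (rule ex_rangeP_Kc_plus)
  have "b p * b p = E p (\<lambda>x. b x * b x)" using rangeP_E[OF rangeP_mult[OF b(1) b(1)]] by simp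
  also have "\<dots> = b p * E p (\<lambda>x. 1) * b p"
    using E_bimodule[OF b(1) Cb_const[of 1] b(1)] by simp
  finally show ?thesis using b(2) by auto
qed

sublocale E: state euclidean "E p" for p
  by unfold_locales (auto intro: E_add E_scale E_pos E_one)

lemma rangeP_const: "(\<lambda>x. c) \<in> rangeP"
  by (simp add: rangeP_def Cb_const E.const)

lemma E_mult: "d \<in> rangeP \<Longrightarrow> f \<in> Cb euclidean \<Longrightarrow> E p (\<lambda>x. d x * f x) = d p * E p f"
  using E_bimodule[of d f "\<lambda>x. 1" p] rangeP_const[of 1] by simp

lemma rangeP_diff: "d \<in> rangeP \<Longrightarrow> d' \<in> rangeP \<Longrightarrow> (\<lambda>x. d x - d' x) \<in> rangeP"
  using rangeP_add[of d "\<lambda>x. (-1) * d' x"] rangeP_scale[of d' "-1"] by simp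

lemma rangeP_sum: "finite I \<Longrightarrow> (\<And>i. i \<in> I \<Longrightarrow> d i \<in> rangeP) \<Longrightarrow> (\<lambda>x. \<Sum>i\<in>I. d i x) \<in> rangeP"
  by (induction I rule: finite_induct) (auto intro: rangeP_const rangeP_add)

lemma E_mono:
  assumes "continuous_on UNIV f" "\<And>x. \<bar>f x\<bar> \<le> c" "continuous_on UNIV g" "\<And>x. \<bar>g x\<bar> \<le> c'"
    and "\<And>x. f x \<le> g x"
  shows "Re (E p (\<lambda>x. complex_of_real (f x))) \<le> Re (E p (\<lambda>x. complex_of_real (g x)))"
  using assms by (intro E.mono) (auto simp: continuous_map_iff_continuous2 intro!: boundedI)

lemma E_norm_le: "f \<in> Cb euclidean \<Longrightarrow> cmod (E p f) \<le> Re (E p (\<lambda>x. complex_of_real (cmod (f x))))"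
  by (rule E.norm_le)

lemma E_norm_le_const:
  assumes f: "f \<in> Cb euclidean" and c: "\<And>x. cmod (f x) \<le> c"
  shows "cmod (E p f) \<le> c"
proof -
  have "Re (E p (\<lambda>x. complex_of_real (cmod (f x)))) \<le> Re (E p (\<lambda>x. complex_of_real c))"
    using Cb_euclideanD(1)[OF f] c by (intro E_mono[where c = c and c' = "\<bar>c\<bar>"] continuous_intros) auto
  then show ?thesis using E_norm_le[OF f, of p] E.const[of p "complex_of_real c"] by simp
qed

text \<open>Positivity dominates \<open>P f\<close> by \<open>P \<bar>f\<bar>\<close>, which settles compact supports; the general case is a uniform
  limit.\<close>

lemma E_C0:
  assumes f: "f \<in> C0 euclidean"
  shows "(\<lambda>p. E p f) \<in> C0 euclidean"
proof -
  have fCb: "f \<in> Cb euclidean" by (rule C0_subset_Cb[OF f])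
  have fc: "continuous_on UNIV f" by (rule Cb_euclideanD(1)[OF fCb])
  have Ec: "continuous_on UNIV (\<lambda>p. E p f)" by (rule Cb_euclideanD(1)[OF E_Cb])
  have "compact {p. r \<le> cmod (E p f)}" if r: "r > 0" for r
  proof -
    \<comment> \<open>Subtracting the nearest point of a small disc makes \<open>f\<close> compactly supported.\<close>
    define cut where "cut x = closest_point (cball 0 (r/2)) (f x)" for x
    define k where "k x = cmod (f x - cut x)" for x
    have cutc: "continuous_on UNIV cut"
      unfolding cut_def using r
    by (intro continuous_on_compose2[OF continuous_on_closest_point[where t = UNIV] fc]) auto
    have cut_in: "cut x \<in> cball 0 (r/2)" for x
      unfolding cut_def using r by (intro closest_point_in_set) auto
    have cut: "cmod (cut x) \<le> r/2" for x using cut_in[of x] by simp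
    have cutCb: "cut \<in> Cb euclidean" by (rule Cb_euclideanI[OF cutc cut])
    have diffCb: "(\<lambda>x. f x - cut x) \<in> Cb euclidean" by (rule Cb_diff[OF fCb cutCb])
    obtain c where c: "\<And>x. cmod (f x - cut x) \<le> c" using Cb_euclideanD(2)[OF diffCb] by blast
    have kCb: "(\<lambda>x. complex_of_real (k x)) \<in> Cb euclidean"
      unfolding k_def using c fc cutc by (intro Cb_real[where c = c] continuous_intros) auto
    have "k x = 0" if "x \<notin> {x. r/2 \<le> cmod (f x)}" for x
      using that unfolding k_def cut_def by (subst closest_point_self) auto
    moreover have "compact {x. r/2 \<le> cmod (f x)}"
      using f half_gt_zero[OF r] unfolding C0_euclidean_iff by blast
    ultimately have "(\<lambda>x. complex_of_real (k x)) \<in> Kc_plus euclidean"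
      unfolding Kc_plus_euclidean_iff Kc_euclidean_iff
      using Cb_euclideanD(1)[OF kCb] by (auto simp: k_def)
    then have "(\<lambda>p. E p (\<lambda>x. complex_of_real (k x))) \<in> C0 euclidean"
      using E_Kc_plus[OF kCb] by (intro Kc_subset_C0) (simp add: Kc_plus_euclidean_iff)
    then have "compact {p. r/2 \<le> cmod (E p (\<lambda>x. complex_of_real (k x)))}"
      using half_gt_zero[OF r] unfolding C0_euclidean_iff by blast
    moreover have "{p. r \<le> cmod (E p f)} \<subseteq> {p. r/2 \<le> cmod (E p (\<lambda>x. complex_of_real (k x)))}"
    proof
      fix p assume "p \<in> {p. r \<le> cmod (E p f)}"
      then have "r \<le> cmod (E p f)" by simp
      also have "E p f = E p (\<lambda>x. f x - cut x) + E p cut"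
        using E.diff[OF fCb cutCb] by simp
      also have "cmod \<dots> \<le> cmod (E p (\<lambda>x. f x - cut x)) + r/2"
        using norm_triangle_ineq[of "E p (\<lambda>x. f x - cut x)" "E p cut"] E_norm_le_const[OF cutCb cut, of p] by simp
      also have "cmod (E p (\<lambda>x. f x - cut x)) \<le> cmod (E p (\<lambda>x. complex_of_real (k x)))"
        using E_norm_le[OF diffCb, of p] complex_Re_le_cmod unfolding k_def by (rule order_trans)
      finally show "p \<in> {p. r/2 \<le> cmod (E p (\<lambda>x. complex_of_real (k x)))}" by simp
    qed
    ultimately show ?thesis
      by (intro compact_closed_subset[OF _ continuous_superlevel_closed[OF Ec]])
  qed
  then show ?thesis using Ec by (simp add: C0_euclidean_iff)
qed

lemma algB_iff: "b \<in> algB P \<longleftrightarrow> apply_bcontfun b \<in> rangeP \<and> apply_bcontfun b \<in> C0 euclidean"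
proof
  assume "b \<in> algB P"
  then obtain x where "b = P x" "apply_bcontfun x \<in> C0 euclidean" unfolding algB_def by auto
  then show "apply_bcontfun b \<in> rangeP \<and> apply_bcontfun b \<in> C0 euclidean"
    using E_C0[of "apply_bcontfun x"] by (auto simp: rangeP_iff E_apply)
next
  assume b: "apply_bcontfun b \<in> rangeP \<and> apply_bcontfun b \<in> C0 euclidean"
  then have "P b = b" by (intro bcontfun_eqI) (metis rangeP_E E_apply)
  then show "b \<in> algB P" unfolding algB_def using b by (metis (mono_tags, lifting) image_eqI mem_Collect_eq)
qed

lemma algB_Bcontfun: "d \<in> rangeP \<Longrightarrow> d \<in> C0 euclidean \<Longrightarrow> Bcontfun d \<in> algB P"
  by (simp add: algB_iff apply_Bcontfun rangeP_Cb)

lemma can_eq_iff: "can P p = can P q \<longleftrightarrow> (\<forall>b\<in>algB P. apply_bcontfun b p = apply_bcontfun b q)"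
proof
  assume eq: "can P p = can P q"
  show "\<forall>b\<in>algB P. apply_bcontfun b p = apply_bcontfun b q"
  proof
    fix b assume "b \<in> algB P"
    then show "apply_bcontfun b p = apply_bcontfun b q"
      using fun_cong[OF eq, of b] by (simp add: can_def)
  qed
qed (auto simp: can_def fun_eq_iff)

text \<open>Fibres are defined by the values of functions in \<open>B\<close> only; but \<open>d b\<close> is in \<open>B\<close> whenever \<open>b\<close> is.\<close>

lemma rangeP_fib:
  assumes d: "d \<in> rangeP" and eq: "can P p = can P q"
  shows "d p = d q"
proof -
  obtain b where b: "b \<in> rangeP" "b \<in> Kc_plus euclidean" "Re (b p) > 0" by (rule ex_rangeP_Kc_plus)
  have bC: "b \<in> C0 euclidean" using b(2) by (simp add: Kc_plus_euclidean_iff Kc_subset_C0)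
  have 1: "b p = b q"
    using eq algB_Bcontfun[OF b(1) bC] rangeP_Cb[OF b(1)] unfolding can_eq_iff by (metis apply_Bcontfun)
  note db = rangeP_mult[OF d b(1)] C0_mult_Cb[OF bC rangeP_Cb[OF d]]
  have 2: "d p * b p = d q * b q"
    using eq algB_Bcontfun[OF db] rangeP_Cb[OF db(1)] unfolding can_eq_iff by (metis apply_Bcontfun)
  show ?thesis using 1 2 b(3) by auto
qed

lemma E_fib: "can P p = can P q \<Longrightarrow> E p f = E q f"
  by (rule rangeP_fib[OF E_rangeP])

text \<open>The functional \<open>E p\<close> lives on the fibre of \<open>p\<close>: for \<open>b\<close> in the range, \<open>\<bar>b - b p\<bar>\<^sup>2\<close> is again in
  the range and vanishes at \<open>p\<close>, so its value under \<open>E p\<close> is \<open>0\<close>; and sums of such functions dominate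
  on compact sets, up to a constant and a small error, every function that vanishes on the fibre.\<close>

lemma E_zero_on_fib:
  assumes f: "f \<in> Cb euclidean" and zero: "\<And>q. can P q = can P p \<Longrightarrow> f q = 0"
  shows "E p f = 0"
proof -
  have fc: "continuous_on UNIV f" by (rule Cb_euclideanD(1)[OF f])
  obtain c where c: "c > 0" "\<And>x. cmod (f x) \<le> c" using Cb_euclideanD(2)[OF f] by blast
  obtain b where b: "b \<in> rangeP" "b \<in> Kc_plus euclidean" "Re (b p) > 0" by (rule ex_rangeP_Kc_plus)
  define \<beta> where "\<beta> x = Re (b x)" for x
  have \<beta>: "b x = complex_of_real (\<beta> x)" "0 \<le> \<beta> x" for x
    using b(2) unfolding Kc_plus_euclidean_iff \<beta>_def nonneg_Reals_iff
    by (metis Re_complex_of_real)+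
  have \<beta>c: "continuous_on UNIV \<beta>"
    unfolding \<beta>_def using Cb_euclideanD(1)[OF rangeP_Cb[OF b(1)]] by (intro continuous_intros)
  obtain K where K: "compact K" "\<And>x. x \<notin> K \<Longrightarrow> b x = 0"
    using b(2) unfolding Kc_plus_euclidean_iff Kc_euclidean_iff by blast
  obtain c' where c': "c' > 0" "\<And>x. cmod (b x) \<le> c'" using Cb_euclideanD(2)[OF rangeP_Cb[OF b(1)]] by blast
  have \<beta>_le: "\<beta> x \<le> c'" for x using c'(2)[of x] \<beta>(2)[of x] by (simp add: \<beta>(1))
  define w where "w a x = (cmod (apply_bcontfun a x - apply_bcontfun a p))\<^sup>2" for a x
  have wc: "continuous_on UNIV (w a)" for a
    unfolding w_def by (intro continuous_intros) auto
  have wD: "(\<lambda>x. complex_of_real (w a x)) \<in> rangeP" if "a \<in> algB P" for a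
  proof -
    have "apply_bcontfun a \<in> rangeP" using that algB_iff by blast
    then have "(\<lambda>x. apply_bcontfun a x - apply_bcontfun a p) \<in> rangeP" by (intro rangeP_diff rangeP_const)
    from rangeP_mult[OF this rangeP_cnj[OF this]] show ?thesis
      unfolding w_def complex_norm_square .
  qed
  have key: "\<beta> p * Re (E p (\<lambda>x. complex_of_real (cmod (f x)))) \<le> 0 + \<epsilon> * \<beta> p" if \<epsilon>: "\<epsilon> > 0" for \<epsilon>
  proof -
    define C where "C = K \<inter> {x. \<epsilon> \<le> cmod (f x)}"
    have C: "compact C"
      unfolding C_def using compact_Int_closed[OF K(1) continuous_superlevel_closed[OF fc, of \<epsilon>]] .
    have "\<exists>a\<in>algB P. 0 < w a x" if x: "x \<in> C" for x
    proof -
      have "can P x \<noteq> can P p" using x zero[of x] \<epsilon> by (auto simp: C_def)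
      then show ?thesis unfolding can_eq_iff w_def by auto
    qed
    then obtain a where a: "\<And>x. x \<in> C \<Longrightarrow> a x \<in> algB P" "\<And>x. x \<in> C \<Longrightarrow> 0 < w (a x) x" by metis
    have "open {y. 0 < w (a x) y}" for x
      using wc by (intro open_Collect_less continuous_intros)
    moreover have "C \<subseteq> (\<Union>x\<in>C. {y. 0 < w (a x) y})" using a(2) by blast
    ultimately obtain I where I: "I \<subseteq> C" "finite I" "C \<subseteq> (\<Union>x\<in>I. {y. 0 < w (a x) y})"
      using compactE_image[OF C, of C "\<lambda>x. {y. 0 < w (a x) y}"] by metis
    \<comment> \<open>Killed by \<open>E p\<close>, but bounded below on \<open>C\<close>.\<close>
    define W where "W y = (\<Sum>x\<in>I. w (a x) y)" for y
    have w0: "0 \<le> w a' y" for a' y by (simp add: w_def)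
    have Wc: "continuous_on UNIV W" unfolding W_def using wc by (intro continuous_on_sum)
    have W0: "0 \<le> W y" for y unfolding W_def using w0 by (intro sum_nonneg)
    have W_pos: "0 < W y" if "y \<in> C" for y
    proof -
      obtain x where "x \<in> I" "0 < w (a x) y" using I(3) \<open>y \<in> C\<close> by auto
      then show ?thesis unfolding W_def using I(2) w0 by (intro sum_pos2[of I x]) auto
    qed
    have WD: "(\<lambda>y. complex_of_real (W y)) \<in> rangeP"
      unfolding W_def of_real_sum using I a(1) wD by (intro rangeP_sum) auto
    have EW: "E p (\<lambda>y. complex_of_real (W y)) = 0"
      using rangeP_E[OF WD, of p] by (simp add: W_def w_def)
    obtain \<delta> where \<delta>: "\<delta> > 0" "\<And>y. y \<in> C \<Longrightarrow> \<delta> \<le> W y"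
    proof (cases "C = {}")
      case True
      then show thesis by (intro that[of 1]) auto
    next
      case False
      then obtain y0 where "y0 \<in> C" "\<And>y. y \<in> C \<Longrightarrow> W y0 \<le> W y"
        using continuous_attains_inf[OF C False continuous_on_subset[OF Wc]] by auto
      then show thesis using W_pos by (intro that[of "W y0"]) auto
    qed
    obtain cW where cW: "\<And>y. W y \<le> cW"
      using Cb_euclideanD(2)[OF rangeP_Cb[OF WD]] W0 by auto
    let ?M = "c' * c / \<delta>"
    have dom: "\<beta> x * cmod (f x) \<le> \<epsilon> * \<beta> x + ?M * W x" for x
    proof (cases "x \<in> C")
      case True
      have "\<beta> x * cmod (f x) \<le> c' * c"
        using \<beta>_le[of x] c(2)[of x] \<beta>(2)[of x] c(1) c'(1) by (intro mult_mono) auto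
      also have "\<dots> = ?M * \<delta>" using \<delta>(1) by simp
      also have "\<dots> \<le> ?M * W x" using \<delta> True c(1) c'(1) by (intro mult_left_mono) auto
      finally show ?thesis using \<beta>(2)[of x] \<epsilon> by (simp add: add_increasing)
    next
      case False
      have "\<beta> x * cmod (f x) \<le> \<epsilon> * \<beta> x"
      proof (cases "x \<in> K")
        case True
        with False have "cmod (f x) \<le> \<epsilon>" by (auto simp: C_def)
        from mult_left_mono[OF this \<beta>(2)[of x]] show ?thesis by (simp add: mult.commute)
      next
        case False
        then have "\<beta> x = 0" using K(2)[of x] \<beta>(1)[of x] by simp
        then show ?thesis by simp
      qed
      moreover have "0 \<le> ?M * W x" using W0 c(1) c'(1) \<delta>(1) by (intro mult_nonneg_nonneg) auto
      ultimately show ?thesis by simp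
    qed
    have fn: "(\<lambda>x. complex_of_real (cmod (f x))) \<in> Cb euclidean"
      using c(2) fc by (intro Cb_real[where c = c] continuous_intros) auto
    have "\<beta> p * Re (E p (\<lambda>x. complex_of_real (cmod (f x)))) = Re (E p (\<lambda>x. b x * complex_of_real (cmod (f x))))"
      using E_mult[OF b(1) fn, of p] by (simp add: \<beta>(1))
    also have "\<dots> = Re (E p (\<lambda>x. complex_of_real (\<beta> x * cmod (f x))))"
      by (simp add: \<beta>(1))
    also have "\<dots> \<le> Re (E p (\<lambda>x. complex_of_real (\<epsilon> * \<beta> x + ?M * W x)))"
    proof (rule E_mono[OF _ _ _ _ dom])
      show "continuous_on UNIV (\<lambda>x. \<beta> x * cmod (f x))"
        using \<beta>c fc by (intro continuous_intros)
      show "continuous_on UNIV (\<lambda>x. \<epsilon> * \<beta> x + ?M * W x)"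
        by (intro continuous_on_add continuous_on_mult_left \<beta>c Wc)
      show "\<bar>\<beta> x * cmod (f x)\<bar> \<le> c' * c" for x
        using \<beta>_le[of x] c(2)[of x] \<beta>(2)[of x] c(1) c'(1) by (auto simp: abs_mult intro!: mult_mono)
      show "\<bar>\<epsilon> * \<beta> x + ?M * W x\<bar> \<le> \<epsilon> * c' + ?M * cW" for x
      proof -
        have "0 \<le> ?M * W x" "?M * W x \<le> ?M * cW"
          using cW[of x] W0[of x] c(1) c'(1) \<delta>(1) by (intro mult_nonneg_nonneg mult_left_mono; simp)+
        moreover have "0 \<le> \<epsilon> * \<beta> x" "\<epsilon> * \<beta> x \<le> \<epsilon> * c'"
          using \<beta>_le[of x] \<beta>(2)[of x] \<epsilon> by simp_all
        ultimately show ?thesis unfolding abs_le_iff by linarith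
      qed
    qed
    also have "E p (\<lambda>x. complex_of_real (\<epsilon> * \<beta> x + ?M * W x)) =
        E p (\<lambda>x. complex_of_real \<epsilon> * b x + complex_of_real ?M * complex_of_real (W x))"
      by (simp add: \<beta>(1))
    also have "\<dots> = complex_of_real \<epsilon> * b p + complex_of_real ?M * 0"
      using E_add[OF Cb_scale[OF rangeP_Cb[OF b(1)]] Cb_scale[OF rangeP_Cb[OF WD]]]
        E_scale[OF rangeP_Cb[OF b(1)]] E_scale[OF rangeP_Cb[OF WD]] rangeP_E[OF b(1)] EW by metis
    finally show ?thesis by (simp add: \<beta>(1))
  qed
  have "Re (E p (\<lambda>x. complex_of_real (cmod (f x)))) \<le> 0 + \<epsilon>" if "\<epsilon> > 0" for \<epsilon>
    using key[OF that] b(3) unfolding \<beta>_def[symmetric] by simp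
  then have "Re (E p (\<lambda>x. complex_of_real (cmod (f x)))) \<le> 0" by (rule field_le_epsilon)
  from order_trans[OF E_norm_le[OF f] this] show ?thesis by simp
qed

lemma E_cong_fib:
  assumes f: "f \<in> Cb euclidean" and g: "g \<in> Cb euclidean"
    and eq: "\<And>q. can P q = can P p \<Longrightarrow> f q = g q"
  shows "E p f = E p g"
  using E_zero_on_fib[OF Cb_diff[OF f g], of p] eq E.diff[OF f g] by simp

lemma E_norm_le_fib:
  assumes f: "f \<in> Cb euclidean" and le: "\<And>q. can P q = can P p \<Longrightarrow> cmod (f q) \<le> c"
  shows "cmod (E p f) \<le> c"
proof -
  have c: "0 \<le> c" using order_trans[OF norm_ge_zero le[OF refl]] .
  have fc: "continuous_on UNIV f" by (rule Cb_euclideanD(1)[OF f])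
  obtain B where B: "\<And>x. cmod (f x) \<le> B" using Cb_euclideanD(2)[OF f] by blast
  have 1: "(\<lambda>x. complex_of_real (cmod (f x))) \<in> Cb euclidean"
    using B fc by (intro Cb_real[where c = B] continuous_intros) auto
  have 2: "(\<lambda>x. complex_of_real (min c (cmod (f x)))) \<in> Cb euclidean"
    using c fc by (intro Cb_real[where c = c] continuous_intros) auto
  have "cmod (E p f) \<le> Re (E p (\<lambda>x. complex_of_real (cmod (f x))))" by (rule E_norm_le[OF f])
  also have "E p (\<lambda>x. complex_of_real (cmod (f x))) = E p (\<lambda>x. complex_of_real (min c (cmod (f x))))"
    using le by (intro E_cong_fib 1 2) (simp add: min_absorb2)
  also have "Re \<dots> \<le> cmod \<dots>" by (rule complex_Re_le_cmod)
  also have "\<dots> \<le> c" using c by (intro E_norm_le_const[OF 2]) auto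
  finally show ?thesis .
qed

text \<open>A function that is constant on the fibre of \<open>p\<close> is there indistinguishable from a constant. This
  identifies the range of \<open>P\<close> without an approximation theorem of Stone-Weierstrass type.\<close>

lemma rangeP_iff_fib: "f \<in> rangeP \<longleftrightarrow> f \<in> Cb euclidean \<and> (\<forall>p q. can P p = can P q \<longrightarrow> f p = f q)"
proof
  assume "f \<in> rangeP"
  then show "f \<in> Cb euclidean \<and> (\<forall>p q. can P p = can P q \<longrightarrow> f p = f q)" using rangeP_Cb rangeP_fib by blast
next
  assume *: "f \<in> Cb euclidean \<and> (\<forall>p q. can P p = can P q \<longrightarrow> f p = f q)"
  then have f: "f \<in> Cb euclidean" and fib: "\<And>p q. can P p = can P q \<Longrightarrow> f p = f q" by blast+
  have "E p f = E p (\<lambda>x. f p)" for p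
    by (rule E_cong_fib[OF f Cb_const]) (rule fib)
  then have "E p f = f p" for p using E.const[of p "f p"] by (simp only:)
  with f show "f \<in> rangeP" unfolding rangeP_def by blast
qed

text \<open>Multiplying by a bump at \<open>q\<close> produces a compactly supported function below a multiple of \<open>f\<close>, to
  which faithfulness applies.\<close>

lemma E_nonzero:
  assumes f: "f \<in> Cb euclidean" and pos: "\<And>x. f x \<in> \<real>\<^sub>\<ge>\<^sub>0"
    and q: "can P q = can P p" "f q \<noteq> 0"
  shows "E p f \<noteq> 0"
proof
  assume z: "E p f = 0"
  obtain k where k: "k \<in> Cb euclidean" "k \<in> Kc_plus euclidean" "k q = 1" by (rule ex_Kc_plus)
  obtain c where c: "\<And>x. cmod (k x) \<le> c" using Cb_euclideanD(2)[OF k(1)] by blast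
  have fk: "(\<lambda>x. f x * k x) \<in> Cb euclidean" by (rule Cb_mult[OF f k(1)])
  obtain K where K: "compact K" "\<And>x. x \<notin> K \<Longrightarrow> k x = 0"
    using k(2) unfolding Kc_plus_euclidean_iff Kc_euclidean_iff by blast
  have kpos: "k x \<in> \<real>\<^sub>\<ge>\<^sub>0" for x using k(2) by (simp add: Kc_plus_euclidean_iff)
  have "(\<lambda>x. f x * k x) \<in> Kc_plus euclidean"
    unfolding Kc_plus_euclidean_iff Kc_euclidean_iff
    using Cb_euclideanD(1)[OF fk] K pos kpos by (auto intro!: nonneg_Reals_mult_I)
  then have "Re (E q (\<lambda>x. f x * k x)) > 0" using q(2) k(3) by (intro E_faithful[OF fk]) auto
  then have 1: "Re (E p (\<lambda>x. f x * k x)) > 0" using E_fib[OF q(1)] by simp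
  have "E p (\<lambda>x. complex_of_real c * f x - f x * k x) \<in> \<real>\<^sub>\<ge>\<^sub>0"
  proof (rule E_pos[OF Cb_diff[OF Cb_scale[OF f] fk]])
    fix x
    obtain r s where rs: "f x = complex_of_real r" "0 \<le> r" "k x = complex_of_real s" "0 \<le> s"
      using pos[of x] kpos[of x] unfolding nonneg_Reals_iff by blast
    have "r * s \<le> r * c" using c[of x] rs by (intro mult_left_mono) simp_all
    then have "r * s \<le> c * r" by (simp add: mult.commute)
    then show "complex_of_real c * f x - f x * k x \<in> \<real>\<^sub>\<ge>\<^sub>0"
      by (simp add: rs flip: of_real_mult of_real_diff)
  qed
  then show False
    using 1 z E.diff[OF Cb_scale[OF f] fk] E_scale[OF f] by (auto simp: nonneg_Reals_iff complex_eq_iff)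
qed

end

section \<open>The spectrum as a quotient of the group\<close>

context expectation
begin

text \<open>The algebra \<open>B\<close>, in terms of plain functions.\<close>

definition algB_fun :: "('g \<Rightarrow> complex) set" where
  "algB_fun = rangeP \<inter> C0 euclidean"

lemma algB_fun_rangeP: "d \<in> algB_fun \<Longrightarrow> d \<in> rangeP" and algB_fun_C0: "d \<in> algB_fun \<Longrightarrow> d \<in> C0 euclidean"
  and algB_fun_Cb: "d \<in> algB_fun \<Longrightarrow> d \<in> Cb euclidean"
  by (auto simp: algB_fun_def dest: rangeP_Cb)

lemma algB_fun_algB: "d \<in> algB_fun \<Longrightarrow> Bcontfun d \<in> algB P"
  unfolding algB_fun_def by (auto intro: algB_Bcontfun)

lemma algB_algB_fun: "b \<in> algB P \<Longrightarrow> apply_bcontfun b \<in> algB_fun"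
  unfolding algB_fun_def algB_iff by auto

lemma algB_fun_add: "d \<in> algB_fun \<Longrightarrow> d' \<in> algB_fun \<Longrightarrow> (\<lambda>x. d x + d' x) \<in> algB_fun"
  unfolding algB_fun_def by (auto intro: rangeP_add C0_add)

lemma algB_fun_mult_rangeP: "d \<in> rangeP \<Longrightarrow> d' \<in> algB_fun \<Longrightarrow> (\<lambda>x. d x * d' x) \<in> algB_fun"
  unfolding algB_fun_def by (auto intro: rangeP_mult C0_mult_Cb rangeP_Cb)

lemma algB_fun_mult: "d \<in> algB_fun \<Longrightarrow> d' \<in> algB_fun \<Longrightarrow> (\<lambda>x. d x * d' x) \<in> algB_fun"
  by (rule algB_fun_mult_rangeP[OF algB_fun_rangeP])

lemma algB_fun_scale: "d \<in> algB_fun \<Longrightarrow> (\<lambda>x. c * d x) \<in> algB_fun"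
  using algB_fun_mult_rangeP[OF rangeP_const] .

lemma algB_fun_diff: "d \<in> algB_fun \<Longrightarrow> d' \<in> algB_fun \<Longrightarrow> (\<lambda>x. d x - d' x) \<in> algB_fun"
  using algB_fun_add[of d "\<lambda>x. (-1) * d' x"] algB_fun_scale[of d' "-1"] by simp

lemma algB_fun_cnj: "d \<in> algB_fun \<Longrightarrow> (\<lambda>x. cnj (d x)) \<in> algB_fun"
  unfolding algB_fun_def by (auto intro: rangeP_cnj simp: C0_euclidean_iff continuous_intros)

lemma ex_algB_fun:
  obtains b K where "b \<in> algB_fun" "b p \<noteq> 0" "compact K" "\<And>x. x \<notin> K \<Longrightarrow> b x = 0"
proof -
  obtain b where b: "b \<in> rangeP" "b \<in> Kc_plus euclidean" "Re (b p) > 0" by (rule ex_rangeP_Kc_plus)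
  have "b \<in> algB_fun" using b by (auto simp: algB_fun_def Kc_plus_euclidean_iff intro: Kc_subset_C0)
  moreover have "b p \<noteq> 0" using b(3) by auto
  ultimately show thesis
    using b(2) that unfolding Kc_plus_euclidean_iff Kc_euclidean_iff by blast
qed

lemma Bcontfun_add: "f \<in> Cb euclidean \<Longrightarrow> g \<in> Cb euclidean \<Longrightarrow>
    Bcontfun (\<lambda>x. f x + g x) = Bcontfun f + (Bcontfun g :: 'g \<Rightarrow>\<^sub>C complex)"
  by (intro bcontfun_eqI) (simp add: apply_Bcontfun Cb_add)

lemma Bcontfun_mult: "f \<in> Cb euclidean \<Longrightarrow> g \<in> Cb euclidean \<Longrightarrow>
    Bcontfun (\<lambda>x. f x * g x) = bc_mult (Bcontfun f) (Bcontfun g :: 'g \<Rightarrow>\<^sub>C complex)"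
  by (intro bcontfun_eqI) (simp add: apply_Bcontfun Cb_mult bc_mult.rep_eq)

lemma Bcontfun_scale: "f \<in> Cb euclidean \<Longrightarrow>
    Bcontfun (\<lambda>x. c * f x) = bc_scale c (Bcontfun f :: 'g \<Rightarrow>\<^sub>C complex)"
  by (intro bcontfun_eqI) (simp add: apply_Bcontfun Cb_scale bc_scale.rep_eq)

lemma topspace_specQ: "topspace (specQ P) = characters (algB P)"
  unfolding spectrum_def characters_def by (auto simp: PiE_def)

lemma can_character: "can P p \<in> characters (algB P)"
proof -
  have closed: "f + g \<in> algB P" "bc_mult f g \<in> algB P" "bc_scale c f \<in> algB P"
    if "f \<in> algB P" "g \<in> algB P" for f g c
    using algB_fun_algB[OF algB_fun_add[OF algB_algB_fun[OF that(1)] algB_algB_fun[OF that(2)]]]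
      algB_fun_algB[OF algB_fun_mult[OF algB_algB_fun[OF that(1)] algB_algB_fun[OF that(2)]]]
      algB_fun_algB[OF algB_fun_scale[OF algB_algB_fun[OF that(1)], of c]]
    by (simp_all add: Bcontfun_add Bcontfun_mult Bcontfun_scale apply_bcontfun_Cb apply_bcontfun_inverse)
  obtain b K where b: "b \<in> algB_fun" "b p \<noteq> 0" "compact K" "\<And>x. x \<notin> K \<Longrightarrow> b x = 0" using ex_algB_fun[of p] by blast
  have "\<exists>f\<in>algB P. can P p f \<noteq> 0"
    using algB_fun_algB[OF b(1)] b(2)
    by (intro bexI[of _ "Bcontfun b"]) (simp_all add: can_def apply_Bcontfun[OF algB_fun_Cb[OF b(1)]])
  then show ?thesis
    unfolding characters_def
    by (auto simp: can_def closed bc_mult.rep_eq bc_scale.rep_eq)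
qed

text \<open>A character that differs from all evaluations would vanish on some \<open>c \<ge> 0\<close> in the algebra that is
  positive where \<open>f\<close> with \<open>h f = 1\<close> is large. Then \<open>\<bar>1 - f\<bar>\<^sup>2 + c = 1 - v\<close> is bounded below although
  \<open>h v = 1\<close>, and \<open>v / (1 - v)\<close>, which lies in the algebra, has no possible value under \<open>h\<close>.\<close>

lemma character_is_evaluation:
  assumes h: "h \<in> characters (algB P)"
  shows "\<exists>p. h = can P p"
proof (rule ccontr)
  assume no: "\<nexists>p. h = can P p"
  define \<theta> where "\<theta> d = h (Bcontfun d)" for d
  have h_ext: "h \<in> extensional (algB P)"
    and h_add: "\<And>f g. f \<in> algB P \<Longrightarrow> g \<in> algB P \<Longrightarrow> h (f + g) = h f + h g"
    and h_mult: "\<And>f g. f \<in> algB P \<Longrightarrow> g \<in> algB P \<Longrightarrow> h (bc_mult f g) = h f * h g"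
    and h_scale: "\<And>c f. f \<in> algB P \<Longrightarrow> h (bc_scale c f) = c * h f"
    and h_nz: "\<exists>f\<in>algB P. h f \<noteq> 0"
    using h unfolding characters_def by auto
  have \<theta>_add: "\<theta> (\<lambda>x. d x + d' x) = \<theta> d + \<theta> d'" if "d \<in> algB_fun" "d' \<in> algB_fun" for d d'
    unfolding \<theta>_def using that by (simp add: Bcontfun_add algB_fun_Cb h_add algB_fun_algB)
  have \<theta>_mult: "\<theta> (\<lambda>x. d x * d' x) = \<theta> d * \<theta> d'" if "d \<in> algB_fun" "d' \<in> algB_fun" for d d'
    unfolding \<theta>_def using that by (simp add: Bcontfun_mult algB_fun_Cb h_mult algB_fun_algB)
  have \<theta>_scale: "\<theta> (\<lambda>x. c * d x) = c * \<theta> d" if "d \<in> algB_fun" for c d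
    unfolding \<theta>_def using that by (simp add: Bcontfun_scale algB_fun_Cb h_scale algB_fun_algB)
  have \<theta>_diff: "\<theta> (\<lambda>x. d x - d' x) = \<theta> d - \<theta> d'" if "d \<in> algB_fun" "d' \<in> algB_fun" for d d'
    using \<theta>_add[OF that(1) algB_fun_scale[OF that(2), of "-1"]] \<theta>_scale[OF that(2), of "-1"] by simp
  obtain g where g: "g \<in> algB P" "h g \<noteq> 0" using h_nz by auto
  define f where "f x = (1 / h g) * apply_bcontfun g x" for x
  have f: "f \<in> algB_fun" unfolding f_def by (rule algB_fun_scale[OF algB_algB_fun[OF g(1)]])
  have \<theta>f: "\<theta> f = 1"
    unfolding f_def using \<theta>_scale[OF algB_algB_fun[OF g(1)], of "1 / h g"] g(2)
    by (simp add: \<theta>_def apply_bcontfun_inverse)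
  define K where "K = {x. 1/2 \<le> cmod (f x)}"
  have "(0::real) < 1/2" by simp
  then have K: "compact K" using algB_fun_C0[OF f] unfolding C0_euclidean_iff K_def by blast
  have "\<exists>k\<in>algB_fun. \<theta> k = 0 \<and> k p \<noteq> 0" if p: "p \<in> K" for p
  proof -
    have "h \<noteq> can P p" using no by auto
    moreover have "can P p \<in> extensional (algB P)" by (simp add: can_def)
    ultimately obtain b where b: "b \<in> algB P" "h b \<noteq> apply_bcontfun b p"
      using extensionalityI[OF h_ext, of "can P p"] by (auto simp: can_def)
    note d = algB_algB_fun[OF b(1)]
    have \<theta>b: "\<theta> (apply_bcontfun b) = h b" by (simp add: \<theta>_def apply_bcontfun_inverse)
    have fp: "f p \<noteq> 0" using p by (auto simp: K_def)
    show ?thesis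
    proof (intro bexI conjI)
      show "(\<lambda>x. apply_bcontfun b x * f x - h b * f x) \<in> algB_fun" by (intro algB_fun_diff algB_fun_mult algB_fun_scale d f)
      show "\<theta> (\<lambda>x. apply_bcontfun b x * f x - h b * f x) = 0"
        using \<theta>_diff[OF algB_fun_mult[OF d f] algB_fun_scale[OF f]] \<theta>_mult[OF d f] \<theta>_scale[OF f] \<theta>b \<theta>f by simp
      show "apply_bcontfun b p * f p - h b * f p \<noteq> 0"
        using b(2) fp by (simp flip: left_diff_distrib)
    qed
  qed
  then obtain k where k: "\<And>p. p \<in> K \<Longrightarrow> k p \<in> algB_fun" "\<And>p. p \<in> K \<Longrightarrow> \<theta> (k p) = 0" "\<And>p. p \<in> K \<Longrightarrow> k p p \<noteq> 0"
    by metis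
  have o: "open {x. k p x \<noteq> 0}" if "p \<in> K" for p
    using Cb_euclideanD(1)[OF algB_fun_Cb[OF k(1)[OF that]]] by (intro open_Collect_neq continuous_intros)
  have "K \<subseteq> (\<Union>p\<in>K. {x. k p x \<noteq> 0})" using k(3) by blast
  then obtain I where I: "I \<subseteq> K" "finite I" "K \<subseteq> (\<Union>p\<in>I. {x. k p x \<noteq> 0})"
    using compactE_image[OF K, of K "\<lambda>p. {x. k p x \<noteq> 0}"] o by metis
  define c where "c x = (\<Sum>p\<in>I. (cmod (k p x))\<^sup>2)" for x
  have c_sum: "complex_of_real (c x) = (\<Sum>p\<in>I. cnj (k p x) * k p x)" for x
    unfolding c_def of_real_sum complex_norm_square by (simp add: mult.commute)
  have "(\<lambda>x. \<Sum>p\<in>J. cnj (k p x) * k p x) \<in> algB_fun \<and> \<theta> (\<lambda>x. \<Sum>p\<in>J. cnj (k p x) * k p x) = 0"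
    if "finite J" "J \<subseteq> I" for J
    using that
  proof (induction J rule: finite_induct)
    case empty
    then show ?case using algB_fun_scale[OF f, of 0] \<theta>_scale[OF f, of 0] by simp
  next
    case (insert p J)
    then have kp: "k p \<in> algB_fun" "\<theta> (k p) = 0" using k I(1) by auto
    note t = algB_fun_mult[OF algB_fun_cnj[OF kp(1)] kp(1)]
    have "\<theta> (\<lambda>x. cnj (k p x) * k p x) = 0" using \<theta>_mult[OF algB_fun_cnj[OF kp(1)] kp(1)] kp(2) by simp
    then show ?case
      using insert algB_fun_add[OF t, of "\<lambda>x. \<Sum>p\<in>J. cnj (k p x) * k p x"]
        \<theta>_add[OF t, of "\<lambda>x. \<Sum>p\<in>J. cnj (k p x) * k p x"] by simp
  qed
  from this[OF I(2) order_refl] have cB: "(\<lambda>x. complex_of_real (c x)) \<in> algB_fun"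
    and \<theta>c: "\<theta> (\<lambda>x. complex_of_real (c x)) = 0" unfolding c_sum by auto
  have c0: "0 \<le> c x" for x unfolding c_def by (intro sum_nonneg) auto
  have c_pos: "0 < c x" if "x \<in> K" for x
  proof -
    obtain p where "p \<in> I" "k p x \<noteq> 0" using I(3) \<open>x \<in> K\<close> by auto
    then show ?thesis unfolding c_def using I(2) by (intro sum_pos2[of I p]) auto
  qed
  have cc: "continuous_on UNIV c"
    unfolding c_def using k(1) I(1) Cb_euclideanD(1)[OF algB_fun_Cb]
    by (intro continuous_on_sum continuous_intros) auto
  obtain \<delta> where \<delta>: "\<delta> > 0" "\<And>x. x \<in> K \<Longrightarrow> \<delta> \<le> c x"
  proof (cases "K = {}")
    case True
    then show thesis by (intro that[of 1]) auto
  next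
    case False
    then obtain x0 where "x0 \<in> K" "\<And>x. x \<in> K \<Longrightarrow> c x0 \<le> c x"
      using continuous_attains_inf[OF K False continuous_on_subset[OF cc]] by auto
    then show thesis using c_pos by (intro that[of "c x0"]) auto
  qed
  \<comment> \<open>That is, \<open>1 - v = \<bar>1 - f\<bar>\<^sup>2 + c\<close>.\<close>
  define v where "v x = f x + cnj (f x) - f x * cnj (f x) - complex_of_real (c x)" for x
  have vB: "v \<in> algB_fun" unfolding v_def by (intro algB_fun_diff algB_fun_add algB_fun_mult algB_fun_cnj f cB)
  have "\<theta> v = \<theta> f + \<theta> (\<lambda>x. cnj (f x)) - \<theta> f * \<theta> (\<lambda>x. cnj (f x)) - \<theta> (\<lambda>x. complex_of_real (c x))"
    unfolding v_def
    by (simp add: \<theta>_diff \<theta>_add \<theta>_mult algB_fun_diff algB_fun_add algB_fun_mult algB_fun_cnj f cB)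
  then have \<theta>v: "\<theta> v = 1" using \<theta>f \<theta>c by simp
  define r where "r x = (cmod (1 - f x))\<^sup>2 + c x" for x
  have r: "1 - v x = complex_of_real (r x)" for x
    unfolding v_def r_def of_real_add complex_norm_square by (simp add: algebra_simps)
  define \<eta> where "\<eta> = min \<delta> (1/4)"
  have \<eta>: "\<eta> > 0" using \<delta>(1) by (simp add: \<eta>_def)
  have r_ge: "\<eta> \<le> r x" for x
  proof (cases "x \<in> K")
    case True
    then have "\<delta> \<le> r x" using \<delta>(2)[OF True] by (simp add: r_def add_increasing)
    then show ?thesis by (simp add: \<eta>_def)
  next
    case False
    then have "1/2 \<le> cmod (1 - f x)"
      using norm_triangle_ineq2[of 1 "f x"] by (simp add: K_def)
    then have "(1/2)\<^sup>2 \<le> (cmod (1 - f x))\<^sup>2" by (intro power_mono) auto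
    then have "1/4 \<le> r x" using c0[of x] by (simp add: r_def power2_eq_square)
    then show ?thesis by (simp add: \<eta>_def)
  qed
  have r_pos: "r x > 0" for x using r_ge[of x] \<eta> by linarith
  \<comment> \<open>The inverse of \<open>1 - v\<close>; being an inverse it is fixed by \<open>P\<close>.\<close>
  define w where "w x = complex_of_real (1 / r x)" for x
  have rc: "continuous_on UNIV r"
    unfolding r_def using cc Cb_euclideanD(1)[OF algB_fun_Cb[OF f]] by (intro continuous_intros)
  have wCb: "w \<in> Cb euclidean"
    unfolding w_def
  proof (rule Cb_real[where c = "1 / \<eta>"])
    show "continuous_on UNIV (\<lambda>x. 1 / r x)"
      using rc r_pos by (intro continuous_intros) (auto simp: less_imp_neq[symmetric])
    show "\<bar>1 / r x\<bar> \<le> 1 / \<eta>" for x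
      using r_pos[of x] r_ge[of x] \<eta> by (simp add: frac_le)
  qed
  have w: "(1 - v x) * w x = 1" for x
    using r_pos[of x] by (simp add: r w_def)
  have "E p w = w p" for p
  proof -
    have "(1 - v p) * E p w = E p (\<lambda>x. (1 - v x) * w x)"
      by (rule E_mult[OF rangeP_diff[OF rangeP_const algB_fun_rangeP[OF vB]] wCb, symmetric])
    also have "\<dots> = (1 - v p) * w p" by (simp add: w E_one)
    finally show ?thesis using w[of p] by (metis mult_left_cancel mult_zero_left zero_neq_one)
  qed
  then have wD: "w \<in> rangeP" using wCb by (simp add: rangeP_def)
  define z where "z x = w x * v x" for x
  have zB: "z \<in> algB_fun" unfolding z_def by (rule algB_fun_mult_rangeP[OF wD vB])
  have "z = (\<lambda>x. v x + z x * v x)"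
  proof
    fix x
    have "z x * (1 - v x) = v x" using w[of x] by (simp add: z_def mult.commute mult.left_commute)
    then show "z x = v x + z x * v x" by (simp add: algebra_simps)
  qed
  then have "\<theta> z = \<theta> (\<lambda>x. v x + z x * v x)" by simp
  also have "\<dots> = \<theta> v + \<theta> z * \<theta> v"
    using \<theta>_add[OF vB algB_fun_mult[OF zB vB]] \<theta>_mult[OF zB vB] by simp
  finally show False using \<theta>v by simp
qed

lemma topspace_range: "topspace (specQ P) = range (can P)"
  unfolding topspace_specQ using can_character character_is_evaluation by blast

lemma can_in_topspace [simp]: "can P p \<in> topspace (specQ P)"
  by (simp add: topspace_range)

lemma Hausdorff_specQ: "Hausdorff_space (specQ P)"
  unfolding spectrum_def
  by (intro Hausdorff_space_subtopology) (simp add: Hausdorff_space_product_topology)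

lemma continuous_into_specQ:
  assumes "\<And>b. b \<in> algB P \<Longrightarrow> continuous_map Y euclidean (\<lambda>x. f x b)"
    and "\<And>x. x \<in> topspace Y \<Longrightarrow> f x \<in> topspace (specQ P)"
  shows "continuous_map Y (specQ P) f"
proof -
  have "f x \<in> characters (algB P)" if "x \<in> topspace Y" for x
    using assms(2)[OF that] by (simp add: topspace_specQ)
  moreover have "characters (algB P) \<subseteq> extensional (algB P)" by (auto simp: characters_def)
  ultimately show ?thesis
    unfolding spectrum_def continuous_map_in_subtopology continuous_map_componentwise
    using assms(1) by auto
qed

lemma continuous_evaluation: "b \<in> algB P \<Longrightarrow> continuous_map (specQ P) euclidean (\<lambda>s. s b)"
  unfolding spectrum_def by (intro continuous_map_from_subtopology continuous_map_product_projection)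

lemma continuous_can: "continuous_map euclidean (specQ P) (can P)"
proof (rule continuous_into_specQ)
  fix b assume "b \<in> algB P"
  then show "continuous_map euclidean euclidean (\<lambda>p. can P p b)"
    by (simp add: can_def continuous_map_iff_continuous2)
qed simp

text \<open>A compactly supported function of \<open>B\<close> that does not vanish at \<open>p\<close> bounds a neighbourhood of the point in
  \<open>Q\<close> and its preimage at the same time; local compactness of \<open>Q\<close> and properness follow.\<close>

lemma specQ_neighbourhood:
  "\<exists>V K. openin (specQ P) V \<and> can P p \<in> V \<and> compact K \<and> (\<forall>q. can P q \<in> V \<longrightarrow> q \<in> K)"
proof -
  obtain b K where b: "b \<in> algB_fun" "b p \<noteq> 0" "compact K" "\<And>x. x \<notin> K \<Longrightarrow> b x = 0" using ex_algB_fun[of p] by blast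
  note B = algB_fun_algB[OF b(1)]
  have val: "can P q (Bcontfun b) = b q" for q
    using B by (simp add: can_def apply_Bcontfun[OF algB_fun_Cb[OF b(1)]])
  have "openin (specQ P) {s \<in> topspace (specQ P). s (Bcontfun b) \<in> - {0}}"
    by (rule openin_continuous_map_preimage[OF continuous_evaluation[OF B]]) (simp add: open_Compl)
  moreover have "can P p \<in> {s \<in> topspace (specQ P). s (Bcontfun b) \<in> - {0}}"
    using b(2) by (simp add: val)
  moreover have "\<forall>q. can P q \<in> {s \<in> topspace (specQ P). s (Bcontfun b) \<in> - {0}} \<longrightarrow> q \<in> K"
    using b(4) by (auto simp: val)
  ultimately show ?thesis using b(3) by blast
qed

lemma locally_compact_specQ: "locally_compact_space (specQ P)"
  unfolding locally_compact_space_def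
proof
  fix s assume "s \<in> topspace (specQ P)"
  then obtain p where p: "s = can P p" by (auto simp: topspace_range)
  obtain V K where VK: "openin (specQ P) V" "can P p \<in> V" "compact K" "\<And>q. can P q \<in> V \<Longrightarrow> q \<in> K"
    using specQ_neighbourhood by blast
  have "compactin (specQ P) (can P ` K)"
    using VK(3) by (intro image_compactin[OF _ continuous_can]) simp
  moreover have "V \<subseteq> can P ` K" using openin_subset[OF VK(1)] VK(4) by (auto simp: topspace_range)
  ultimately show "\<exists>U K. openin (specQ P) U \<and> compactin (specQ P) K \<and> s \<in> U \<and> U \<subseteq> K"
    using VK(1,2) p by blast
qed

lemma compact_can_preimage:
  assumes C: "compactin (specQ P) C"
  shows "compact {q. can P q \<in> C}"
proof -
  obtain V K where VK: "\<And>p. openin (specQ P) (V p)" "\<And>p. can P p \<in> V p" "\<And>p. compact (K p)"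
      "\<And>p q. can P q \<in> V p \<Longrightarrow> q \<in> K p"
    using specQ_neighbourhood by metis
  have "C \<subseteq> \<Union> (range V)"
    using compactin_subset_topspace[OF C] VK(2) unfolding topspace_range by blast
  then have "\<exists>\<F>. finite \<F> \<and> \<F> \<subseteq> range V \<and> C \<subseteq> \<Union> \<F>"
    by (intro compactinD[OF C]) (use VK(1) in auto)
  then obtain I where I: "finite I" "C \<subseteq> \<Union> (V ` I)"
    by (metis finite_subset_image)
  have "compact (\<Union>p\<in>I. K p)" using I(1) VK(3) by (intro compact_UN) auto
  moreover have "{q. can P q \<in> C} \<subseteq> (\<Union>p\<in>I. K p)" using I(2) VK(4) by blast
  moreover have "closed {q. can P q \<in> C}"
    using closedin_continuous_map_preimage[OF continuous_can compactin_imp_closedin[OF Hausdorff_specQ C]]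
    by simp
  ultimately show ?thesis by (metis compact_closed_subset)
qed

lemma proper_can: "proper_map euclidean (specQ P) (can P)"
  by (rule compact_imp_proper_map)
    (auto simp: locally_compact_imp_k_space locally_compact_specQ Hausdorff_imp_kc_space Hausdorff_specQ
      continuous_can compact_can_preimage)

lemma quotient_can: "quotient_map euclidean (specQ P) (can P)"
  by (intro continuous_closed_imp_quotient_map continuous_can proper_imp_closed_map proper_can)
    (simp add: topspace_range)

lemma proper_can_prod:
  "proper_map euclidean (prod_topology (specQ P) (specQ P)) (\<lambda>(x, y). (can P x, can P y))"
  using proper_map_prod[of euclidean euclidean "specQ P" "specQ P" "can P" "can P"] proper_can
  by (simp add: euclidean_product_topology)

text \<open>Continuity of functions on \<open>Q \<times> Q\<close> may be tested on \<open>G \<times> G\<close>: products of proper maps are proper.\<close>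

lemma quotient_can_prod:
  "quotient_map euclidean (prod_topology (specQ P) (specQ P)) (\<lambda>(x, y). (can P x, can P y))"
proof (rule continuous_closed_imp_quotient_map)
  have "continuous_map euclidean (specQ P) (\<lambda>z. can P (fst z))" "continuous_map euclidean (specQ P) (\<lambda>z. can P (snd z))"
    using continuous_map_compose[of euclidean euclidean fst, OF _ continuous_can]
      continuous_map_compose[of euclidean euclidean snd, OF _ continuous_can]
    by (simp_all add: o_def continuous_map_iff_continuous2 continuous_on_fst continuous_on_snd continuous_on_id)
  then show "continuous_map euclidean (prod_topology (specQ P) (specQ P)) (\<lambda>(x, y). (can P x, can P y))"
    unfolding case_prod_unfold by (rule continuous_map_pairedI)
  show "closed_map euclidean (prod_topology (specQ P) (specQ P)) (\<lambda>(x, y). (can P x, can P y))"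
    by (rule proper_imp_closed_map[OF proper_can_prod])
  show "(\<lambda>(x, y). (can P x, can P y)) ` topspace euclidean = topspace (prod_topology (specQ P) (specQ P))"
    by (auto simp: topspace_range)
qed

lemma Cb_comp_can: "f \<in> Cb (specQ P) \<Longrightarrow> (\<lambda>p. f (can P p)) \<in> rangeP"
  unfolding rangeP_iff_fib
proof (intro conjI allI impI)
  assume f: "f \<in> Cb (specQ P)"
  have "continuous_map euclidean euclidean (f \<circ> can P)"
    using f by (intro continuous_map_compose[OF continuous_can]) (simp add: Cb_def)
  moreover have "bounded (f ` range (can P))" using f by (simp add: Cb_def topspace_range)
  ultimately show "(\<lambda>p. f (can P p)) \<in> Cb euclidean"
    by (simp add: Cb_def o_def image_image)
qed simp

end

section \<open>The comultiplication on the spectrum\<close>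

locale group_expectation = expectation P
  for P :: "('g::{topological_group_add, t2_space} \<Rightarrow>\<^sub>C complex) \<Rightarrow> ('g \<Rightarrow>\<^sub>C complex)" +
  assumes P_id_eq_id_P: "P_id P (apply_bcontfun (comult (P f))) = id_P P (apply_bcontfun (comult (P f)))"
    and id_P_eq_P_P: "id_P P (apply_bcontfun (comult (P f))) = P_P P (apply_bcontfun (comult f))"
    and P_check: "P (bc_check f) = bc_check (P f)"
begin

lemma translate_Cb:
  fixes f :: "'g \<Rightarrow> complex"
  assumes f: "f \<in> Cb euclidean"
  shows "(\<lambda>x. f (a + x)) \<in> Cb euclidean" "(\<lambda>x. f (x + a)) \<in> Cb euclidean" "(\<lambda>x. f (- x)) \<in> Cb euclidean"
proof -
  obtain c where c: "\<And>x. cmod (f x) \<le> c" using Cb_euclideanD(2)[OF f] by blast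
  note fc = Cb_euclideanD(1)[OF f]
  have "continuous_on UNIV (\<lambda>x. f (a + x))" "continuous_on UNIV (\<lambda>x. f (x + a))" "continuous_on UNIV (\<lambda>x. f (- x))"
    by (rule continuous_on_compose2[OF fc]; auto intro!: continuous_intros)+
  then show "(\<lambda>x. f (a + x)) \<in> Cb euclidean" "(\<lambda>x. f (x + a)) \<in> Cb euclidean" "(\<lambda>x. f (- x)) \<in> Cb euclidean"
    using c by (auto intro: Cb_euclideanI)
qed

text \<open>The equations between slice maps, spelled out at one point.\<close>

lemma E_comult:
  assumes f: "f \<in> Cb euclidean"
  shows "E b (\<lambda>y. E (a + y) f) = E a (\<lambda>x. E b (\<lambda>y. f (x + y)))"
  using fun_cong[OF id_P_eq_P_P[of "Bcontfun f"], of "(a, b)"]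
  by (simp add: id_P_def P_P_def P_id_def comult.rep_eq E_def apply_Bcontfun f)

lemma rangeP_comult:
  assumes u: "u \<in> rangeP"
  shows "E a (\<lambda>x. u (x + b)) = E b (\<lambda>y. u (a + y))"
    and "P_P P (apply_bcontfun (comult (Bcontfun u))) (a, b) = E b (\<lambda>y. u (a + y))"
proof -
  have Pu: "P (Bcontfun u) = Bcontfun u"
    by (rule bcontfun_eqI) (simp add: E_def[symmetric] rangeP_E[OF u] apply_Bcontfun[OF rangeP_Cb[OF u]])
  show "E a (\<lambda>x. u (x + b)) = E b (\<lambda>y. u (a + y))"
    using fun_cong[OF P_id_eq_id_P[of "Bcontfun u"], of "(a, b)"]
    by (simp add: Pu id_P_def P_id_def comult.rep_eq E_def apply_Bcontfun[OF rangeP_Cb[OF u]])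
  show "P_P P (apply_bcontfun (comult (Bcontfun u))) (a, b) = E b (\<lambda>y. u (a + y))"
    using fun_cong[OF id_P_eq_P_P[of "Bcontfun u"], of "(a, b)"]
    by (simp add: Pu id_P_def comult.rep_eq E_def apply_Bcontfun[OF rangeP_Cb[OF u]])
qed

text \<open>The average over the first variable does not change when \<open>a\<close> moves in its fibre, the average over
  the second one does not change when \<open>b\<close> does, and the two averages agree.\<close>

lemma rangeP_comult_fib:
  assumes u: "u \<in> rangeP" and a: "can P a = can P a'" and b: "can P b = can P b'"
  shows "E b (\<lambda>y. u (a + y)) = E b' (\<lambda>y. u (a' + y))"
proof -
  have "E b (\<lambda>y. u (a + y)) = E b' (\<lambda>y. u (a + y))" by (rule E_fib[OF b])
  also have "\<dots> = E a (\<lambda>x. u (x + b'))" by (rule rangeP_comult(1)[OF u, symmetric])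
  also have "\<dots> = E a' (\<lambda>x. u (x + b'))" by (rule E_fib[OF a])
  also have "\<dots> = E b' (\<lambda>y. u (a' + y))" by (rule rangeP_comult(1)[OF u])
  finally show ?thesis .
qed

lemma Q_comult_can:
  assumes f: "f \<in> Cb (specQ P)"
  shows "Q_comult P f (can P a, can P b) = E b (\<lambda>y. f (can P (a + y)))"
proof -
  let ?u = "\<lambda>p. f (can P p)"
  have inv: "can P (inv_into UNIV (can P) (can P p)) = can P p" for p
    by (rule f_inv_into_f) simp
  have "Q_comult P f (can P a, can P b) =
      P_P P (apply_bcontfun (comult (Bcontfun ?u))) (inv_into UNIV (can P) (can P a), inv_into UNIV (can P) (can P b))"
    by (simp add: Q_comult_def o_def)
  also have "\<dots> = E (inv_into UNIV (can P) (can P b)) (\<lambda>y. ?u (inv_into UNIV (can P) (can P a) + y))"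
    by (rule rangeP_comult(2)[OF Cb_comp_can[OF f]])
  also have "\<dots> = E b (\<lambda>y. ?u (a + y))"
    by (rule rangeP_comult_fib[OF Cb_comp_can[OF f] inv inv])
  finally show ?thesis .
qed

text \<open>The image of the sum of the two fibres, which turns out to be the support of \<open>\<epsilon>\<^sub>s * \<epsilon>\<^sub>t\<close>.\<close>

definition conv_supp :: "(('g \<Rightarrow>\<^sub>C complex) \<Rightarrow> complex) \<Rightarrow> (('g \<Rightarrow>\<^sub>C complex) \<Rightarrow> complex) \<Rightarrow>
    (('g \<Rightarrow>\<^sub>C complex) \<Rightarrow> complex) set" where
  "conv_supp s t = {can P (x + y) |x y. can P x = s \<and> can P y = t}"

text \<open>Near \<open>b\<close> all fibres stay in a fixed compact set \<open>K\<close>, over which \<open>u (a + y)\<close> varies little with \<open>a\<close>;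
  and for fixed \<open>a\<close> the average is continuous in \<open>b\<close>.\<close>

lemma Q_comult_Cb:
  assumes f: "f \<in> Cb (specQ P)"
  shows "Q_comult P f \<in> Cb (prod_topology (specQ P) (specQ P))"
proof -
  define u where "u p = f (can P p)" for p
  have uD: "u \<in> rangeP" unfolding u_def by (rule Cb_comp_can[OF f])
  note uCb = rangeP_Cb[OF uD] and tr = translate_Cb(1)[OF rangeP_Cb[OF uD]]
  obtain c where c: "\<And>x. cmod (u x) \<le> c" using Cb_euclideanD(2)[OF uCb] by blast
  have val: "Q_comult P f (can P a, can P b) = E b (\<lambda>y. u (a + y))" for a b
    unfolding u_def by (rule Q_comult_can[OF f])
  have "continuous_map euclidean euclidean (\<lambda>z. E (snd z) (\<lambda>y. u (fst z + y)))"
  proof (rule continuous_map_distI)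
    fix z :: "'g \<times> 'g" and \<epsilon> :: real assume \<epsilon>: "0 < \<epsilon>"
    obtain a b where z: "z = (a, b)" by (cases z)
    obtain V K where VK: "openin (specQ P) V" "can P b \<in> V" "compact K" "\<And>q. can P q \<in> V \<Longrightarrow> q \<in> K"
      using specQ_neighbourhood by blast
    have "continuous_on UNIV (\<lambda>z. u (fst z + snd z))"
      by (rule continuous_on_compose2[OF Cb_euclideanD(1)[OF uCb]])
        (auto intro!: continuous_intros)
    then have "continuous_map (prod_topology euclidean euclidean) euclidean (\<lambda>z. u (fst z + snd z))"
      by (simp add: euclidean_product_topology continuous_map_iff_continuous2)
    from uniform_over_compact_right[OF this, of K a "\<epsilon>/2"]
    obtain U where U: "open U" "a \<in> U" "\<And>a' y. a' \<in> U \<Longrightarrow> y \<in> K \<Longrightarrow> dist (u (a' + y)) (u (a + y)) < \<epsilon>/2"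
      using VK(3) \<epsilon> by auto
    have "continuous_map euclidean euclidean (\<lambda>b. E b (\<lambda>y. u (a + y)))"
      using E_Cb unfolding Cb_def by blast
    from continuous_map_distD[OF this, of b "\<epsilon>/2"]
    obtain W where W: "open W" "b \<in> W" "\<And>b'. b' \<in> W \<Longrightarrow> dist (E b' (\<lambda>y. u (a + y))) (E b (\<lambda>y. u (a + y))) < \<epsilon>/2"
      using \<epsilon> by auto
    have V': "open {q. can P q \<in> V}"
      using openin_continuous_map_preimage[OF continuous_can VK(1)] by simp
    show "\<exists>N. openin euclidean N \<and> z \<in> N \<and> (\<forall>z'\<in>N. dist (E (snd z') (\<lambda>y. u (fst z' + y))) (E (snd z) (\<lambda>y. u (fst z + y))) < \<epsilon>)"
    proof (intro exI[of _ "U \<times> (W \<inter> {q. can P q \<in> V})"] conjI ballI)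
      show "openin euclidean (U \<times> (W \<inter> {q. can P q \<in> V}))" using U(1) W(1) V' by (simp add: open_Times open_Int)
      show "z \<in> U \<times> (W \<inter> {q. can P q \<in> V})" using z U(2) W(2) VK(2) by simp
      fix z' assume "z' \<in> U \<times> (W \<inter> {q. can P q \<in> V})"
      then obtain a' b' where z': "z' = (a', b')" "a' \<in> U" "b' \<in> W" "can P b' \<in> V" by auto
      have "cmod (E b' (\<lambda>y. u (a' + y) - u (a + y))) \<le> \<epsilon>/2"
      proof (rule E_norm_le_fib[OF Cb_diff[OF tr tr]])
        fix q assume "can P q = can P b'"
        then have "q \<in> K" using VK(4) z'(4) by simp
        then show "cmod (u (a' + q) - u (a + q)) \<le> \<epsilon>/2" using U(3)[OF z'(2)] by (simp add: dist_norm less_imp_le)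
      qed
      then have "dist (E b' (\<lambda>y. u (a' + y))) (E b' (\<lambda>y. u (a + y))) \<le> \<epsilon>/2"
        by (simp add: dist_norm E.diff[OF tr tr])
      then have "dist (E b' (\<lambda>y. u (a' + y))) (E b (\<lambda>y. u (a + y))) < \<epsilon>"
        using W(3)[OF z'(3)] dist_triangle[of "E b' (\<lambda>y. u (a' + y))" "E b (\<lambda>y. u (a + y))" "E b' (\<lambda>y. u (a + y))"] by linarith
      then show "dist (E (snd z') (\<lambda>y. u (fst z' + y))) (E (snd z) (\<lambda>y. u (fst z + y))) < \<epsilon>"
        by (simp add: z z'(1))
    qed
  qed
  also have "(\<lambda>z. E (snd z) (\<lambda>y. u (fst z + y))) = Q_comult P f \<circ> (\<lambda>(x, y). (can P x, can P y))"
    by (auto simp: val fun_eq_iff)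
  finally have "continuous_map (prod_topology (specQ P) (specQ P)) euclidean (Q_comult P f)"
    by (rule continuous_compose_quotient_map[OF quotient_can_prod])
  moreover have "bounded (Q_comult P f ` topspace (prod_topology (specQ P) (specQ P)))"
    using c E_norm_le_const[OF tr] by (intro boundedI[where B = c]) (auto simp: topspace_range val)
  ultimately show ?thesis by (simp add: Cb_def)
qed

lemma Q_unit_eq: "Q_unit P = can P 0"
  by (simp add: Q_unit_def can_def)

lemma check_algB: "b \<in> algB P \<Longrightarrow> bc_check b \<in> algB P"
proof -
  assume "b \<in> algB P"
  then obtain x where x: "b = P x" "apply_bcontfun x \<in> C0 euclidean" unfolding algB_def by auto
  have xc: "continuous_on UNIV (apply_bcontfun x)" by auto
  have "apply_bcontfun (bc_check x) \<in> C0 euclidean"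
    unfolding C0_euclidean_iff
  proof (intro conjI allI impI)
    fix r :: real assume "r > 0"
    then have "compact {p. r \<le> cmod (apply_bcontfun x p)}" using x(2) by (simp add: C0_euclidean_iff)
    then have "compact (uminus ` {p. r \<le> cmod (apply_bcontfun x p)})"
      by (intro compact_continuous_image continuous_intros)
    moreover have "uminus ` {p. r \<le> cmod (apply_bcontfun x p)} = {p. r \<le> cmod (apply_bcontfun (bc_check x) p)}"
      by (auto simp: bc_check.rep_eq image_iff) (metis add.inverse_inverse)
    ultimately show "compact {p. r \<le> cmod (apply_bcontfun (bc_check x) p)}" by simp
  qed auto
  then have "P (bc_check x) \<in> algB P" unfolding algB_def by blast
  then show "bc_check b \<in> algB P" by (simp add: x(1) P_check)
qed

lemma Q_check_can: "Q_check P (can P p) = can P (- p)"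
  by (auto simp: Q_check_def can_def check_algB bc_check.rep_eq)

lemma E_check: "f \<in> Cb euclidean \<Longrightarrow> E p (\<lambda>x. f (- x)) = E (- p) f"
proof -
  assume f: "f \<in> Cb euclidean"
  have "(\<lambda>x. f (- x)) = apply_bcontfun (bc_check (Bcontfun f))"
    by (simp add: fun_eq_iff bc_check.rep_eq apply_Bcontfun[OF f])
  then have "E p (\<lambda>x. f (- x)) = apply_bcontfun (P (bc_check (Bcontfun f))) p" by (simp only: E_apply)
  then show ?thesis by (simp add: P_check bc_check.rep_eq E_def)
qed

lemma Q_check_homeomorphic: "homeomorphic_map (specQ P) (specQ P) (Q_check P)"
proof -
  have "continuous_map euclidean euclidean (uminus :: 'g \<Rightarrow> 'g)"
    by (simp add: continuous_map_iff_continuous2 continuous_intros)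
  from continuous_map_compose[OF this continuous_can]
  have "continuous_map euclidean (specQ P) (Q_check P \<circ> can P)"
    by (simp add: o_def Q_check_can)
  then have "continuous_map (specQ P) (specQ P) (Q_check P)"
    by (rule continuous_compose_quotient_map[OF quotient_can])
  then have "homeomorphic_maps (specQ P) (specQ P) (Q_check P) (Q_check P)"
    by (auto simp: homeomorphic_maps_def topspace_range Q_check_can)
  then show ?thesis by (rule homeomorphic_maps_imp_map)
qed

lemma compact_sum_image:
  assumes "compact A" "compact B"
  shows "compactin (specQ P) (can P ` {x + y |x y. x \<in> A \<and> y \<in> B})"
proof -
  have "{x + y |x y. x \<in> A \<and> y \<in> B} = (\<lambda>z. fst z + snd z) ` (A \<times> B)" by force
  moreover have "compact ((\<lambda>z. fst z + snd z) ` (A \<times> B))"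
    by (intro compact_continuous_image compact_Times assms continuous_intros)
  ultimately show ?thesis by (intro image_compactin[OF _ continuous_can]) simp
qed

lemma fib_compact: "compact {q. can P q = s}"
proof (cases "s \<in> topspace (specQ P)")
  case True
  then show ?thesis using compact_can_preimage[of "{s}"] by simp
next
  case False
  then have "{q. can P q = s} = {}" using can_in_topspace by blast
  then show ?thesis by simp
qed

lemma conv_supp_eq: "conv_supp s t = can P ` {x + y |x y. x \<in> {q. can P q = s} \<and> y \<in> {q. can P q = t}}"
  unfolding conv_supp_def by blast

text \<open>The complement is the image of a closed set under the closed map \<open>\<phi> \<times> \<phi>\<close>.\<close>

lemma conv_supp_upper:
  assumes W: "openin (specQ P) W"
  shows "openin (prod_topology (specQ P) (specQ P))
    {p \<in> topspace (prod_topology (specQ P) (specQ P)). conv_supp (fst p) (snd p) \<subseteq> W}"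
proof -
  let ?XX = "prod_topology (specQ P) (specQ P)" and ?c = "\<lambda>(x, y). (can P x, can P y)"
  define Z where "Z = {z :: 'g \<times> 'g. can P (fst z + snd z) \<notin> W}"
  have "open {p. can P p \<in> W}"
    using openin_continuous_map_preimage[OF continuous_can W] by simp
  then have "open ((\<lambda>z :: 'g \<times> 'g. fst z + snd z) -` {p. can P p \<in> W})"
    by (rule open_vimage) (intro continuous_intros)
  then have "closed Z" by (simp add: Z_def closed_def vimage_def Collect_neg_eq[symmetric])
  then have "closedin ?XX (?c ` Z)"
    using proper_imp_closed_map[OF proper_can_prod] by (simp add: closed_map_def)
  moreover have "{p \<in> topspace ?XX. conv_supp (fst p) (snd p) \<subseteq> W} = topspace ?XX - ?c ` Z"
  proof (intro set_eqI iffI)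
    fix p assume "p \<in> {p \<in> topspace ?XX. conv_supp (fst p) (snd p) \<subseteq> W}"
    then have p: "p \<in> topspace ?XX" "conv_supp (fst p) (snd p) \<subseteq> W" by auto
    have "p \<noteq> (can P x, can P y)" if "(x, y) \<in> Z" for x y
    proof
      assume "p = (can P x, can P y)"
      then have "can P (x + y) \<in> conv_supp (fst p) (snd p)" unfolding conv_supp_def by auto
      then show False using p(2) that by (auto simp: Z_def)
    qed
    then show "p \<in> topspace ?XX - ?c ` Z" using p(1) by auto
  next
    fix p assume p: "p \<in> topspace ?XX - ?c ` Z"
    have "can P (x + y) \<in> W" if "can P x = fst p" "can P y = snd p" for x y
    proof (rule ccontr)
      assume "can P (x + y) \<notin> W"
      then have "?c (x, y) \<in> ?c ` Z" by (intro imageI) (simp add: Z_def)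
      then show False using p that by simp
    qed
    then show "p \<in> {p \<in> topspace ?XX. conv_supp (fst p) (snd p) \<subseteq> W}"
      using p by (auto simp: conv_supp_def)
  qed
  ultimately show ?thesis by (simp only: openin_diff openin_topspace)
qed

text \<open>The average \<open>f \<mapsto> E b (\<lambda>y. f (a + y))\<close> has support \<open>can P ` (a + fibre of b)\<close>, since \<open>E b\<close> has full
  support on the fibre of \<open>b\<close>; moving \<open>a\<close> through its fibre does not change it.\<close>

lemma Q_comult_zero_iff:
  assumes f: "f \<in> Cb (specQ P)" and pos: "\<And>x. x \<in> topspace (specQ P) \<Longrightarrow> f x \<in> \<real>\<^sub>\<ge>\<^sub>0"
  shows "Q_comult P f (can P a, can P b) = 0 \<longleftrightarrow> (\<forall>x\<in>conv_supp (can P a) (can P b). f x = 0)"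
proof
  note uD = Cb_comp_can[OF f]
  note tr = translate_Cb(1)[OF rangeP_Cb[OF uD]]
  assume z: "Q_comult P f (can P a, can P b) = 0"
  show "\<forall>x\<in>conv_supp (can P a) (can P b). f x = 0"
  proof
    fix w assume "w \<in> conv_supp (can P a) (can P b)"
    then obtain x y where w: "w = can P (x + y)" "can P x = can P a" "can P y = can P b"
      unfolding conv_supp_def by blast
    have "E b (\<lambda>y. f (can P (x + y))) = 0" using z w(2) Q_comult_can[OF f, of x b] by simp
    then show "f w = 0"
      using E_nonzero[OF tr[of x], of y b] pos w by auto
  qed
next
  note tr = translate_Cb(1)[OF rangeP_Cb[OF Cb_comp_can[OF f]]]
  assume z: "\<forall>x\<in>conv_supp (can P a) (can P b). f x = 0"
  have "E b (\<lambda>y. f (can P (a + y))) = 0"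
  proof (rule E_zero_on_fib[OF tr])
    fix q assume "can P q = can P b"
    then have "can P (a + q) \<in> conv_supp (can P a) (can P b)" unfolding conv_supp_def by blast
    then show "f (can P (a + q)) = 0" using z by blast
  qed
  then show "Q_comult P f (can P a, can P b) = 0" by (simp add: Q_comult_can[OF f])
qed

text \<open>Convolving with the unit does nothing, so the fibre of the unit is absorbed by every fibre.\<close>

lemma conv_supp_unit:
  assumes "w \<in> conv_supp (can P b) (can P 0)"
  shows "w = can P b"
proof (rule ccontr)
  assume ne: "w \<noteq> can P b"
  have w: "w \<in> topspace (specQ P)" using assms unfolding conv_supp_def by auto
  have U: "openin (specQ P) (topspace (specQ P) - {can P b})"
    by (simp add: openin_diff closedin_t1_singleton Hausdorff_imp_t1_space Hausdorff_specQ)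
  have wU: "w \<in> topspace (specQ P) - {can P b}" using w ne by simp
  obtain g where g: "g \<in> Cb (specQ P)" "\<And>y. y \<in> topspace (specQ P) \<Longrightarrow> g y \<in> \<real>\<^sub>\<ge>\<^sub>0" "g w = 1"
      "\<And>y. y \<in> topspace (specQ P) - (topspace (specQ P) - {can P b}) \<Longrightarrow> g y = 0"
    using Cb_bump[OF locally_compact_specQ Hausdorff_specQ U wU] by metis
  have "Q_comult P g (can P b, can P 0) = E b (\<lambda>x. g (can P x))"
    unfolding Q_comult_can[OF g(1)] using rangeP_comult(1)[OF Cb_comp_can[OF g(1)], of b 0] by simp
  also have "\<dots> = g (can P b)" by (rule rangeP_E[OF Cb_comp_can[OF g(1)]])
  also have "\<dots> = 0" using g(4)[of "can P b"] by simp
  finally have "g w = 0" using Q_comult_zero_iff[OF g(1,2)] assms by simp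
  then show False using g(3) by simp
qed

text \<open>Coassociativity holds because both sides average \<open>u (a + y + z)\<close> over the fibres of \<open>b\<close> and \<open>c\<close>, one
  of them after rewriting an average over a single fibre as one over two.\<close>

sublocale Q: comultiplication "specQ P" "Q_comult P" conv_supp "Q_unit P" "Q_check P"
proof
  let ?X = "specQ P"
  show "locally_compact_space ?X" by (rule locally_compact_specQ)
  show "Hausdorff_space ?X" by (rule Hausdorff_specQ)
  show "Q_comult P f \<in> Cb (prod_topology ?X ?X)" if "f \<in> Cb ?X" for f using that by (rule Q_comult_Cb)
  note tr = translate_Cb(1)[OF rangeP_Cb[OF Cb_comp_can]]
  show "Q_comult P (\<lambda>x. f x + g x) (s, t) = Q_comult P f (s, t) + Q_comult P g (s, t)"
    if "f \<in> Cb ?X" "g \<in> Cb ?X" "s \<in> topspace ?X" "t \<in> topspace ?X" for f g s t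
    using that by (auto simp: topspace_range Q_comult_can Cb_add E_add tr)
  show "Q_comult P (\<lambda>x. c * f x) (s, t) = c * Q_comult P f (s, t)"
    if "f \<in> Cb ?X" "s \<in> topspace ?X" "t \<in> topspace ?X" for f c s t
    using that by (auto simp: topspace_range Q_comult_can Cb_scale E_scale tr)
  show "Q_comult P (\<lambda>x. 1) (s, t) = 1" if "s \<in> topspace ?X" "t \<in> topspace ?X" for s t
    using that by (auto simp: topspace_range Q_comult_can Cb_const E_one)
  show "Q_comult P f (s, t) \<in> \<real>\<^sub>\<ge>\<^sub>0"
    if f: "f \<in> Cb ?X" and pos: "\<And>x. x \<in> topspace ?X \<Longrightarrow> f x \<in> \<real>\<^sub>\<ge>\<^sub>0"
      and st: "s \<in> topspace ?X" "t \<in> topspace ?X" for f s t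
  proof -
    obtain a b where ab: "s = can P a" "t = can P b" using st by (auto simp: topspace_range)
    show ?thesis unfolding ab Q_comult_can[OF f] by (rule E_pos[OF tr[OF f]]) (simp add: pos)
  qed
  show "Q_comult P f (s, t) = 0 \<longleftrightarrow> (\<forall>x\<in>conv_supp s t. f x = 0)"
    if f: "f \<in> Cb ?X" and pos: "\<And>x. x \<in> topspace ?X \<Longrightarrow> f x \<in> \<real>\<^sub>\<ge>\<^sub>0"
      and st: "s \<in> topspace ?X" "t \<in> topspace ?X" for f s t
  proof -
    obtain a b where ab: "s = can P a" "t = can P b" using st by (auto simp: topspace_range)
    show ?thesis unfolding ab by (rule Q_comult_zero_iff[OF f pos])
  qed
  show "compactin ?X (conv_supp s t)" if "s \<in> topspace ?X" "t \<in> topspace ?X" for s t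
    unfolding conv_supp_eq by (intro compact_sum_image fib_compact)
  show "\<exists>C. compactin ?X C \<and> (\<forall>s\<in>K. \<forall>t\<in>L. conv_supp s t \<subseteq> C)" if "compactin ?X K" "compactin ?X L" for K L
  proof (intro exI conjI ballI)
    show "compactin ?X (can P ` {x + y |x y. x \<in> {q. can P q \<in> K} \<and> y \<in> {q. can P q \<in> L}})"
      using that by (intro compact_sum_image compact_can_preimage)
    show "conv_supp s t \<subseteq> can P ` {x + y |x y. x \<in> {q. can P q \<in> K} \<and> y \<in> {q. can P q \<in> L}}"
      if "s \<in> K" "t \<in> L" for s t
      using that unfolding conv_supp_def by blast
  qed
  show "openin (prod_topology ?X ?X) {p \<in> topspace (prod_topology ?X ?X). conv_supp (fst p) (snd p) \<subseteq> W}"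
    if "openin ?X W" for W using that by (rule conv_supp_upper)
  show "Q_comult P (\<lambda>x. Q_comult P f (x, r)) (s, t) = Q_comult P (\<lambda>x. Q_comult P f (s, x)) (t, r)"
    if f: "f \<in> Cb ?X" and str: "s \<in> topspace ?X" "t \<in> topspace ?X" "r \<in> topspace ?X" for f s t r
  proof -
    obtain a b c where abc: "s = can P a" "t = can P b" "r = can P c"
      using str by (auto simp: topspace_range)
    define u where "u p = f (can P p)" for p
    have uD: "u \<in> rangeP" unfolding u_def by (rule Cb_comp_can[OF f])
    have left: "Q_comult P f (can P p, can P q) = E q (\<lambda>y. u (p + y))" for p q
      unfolding u_def by (rule Q_comult_can[OF f])
    have "Q_comult P (\<lambda>x. Q_comult P f (x, r)) (s, t) = E b (\<lambda>y. E c (\<lambda>z. u (a + y + z)))"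
      unfolding abc using Q_comult_can[OF Cb_slice_left[OF Q_comult_Cb[OF f]], of "can P c" a b]
      by (simp add: left)
    also have "\<dots> = E b (\<lambda>y. E c (\<lambda>z. u (a + (y + z))))" by (simp add: add.assoc)
    also have "\<dots> = E c (\<lambda>z. E (b + z) (\<lambda>y. u (a + y)))"
      by (rule E_comult[OF translate_Cb(1)[OF rangeP_Cb[OF uD]], symmetric])
    also have "\<dots> = Q_comult P (\<lambda>x. Q_comult P f (s, x)) (t, r)"
      unfolding abc using Q_comult_can[OF Cb_slice_right[OF Q_comult_Cb[OF f]], of "can P a" b c]
      by (simp add: left)
    finally show ?thesis .
  qed
  show "Q_unit P \<in> topspace ?X" by (simp add: Q_unit_eq)
  show "Q_comult P f (Q_unit P, s) = f s" "Q_comult P f (s, Q_unit P) = f s"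
    if f: "f \<in> Cb ?X" and s: "s \<in> topspace ?X" for f s
  proof -
    obtain a where a: "s = can P a" using s by (auto simp: topspace_range)
    note uD = Cb_comp_can[OF f]
    show "Q_comult P f (Q_unit P, s) = f s"
      by (simp add: Q_unit_eq a Q_comult_can[OF f] rangeP_E[OF uD])
    show "Q_comult P f (s, Q_unit P) = f s"
      using rangeP_comult(1)[OF uD, of a 0] by (simp add: Q_unit_eq a Q_comult_can[OF f] rangeP_E[OF uD])
  qed
  show "homeomorphic_map ?X ?X (Q_check P)" by (rule Q_check_homeomorphic)
  show "Q_check P (Q_check P s) = s" if "s \<in> topspace ?X" for s
    using that by (auto simp: topspace_range Q_check_can)
  show "Q_comult P (f \<circ> Q_check P) (s, t) = Q_comult P f (Q_check P t, Q_check P s)"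
    if f: "f \<in> Cb ?X" and st: "s \<in> topspace ?X" "t \<in> topspace ?X" for f s t
  proof -
    obtain a b where ab: "s = can P a" "t = can P b" using st by (auto simp: topspace_range)
    have cont: "continuous_map ?X ?X (Q_check P)"
      by (rule homeomorphic_imp_continuous_map[OF Q_check_homeomorphic])
    have "bounded (f ` topspace ?X)" using f by (simp add: Cb_def)
    then have "bounded ((f \<circ> Q_check P) ` topspace ?X)"
      by (rule bounded_subset) (auto simp: topspace_range Q_check_can)
    then have fc: "f \<circ> Q_check P \<in> Cb ?X"
      using f continuous_map_compose[OF cont] by (auto simp: Cb_def)
    define u where "u p = f (can P p)" for p
    have uD: "u \<in> rangeP" unfolding u_def by (rule Cb_comp_can[OF f])
    have "Q_comult P (f \<circ> Q_check P) (s, t) = E b (\<lambda>y. u (- y + - a))"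
      unfolding ab by (simp add: Q_comult_can[OF fc] Q_check_can u_def minus_add)
    also have "\<dots> = E (- b) (\<lambda>y. u (y + - a))"
      by (rule E_check[OF translate_Cb(2)[OF rangeP_Cb[OF uD]]])
    also have "\<dots> = E (- a) (\<lambda>y. u (- b + y))" by (rule rangeP_comult(1)[OF uD])
    also have "\<dots> = Q_comult P f (Q_check P t, Q_check P s)"
      unfolding ab by (simp add: Q_check_can Q_comult_can[OF f] u_def)
    finally show ?thesis .
  qed
  show "Q_unit P \<in> conv_supp s t \<longleftrightarrow> s = Q_check P t" if st: "s \<in> topspace ?X" "t \<in> topspace ?X" for s t
  proof
    obtain b where b: "t = can P b" using st by (auto simp: topspace_range)
    {
      assume "s = Q_check P t"
      then have "s = can P (- b)" by (simp add: b Q_check_can)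
      then have "can P (- b + b) \<in> conv_supp s t" unfolding conv_supp_def b by blast
      then show "Q_unit P \<in> conv_supp s t" by (simp add: Q_unit_eq)
    next
      assume "Q_unit P \<in> conv_supp s t"
      then obtain x y where xy: "can P (x + y) = can P 0" "can P x = s" "can P y = t"
        unfolding conv_supp_def Q_unit_eq by auto
      \<comment> \<open>The point \<open>x + y\<close> lies over the unit, so adding it to \<open>- x\<close> stays in the fibre of \<open>- x\<close>.\<close>
      have "can P (- x + (x + y)) \<in> conv_supp (can P (- x)) (can P 0)"
        using xy(1) unfolding conv_supp_def by blast
      then have "can P y = can P (- x)" using conv_supp_unit by (simp add: add.assoc[symmetric])
      then have "Q_check P t = can P (- (- x))" using xy(3) Q_check_can by metis
      then show "s = Q_check P t" using xy(2) by simp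
    }
  qed
qed

lemma is_Q_conv_iff: "is_Q_conv P \<mu> \<nu> \<kappa> \<longleftrightarrow> Q.is_conv \<mu> \<nu> \<kappa>"
  unfolding is_Q_conv_def Q.is_conv_def ..

lemma Q_conv_eq: "Q_conv P = Q.conv"
  by (simp add: fun_eq_iff Q_conv_def Q.conv_def is_Q_conv_iff)

section \<open>Haar measure\<close>

lemma can_measurable:
  assumes "sets m = sets (borel_of (euclidean :: 'g topology))"
  shows "can P \<in> measurable m (borel_of (specQ P))"
proof -
  have "can P \<in> measurable (borel_of euclidean) (borel_of (specQ P))"
    unfolding borel_of_def[of "specQ P"]
  proof (rule measurable_measure_of)
    fix U assume "U \<in> {U. openin (specQ P) U}"
    then have "openin euclidean {x \<in> topspace euclidean. can P x \<in> U}"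
      using openin_continuous_map_preimage[OF continuous_can] by blast
    then show "can P -` U \<inter> space (borel_of euclidean) \<in> sets (borel_of euclidean)"
      using openin_borel_of[of euclidean "{x. can P x \<in> U}"] by (simp add: vimage_def)
  qed (auto dest: openin_subset)
  then show ?thesis using assms by (simp cong: measurable_cong_sets)
qed

text \<open>The fibre map is proper, so images and preimages of the approximating compact and open sets serve
  for the image measure.\<close>

lemma radon_measure_distr_can:
  assumes m: "radon_measure euclidean m"
  shows "radon_measure (specQ P) (distr m (borel_of (specQ P)) (can P))" (is "radon_measure ?X ?m")
proof -
  have sets_m: "sets m = sets (borel_of euclidean)" using m by (simp add: radon_measure_def)
  have sp: "space m = UNIV" using sets_eq_imp_space_eq[OF sets_m] by simp
  note meas = can_measurable[OF sets_m]
  have em: "emeasure ?m A = emeasure m {p. can P p \<in> A}" if "A \<in> sets (borel_of ?X)" for A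
    using that by (simp add: emeasure_distr[OF meas] sp vimage_def)
  have closed_can: "closedin ?X (can P ` C)" if "closed C" for C
    using proper_imp_closed_map[OF proper_can] that by (simp add: closed_map_def)
  show ?thesis
    unfolding radon_measure_def
  proof (intro conjI allI impI ballI)
    show "sets ?m = sets (borel_of ?X)" by simp
    fix K assume K: "compactin ?X K"
    then have "K \<in> sets (borel_of ?X)" by (intro closedin_borel_of compactin_imp_closedin[OF Hausdorff_specQ])
    then show "emeasure ?m K < \<infinity>"
      using m compact_can_preimage[OF K] by (simp add: em radon_measure_def)
  next
    fix A assume "A \<in> sets ?m"
    then have A: "A \<in> sets (borel_of ?X)" by simp
    have pre: "{p. can P p \<in> A} \<in> sets m"
      using measurable_sets[OF meas A] by (simp add: sp vimage_def)
    show "emeasure ?m A = (INF U\<in>{U. openin ?X U \<and> A \<subseteq> U}. emeasure ?m U)"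
    proof (rule antisym)
      show "emeasure ?m A \<le> (INF U\<in>{U. openin ?X U \<and> A \<subseteq> U}. emeasure ?m U)"
        by (rule INF_greatest) (auto intro!: emeasure_mono simp: openin_borel_of)
      have "(INF U\<in>{U. openin ?X U \<and> A \<subseteq> U}. emeasure ?m U) \<le> emeasure m U"
        if U: "open U" "{p. can P p \<in> A} \<subseteq> U" for U
      proof -
        have V: "openin ?X (topspace ?X - can P ` (- U))"
          using closed_can[of "- U"] U(1) by (simp add: openin_diff closed_Compl)
        have "A \<subseteq> topspace ?X - can P ` (- U)" using U(2) borel_of_subset[OF A] by auto
        then have "(INF U\<in>{U. openin ?X U \<and> A \<subseteq> U}. emeasure ?m U) \<le> emeasure ?m (topspace ?X - can P ` (- U))"
          using V by (intro INF_lower) auto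
        also have "\<dots> = emeasure m {p. can P p \<in> topspace ?X - can P ` (- U)}" by (rule em[OF openin_borel_of[OF V]])
        also have "\<dots> \<le> emeasure m U"
          using U(1) openin_borel_of[of euclidean U] by (intro emeasure_mono) (auto simp: sets_m)
        finally show ?thesis .
      qed
      then have "(INF U\<in>{U. openin ?X U \<and> A \<subseteq> U}. emeasure ?m U) \<le>
          (INF U\<in>{U. openin euclidean U \<and> {p. can P p \<in> A} \<subseteq> U}. emeasure m U)"
        by (intro INF_greatest) auto
      also have "\<dots> = emeasure ?m A" using m pre by (simp add: radon_measure_def em[OF A])
      finally show "(INF U\<in>{U. openin ?X U \<and> A \<subseteq> U}. emeasure ?m U) \<le> emeasure ?m A" .
    qed
  next
    fix U assume U: "openin ?X U"
    have pre: "openin euclidean {p. can P p \<in> U}"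
      using openin_continuous_map_preimage[OF continuous_can U] by simp
    show "emeasure ?m U = (SUP K\<in>{K. compactin ?X K \<and> K \<subseteq> U}. emeasure ?m K)"
    proof (rule antisym)
      show "(SUP K\<in>{K. compactin ?X K \<and> K \<subseteq> U}. emeasure ?m K) \<le> emeasure ?m U"
        by (rule SUP_least) (auto intro!: emeasure_mono simp: openin_borel_of U)
      have "emeasure ?m U = emeasure m {p. can P p \<in> U}" by (rule em[OF openin_borel_of[OF U]])
      also have "\<dots> = (SUP K\<in>{K. compactin euclidean K \<and> K \<subseteq> {p. can P p \<in> U}}. emeasure m K)"
        using m pre unfolding radon_measure_def by blast
      also have "\<dots> \<le> (SUP K\<in>{K. compactin ?X K \<and> K \<subseteq> U}. emeasure ?m K)"
      proof (rule SUP_least)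
        fix K assume "K \<in> {K. compactin euclidean K \<and> K \<subseteq> {p. can P p \<in> U}}"
        then have K: "compact K" "can P ` K \<subseteq> U" by auto
        have cK: "compactin ?X (can P ` K)" using K(1) by (intro image_compactin[OF _ continuous_can]) simp
        have B: "can P ` K \<in> sets (borel_of ?X)"
          by (rule closedin_borel_of[OF compactin_imp_closedin[OF Hausdorff_specQ cK]])
        have "emeasure m K \<le> emeasure m {p. can P p \<in> can P ` K}"
          using measurable_sets[OF meas B] by (intro emeasure_mono) (auto simp: sp vimage_def)
        also have "\<dots> = emeasure ?m (can P ` K)" by (rule em[OF B, symmetric])
        also have "\<dots> \<le> (SUP K\<in>{K. compactin ?X K \<and> K \<subseteq> U}. emeasure ?m K)"
          using K(2) cK by (intro SUP_upper) auto
        finally show "emeasure m K \<le> (SUP K\<in>{K. compactin ?X K \<and> K \<subseteq> U}. emeasure ?m K)" .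
      qed
      finally show "emeasure ?m U \<le> (SUP K\<in>{K. compactin ?X K \<and> K \<subseteq> U}. emeasure ?m K)" .
    qed
  qed
qed

lemma integral_left_translate:
  fixes u :: "'g \<Rightarrow> complex"
  assumes m: "group_left_haar m" and u: "continuous_on UNIV u"
  shows "(\<integral>p. u (a + p) \<partial>m) = (\<integral>p. u p \<partial>m)"
proof -
  have sets_m: "sets m = sets (borel_of euclidean)" using m by (simp add: group_left_haar_def radon_measure_def)
  have sp: "space m = UNIV" using sets_eq_imp_space_eq[OF sets_m] by simp
  have "(+) a \<in> measurable (borel_of euclidean) (borel_of euclidean)"
    unfolding borel_of_def[of "euclidean :: 'g topology"]
  proof (rule measurable_measure_of)
    fix U assume "U \<in> {U. openin (euclidean :: 'g topology) U}"
    then have "open ((+) a -` U)" by (intro open_vimage continuous_intros) auto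
    then show "(+) a -` U \<inter> space (sigma (topspace euclidean) {U. openin (euclidean :: 'g topology) U})
        \<in> sets (sigma (topspace euclidean) {U. openin (euclidean :: 'g topology) U})"
      using openin_borel_of[of euclidean "(+) a -` U"] by (simp add: borel_of_def)
  qed auto
  then have meas: "(+) a \<in> measurable m m" using sets_m by (simp cong: measurable_cong_sets)
  have "distr m m ((+) a) = m"
  proof (rule measure_eqI)
    fix A assume "A \<in> sets (distr m m ((+) a))"
    then have A: "A \<in> sets m" by simp
    have "emeasure (distr m m ((+) a)) A = emeasure m ((+) a -` A)"
      using A by (simp add: emeasure_distr[OF meas] sp)
    also have "(+) a -` A = (+) (- a) ` A"
    proof (intro set_eqI iffI)
      fix x assume "x \<in> (+) a -` A"
      then show "x \<in> (+) (- a) ` A" by (intro image_eqI[of _ _ "a + x"]) (auto simp: add.assoc[symmetric])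
    qed (auto simp: add.assoc[symmetric])
    also have "emeasure m ((+) (- a) ` A) = emeasure m A" using m A by (simp add: group_left_haar_def)
    finally show "emeasure (distr m m ((+) a)) A = emeasure m A" .
  qed simp
  moreover have "u \<in> borel_measurable m"
    using continuous_map_borel_measurable[of euclidean u] u
    by (simp add: continuous_map_iff_continuous2 measurable_cong_sets[OF sets_m refl])
  ultimately show ?thesis using integral_distr[OF meas, of u] by simp
qed

lemma integral_distr_can:
  fixes f :: "(('g \<Rightarrow>\<^sub>C complex) \<Rightarrow> complex) \<Rightarrow> complex"
  assumes "sets m = sets (borel_of (euclidean :: 'g topology))" "continuous_map (specQ P) euclidean f"
  shows "(\<integral>s. f s \<partial>distr m (borel_of (specQ P)) (can P)) = (\<integral>p. f (can P p) \<partial>m)"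
  by (rule integral_distr[OF can_measurable[OF assms(1)] continuous_map_borel_measurable[OF assms(2)]])

text \<open>Convolution with \<open>\<epsilon>\<^sub>s\<close> corresponds to \<open>P\<close> applied to a left translate, and \<open>m\<close> is invariant under
  both operations.\<close>

lemma left_haar_distr_can:
  assumes m: "group_left_haar m"
    and inv: "\<And>f. apply_bcontfun f \<in> Kc euclidean \<Longrightarrow>
      (\<integral>p. apply_bcontfun (P f) p \<partial>m) = (\<integral>p. apply_bcontfun f p \<partial>m)"
  shows "hypergroup_left_haar (specQ P) (Q_conv P) (distr m (borel_of (specQ P)) (can P))"
    (is "hypergroup_left_haar ?X _ ?m")
  unfolding hypergroup_left_haar_def
proof (intro conjI ballI)
  have radon: "radon_measure euclidean m" using m by (simp add: group_left_haar_def)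
  then have sets_m: "sets m = sets (borel_of euclidean)" by (simp add: radon_measure_def)
  have sp: "space m = UNIV" using sets_eq_imp_space_eq[OF sets_m] by simp
  show "radon_measure ?X ?m" by (rule radon_measure_distr_can[OF radon])
  have "can P -` topspace ?X = UNIV" by auto
  then show "emeasure ?m (topspace ?X) \<noteq> 0"
    using m by (simp add: emeasure_distr[OF can_measurable[OF sets_m]] sp group_left_haar_def)
  fix s f assume s: "s \<in> topspace ?X" and f: "f \<in> Kc ?X"
  obtain a where a: "s = can P a" using s by (auto simp: topspace_range)
  have fCb: "f \<in> Cb ?X" by (rule C0_subset_Cb[OF Kc_subset_C0[OF f]])
  have fc: "continuous_map ?X euclidean f" using fCb by (simp add: Cb_def)
  define u where "u p = f (can P p)" for p
  have uCb: "u \<in> Cb euclidean" unfolding u_def by (rule rangeP_Cb[OF Cb_comp_can[OF fCb]])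
  note tr = translate_Cb(1)[OF uCb, of a]
  define K where "K = {q. can P q \<in> ?X closure_of {x \<in> topspace ?X. f x \<noteq> 0}}"
  have K: "compact K" unfolding K_def using f by (intro compact_can_preimage) (simp add: Kc_def)
  have "u p = 0" if "p \<notin> K" for p
    using that closure_of_subset[of "{x \<in> topspace ?X. f x \<noteq> 0}" ?X] can_in_topspace[of p]
    unfolding K_def u_def by blast
  then have "u (a + p) = 0" if "p \<notin> (+) (- a) ` K" for p
  proof -
    have "p = - a + (a + p)" by (simp add: add.assoc[symmetric])
    then have "a + p \<notin> K" using that by blast
    then show ?thesis by (rule \<open>\<And>p. p \<notin> K \<Longrightarrow> u p = 0\<close>)
  qed
  moreover have "compact ((+) (- a) ` K)" by (intro compact_continuous_image continuous_intros K)
  ultimately have "(\<lambda>p. u (a + p)) \<in> Kc euclidean"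
    unfolding Kc_euclidean_iff using Cb_euclideanD(1)[OF tr] by blast
  then have shift: "(\<integral>p. E p (\<lambda>y. u (a + y)) \<partial>m) = (\<integral>p. u (a + p) \<partial>m)"
    using inv[of "Bcontfun (\<lambda>p. u (a + p))"] by (simp add: apply_Bcontfun[OF tr] E_def)
  have slice: "(\<lambda>t. Q_comult P f (s, t)) \<in> Cb ?X" by (rule Cb_slice_right[OF Q_comult_Cb[OF fCb] s])
  have "(\<integral>t. pairing ?X f (Q_conv P (dirac ?X s) (dirac ?X t)) \<partial>?m) = (\<integral>t. Q_comult P f (s, t) \<partial>?m)"
    by (rule Bochner_Integration.integral_cong) (simp_all add: Q_conv_eq Q.pairing_conv_dirac[OF s _ fCb])
  also have "\<dots> = (\<integral>p. Q_comult P f (s, can P p) \<partial>m)"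
    using slice by (intro integral_distr_can[OF sets_m]) (simp add: Cb_def)
  also have "\<dots> = (\<integral>p. E p (\<lambda>y. u (a + y)) \<partial>m)" by (simp add: a Q_comult_can[OF fCb] u_def)
  also have "\<dots> = (\<integral>p. u (a + p) \<partial>m)" by (rule shift)
  also have "\<dots> = (\<integral>p. u p \<partial>m)" by (rule integral_left_translate[OF m Cb_euclideanD(1)[OF uCb]])
  also have "\<dots> = (\<integral>t. f t \<partial>?m)" unfolding u_def by (rule integral_distr_can[OF sets_m fc, symmetric])
  finally show "(\<integral>t. pairing ?X f (Q_conv P (dirac ?X s) (dirac ?X t)) \<partial>?m) = (\<integral>t. f t \<partial>?m)" .
qed

end

theorem theorem1:
  fixes P :: "('g::{topological_group_add, t2_space} \<Rightarrow>\<^sub>C complex) \<Rightarrow> ('g \<Rightarrow>\<^sub>C complex)"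
  assumes loc_compact: "locally_compact_space (euclidean :: 'g topology)"
    and P: "cond_expectation (range P) P"
    and one_a: "\<And>f. apply_bcontfun f \<in> Kc_plus euclidean \<Longrightarrow>
                  apply_bcontfun (P f) \<in> Kc_plus euclidean"
    and one_b: "\<And>p f. \<lbrakk>apply_bcontfun f \<in> Kc_plus euclidean; Re (apply_bcontfun f p) > 0\<rbrakk> \<Longrightarrow>
                  Re (can P p (P f)) > 0"
    and two_a: "\<And>f. P_id P (apply_bcontfun (comult (P f))) = id_P P (apply_bcontfun (comult (P f)))"
    and two_b: "\<And>f. id_P P (apply_bcontfun (comult (P f))) = P_P P (apply_bcontfun (comult f))"
    and two_c: "\<And>f. P (bc_check f) = bc_check (P f)"
  shows "(\<forall>f\<in>Cb (specQ P).
            Q_comult P f \<in> Cb (prod_topology (specQ P) (specQ P)) \<and>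
            (\<forall>p\<^sub>1 p\<^sub>2. Q_comult P f (can P p\<^sub>1, can P p\<^sub>2) =
                      P_P P (apply_bcontfun (comult (Bcontfun (f \<circ> can P)))) (p\<^sub>1, p\<^sub>2))) \<and>
         (\<forall>\<mu>\<^sub>1\<in>Mb (specQ P). \<forall>\<mu>\<^sub>2\<in>Mb (specQ P). is_Q_conv P \<mu>\<^sub>1 \<mu>\<^sub>2 (Q_conv P \<mu>\<^sub>1 \<mu>\<^sub>2)) \<and>
         hypergroup (specQ P) (Q_conv P) (Q_unit P) (Q_check P) \<and>
         (\<forall>m. group_left_haar m \<and>
              (\<forall>f. apply_bcontfun f \<in> Kc euclidean \<longrightarrow>
                 (\<integral>p. apply_bcontfun (P f) p \<partial>m) = (\<integral>p. apply_bcontfun f p \<partial>m)) \<longrightarrow>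
              hypergroup_left_haar (specQ P) (Q_conv P) (distr m (borel_of (specQ P)) (can P)) \<and>
              (\<forall>f\<in>Kc (specQ P).
                 (\<integral>s. f s \<partial>distr m (borel_of (specQ P)) (can P)) = (\<integral>p. f (can P p) \<partial>m)))"
proof -
  interpret group_expectation P
    by unfold_locales (rule loc_compact P one_a one_b two_a two_b two_c; assumption?)+
  show ?thesis
  proof (intro conjI allI ballI impI)
    fix f assume f: "f \<in> Cb (specQ P)"
    show "Q_comult P f \<in> Cb (prod_topology (specQ P) (specQ P))" by (rule Q_comult_Cb[OF f])
    show "Q_comult P f (can P p\<^sub>1, can P p\<^sub>2) =
        P_P P (apply_bcontfun (comult (Bcontfun (f \<circ> can P)))) (p\<^sub>1, p\<^sub>2)" for p\<^sub>1 p\<^sub>2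
      using Q_comult_can[OF f] rangeP_comult(2)[OF Cb_comp_can[OF f]] by (simp add: o_def)
  next
    fix \<mu>\<^sub>1 \<mu>\<^sub>2 assume "\<mu>\<^sub>1 \<in> Mb (specQ P)" "\<mu>\<^sub>2 \<in> Mb (specQ P)"
    then show "is_Q_conv P \<mu>\<^sub>1 \<mu>\<^sub>2 (Q_conv P \<mu>\<^sub>1 \<mu>\<^sub>2)"
      by (simp add: is_Q_conv_iff Q_conv_eq Q.is_conv_conv)
  next
    show "hypergroup (specQ P) (Q_conv P) (Q_unit P) (Q_check P)"
      unfolding Q_conv_eq by (rule Q.hypergroup_conv)
  next
    fix m :: "'g measure"
    assume m: "group_left_haar m \<and> (\<forall>f. apply_bcontfun f \<in> Kc euclidean \<longrightarrow>
                 (\<integral>p. apply_bcontfun (P f) p \<partial>m) = (\<integral>p. apply_bcontfun f p \<partial>m))"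
    then show "hypergroup_left_haar (specQ P) (Q_conv P) (distr m (borel_of (specQ P)) (can P))"
      by (intro left_haar_distr_can) auto
    fix f assume "f \<in> Kc (specQ P)"
    then show "(\<integral>s. f s \<partial>distr m (borel_of (specQ P)) (can P)) = (\<integral>p. f (can P p) \<partial>m)"
      using m by (intro integral_distr_can) (auto simp: Kc_def group_left_haar_def radon_measure_def)
  qed
qed

end
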